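(* Assume: (i) $\mathbb{E}[y^2\mid x]<\infty$ almost surely and $\mathrm{tr}[\mathbf{H}]<\infty$; (ii) there is $\tau>0$ such that $\mathbf{M}(\mathbf{A})\preceq \tau\,\mathrm{tr}[\mathbf{H}\mathbf{A}]\,\mathbf{H}$ for every PSD operator $\mathbf{A}$ on $\mathcal{H}$; (iii) $\sigma^2:=\|\mathbf{H}^{-1/2}\boldsymbol{\Sigma}\mathbf{H}^{-1/2}\|<\infty$. Let $0<\gamma<\frac{1}{\tau\,\mathrm{tr}[\mathbf{H}]}$ and $w_1=0$. Then the distributed (uniformly averaged) SGD estimator $\overline{\overline{w}}_M$ satisfies $$\mathbb{E}\big[L(\overline{\overline{w}}_M)\big]-L(w^* )\;\le\;2\,\mathrm{Bias}(\overline{\overline{w}}_M)+2\,\mathrm{Var}(\overline{\overline{w}}_M),$$ where, with $k^*=\max\{k:\lambda_k\ge \frac{M}{\gamma n}\}$ and $V_{k}(n,M)=\frac{k}{n}+\gamma^2\frac{n}{M^2}\sum_{j>k}\lambda_j^2$, $$\mathrm{Bias}(\overline{\overline{w}}_M)\le \frac{M^2}{\gamma^2n^2}\|w^*\|^2_{\mathbf{H}^\dagger_{0:k^*}}+\|w^*\|^2_{\mathbf{H}_{k^*:\infty}}+\frac{2\tau M^2\Big(\|w^*\|^2_{\mathbf{I}_{0:k^*}}+\gamma\frac{n}{M}\|w^*\|^2_{\mathbf{H}_{k^*:\infty}}\Big)}{\gamma n\,(1-\gamma\tau\,\mathrm{tr}[\mathbf{H}])}\cdot V_{k^*}(n,M)$$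 and $$\mathrm{Var}(\overline{\overline{w}}_M)\le\frac{\sigma^2}{1-\gamma\tau\,\mathrm{tr}[\mathbf{H}]}\cdot V_{k^*}(n,M).$$
   Context: Model. $\mathcal{H}$ is a real separable Hilbert space, $(x,y)\in\mathcal{H}\times\mathbb{R}$ a random pair with $y=\langle w^*,x\rangle+\epsilon$. $L(w)=\frac12\mathbb{E}[(y-\langle w,x\rangle)^2]$, and $w^*\in\mathcal{H}$ is the minimum-norm minimizer of $L$ over $\mathcal{H}$. Operators. $\mathbf{H}=\mathbb{E}[x\otimes x]$ (so $\mathbf{H}w=\mathbb{E}[\langle w,x\rangle x]$); $\mathbf{M}(\mathbf{A})w=\mathbb{E}[\langle x,\mathbf{A}x\rangle\langle w,x\rangle x]$ for bounded operators $\mathbf{A}$; $\boldsymbol{\Sigma}=\mathbb{E}[(\langle w^*,x\rangle-y)^2\,x\otimes x]$. $\|\mathbf{H}^{-1/2}\boldsymbol{\Sigma}\mathbf{H}^{-1/2}\|$ is the smallest constant $s$ with $\boldsymbol{\Sigma}\preceq s\,\mathbf{H}$. Eigendecomposition: $\mathbf{H}=\sum_{j\ge1}\lambda_j\,v_j\otimes v_j$, $\lambda_1\ge\lambda_2\ge\dots$. For $w\in\mathcal{H}$: $\|w\|^2_{\mathbf{H}^\dagger_{0:k}}=\sum_{j\le k}\langle w,v_j\rangle^2/\lambda_j$, $\|w\|^2_{\mathbf{H}_{k:\infty}}=\sum_{j>k}\lambda_j\langle w,v_j\rangle^2$, $\|w\|^2_{\mathbf{I}_{0:k}}=\sum_{j\le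 k}\langle w,v_j\rangle^2$. Convention: $k^*=0$ if no $k$ satisfies the defining condition. Distributed SGD. $n$ i.i.d. copies of $(x,y)$ are split evenly into $M$ disjoint local data sets $(x^{(m)}_t,y^{(m)}_t)_{t=1}^{n/M}$, $m=1,\dots,M$ ($M$ divides $n$). With stepsize $\gamma>0$ and common initialization $w^{(m)}_1=w_1$, $$w^{(m)}_{t+1}=w^{(m)}_t-\gamma\big(\langle w^{(m)}_t,x^{(m)}_t\rangle-y^{(m)}_t\big)x^{(m)}_t .$$ Set $\bar w^{(m)}=\frac{M}{n}\sum_{t=1}^{n/M}w^{(m)}_t$ and $\overline{\overline{w}}_M=\frac1M\sum_{m=1}^M\bar w^{(m)}$. Bias and variance. Let $\epsilon^{(m)}_t=y^{(m)}_t-\langle x^{(m)}_t,w^*\rangle$, $b^{(m)}_1=w_1-w^*$, $b^{(m)}_{t+1}=(\mathbf{I}-\gamma x^{(m)}_t\otimes x^{(m)}_t)b^{(m)}_t$, $v^{(m)}_1=0$, $v^{(m)}_{t+1}=(\mathbf{I}-\gamma x^{(m)}_t\otimes x^{(m)}_t)v^{(m)}_t+\gamma\epsilon^{(m)}_tx^{(m)}_t$. Let $\overline{\overline{b}}_M=\frac1M\sum_m\frac Mn\sum_{t=1}^{n/M}b^{(m)}_t$, and $\overline{\overline{v}}_M$ analogously. Then $\mathrm{Bias}(\overline{\overline{w}}_M)=\frac12\mathbb{E}\langle\overline{\overline{b}}_M,\mathbf{H}\overline{\overline{b}}_M\rangle$ and $\mathrm{Var}(\overline{\overline{w}}_M)=\frac12\mathbb{E}\langle\overline{\overline{v}}_M,\mathbf{H}\overline{\overline{v}}_M\rangle$.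 *)

theory Defs
  imports "HOL-Probability.Probability"
begin

section \<open>Operators on a real Hilbert space\<close>

definition psd :: "('h::real_inner \<Rightarrow> 'h) \<Rightarrow> bool" where
  "psd A \<longleftrightarrow> bounded_linear A \<and> (\<forall>u w. inner (A u) w = inner u (A w)) \<and> (\<forall>w. 0 \<le> inner w (A w))"

definition loewner_le :: "('h::real_inner \<Rightarrow> 'h) \<Rightarrow> ('h \<Rightarrow> 'h) \<Rightarrow> bool" where
  "loewner_le A B \<longleftrightarrow> psd (\<lambda>w. B w - A w)"

definition orthonormal_basis :: "'h::real_inner set \<Rightarrow> bool" where
  "orthonormal_basis B \<longleftrightarrow>
     pairwise orthogonal B \<and> (\<forall>e\<in>B. norm e = 1) \<and> closure (span B) = UNIV"

text \<open>The trace is required not to depend on the orthonormal basis; for a positive operator,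
  existence of \<open>t\<close> with \<open>has_trace T t\<close> is finiteness of the trace.\<close>

definition has_trace :: "('h::real_inner \<Rightarrow> 'h) \<Rightarrow> real \<Rightarrow> bool" where
  "has_trace T t \<longleftrightarrow> (\<forall>B. orthonormal_basis B \<longrightarrow> ((\<lambda>e. inner e (T e)) has_sum t) B)"

definition op_trace :: "('h::real_inner \<Rightarrow> 'h) \<Rightarrow> real" where
  "op_trace T = (THE t. has_trace T t)"

text \<open>The norm of \<open>H\<^sup>-\<^sup>1\<^sup>/\<^sup>2 S H\<^sup>-\<^sup>1\<^sup>/\<^sup>2\<close>, i.e. the smallest constant \<open>s\<close> with \<open>S \<preceq> s H\<close>.
  The restriction to \<open>s \<ge> 0\<close> only matters for \<open>H = 0\<close>.\<close>

definition whitened_bounded :: "('h::real_inner \<Rightarrow> 'h) \<Rightarrow> ('h \<Rightarrow> 'h) \<Rightarrow> bool" where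
  "whitened_bounded H S \<longleftrightarrow> (\<exists>s\<ge>0. loewner_le S (\<lambda>w. s *\<^sub>R H w))"

definition whitened_norm :: "('h::real_inner \<Rightarrow> 'h) \<Rightarrow> ('h \<Rightarrow> 'h) \<Rightarrow> real" where
  "whitened_norm H S = Inf {s. 0 \<le> s \<and> loewner_le S (\<lambda>w. s *\<^sub>R H w)}"

text \<open>Indices start at 1; \<open>lam 0\<close> and \<open>v 0\<close> are never used. When there are only
  finitely many eigenvectors to list (e.g. in finite dimension), the sequences are padded
  by \<open>lam j = 0\<close>, \<open>v j = 0\<close>.\<close>

definition eigendecomposition ::
    "('h::real_inner \<Rightarrow> 'h) \<Rightarrow> (nat \<Rightarrow> real) \<Rightarrow> (nat \<Rightarrow> 'h) \<Rightarrow> bool" where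
  "eigendecomposition T lam v \<longleftrightarrow>
     (\<forall>i\<ge>1. \<forall>j\<ge>i. lam j \<le> lam i) \<and>
     (\<forall>i\<ge>1. \<forall>j\<ge>1. i \<noteq> j \<longrightarrow> orthogonal (v i) (v j)) \<and>
     (\<forall>j\<ge>1. norm (v j) = 1 \<or> (lam j = 0 \<and> v j = 0)) \<and>
     (\<forall>w. ((\<lambda>j. (lam j * inner w (v j)) *\<^sub>R v j) has_sum T w) {1..})"

definition normsq_pinv_head :: "(nat \<Rightarrow> real) \<Rightarrow> (nat \<Rightarrow> 'h::real_inner) \<Rightarrow> nat \<Rightarrow> 'h \<Rightarrow> real" where
  "normsq_pinv_head lam v k w = (\<Sum>j=1..k. (inner w (v j))\<^sup>2 / lam j)"

definition normsq_id_head :: "(nat \<Rightarrow> 'h::real_inner) \<Rightarrow> nat \<Rightarrow> 'h \<Rightarrow> real" where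
  "normsq_id_head v k w = (\<Sum>j=1..k. (inner w (v j))\<^sup>2)"

definition normsq_tail :: "(nat \<Rightarrow> real) \<Rightarrow> (nat \<Rightarrow> 'h::real_inner) \<Rightarrow> nat \<Rightarrow> 'h \<Rightarrow> real" where
  "normsq_tail lam v k w = (\<Sum>\<^sub>\<infinity>j\<in>{k<..}. lam j * (inner w (v j))\<^sup>2)"


section \<open>The regression model\<close>

definition risk :: "'a measure \<Rightarrow> ('a \<Rightarrow> 'h::real_inner) \<Rightarrow> ('a \<Rightarrow> real) \<Rightarrow> 'h \<Rightarrow> real" where
  "risk P x y w = 1/2 * (\<integral>\<omega>. (y \<omega> - inner w (x \<omega>))\<^sup>2 \<partial>P)"

definition min_norm_minimizer :: "('h::real_inner \<Rightarrow> real) \<Rightarrow> 'h \<Rightarrow> bool" where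
  "min_norm_minimizer f w \<longleftrightarrow> is_arg_min norm (is_arg_min f (\<lambda>_. True)) w"

text \<open>The operator \<open>E[g x \<otimes> x]\<close> for a real random variable \<open>g\<close>. Bochner integrals of
  non-integrable functions are \<open>0\<close>, so existence is a separate predicate.\<close>

definition moment_op ::
    "'a measure \<Rightarrow> ('a \<Rightarrow> 'h::{real_inner,banach,second_countable_topology}) \<Rightarrow> ('a \<Rightarrow> real) \<Rightarrow> 'h \<Rightarrow> 'h" where
  "moment_op P x g w = (\<integral>\<omega>. (g \<omega> * inner w (x \<omega>)) *\<^sub>R x \<omega> \<partial>P)"

definition moment_op_exists ::
    "'a measure \<Rightarrow> ('a \<Rightarrow> 'h::{real_inner,banach,second_countable_topology}) \<Rightarrow> ('a \<Rightarrow> real) \<Rightarrow> bool" where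
  "moment_op_exists P x g \<longleftrightarrow> (\<forall>w. integrable P (\<lambda>\<omega>. (g \<omega> * inner w (x \<omega>)) *\<^sub>R x \<omega>))"


section \<open>Distributed SGD\<close>

text \<open>The iterations start at time 1; the value at time 0 is a dummy. They are stated for one
  machine, with \<open>x t\<close> and \<open>y t\<close> its local sample at time \<open>t\<close>.\<close>

primrec sgd_iter :: "real \<Rightarrow> 'h::real_inner \<Rightarrow> (nat \<Rightarrow> 'h) \<Rightarrow> (nat \<Rightarrow> real) \<Rightarrow> nat \<Rightarrow> 'h" where
  "sgd_iter \<gamma> w1 x y 0 = w1"
| "sgd_iter \<gamma> w1 x y (Suc t) =
     (if t = 0 then w1
      else sgd_iter \<gamma> w1 x y t - (\<gamma> * (inner (sgd_iter \<gamma> w1 x y t) (x t) - y t)) *\<^sub>R x t)"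

primrec bias_iter :: "real \<Rightarrow> 'h::real_inner \<Rightarrow> (nat \<Rightarrow> 'h) \<Rightarrow> nat \<Rightarrow> 'h" where
  "bias_iter \<gamma> b1 x 0 = b1"
| "bias_iter \<gamma> b1 x (Suc t) =
     (if t = 0 then b1
      else bias_iter \<gamma> b1 x t - (\<gamma> * inner (bias_iter \<gamma> b1 x t) (x t)) *\<^sub>R x t)"

primrec var_iter :: "real \<Rightarrow> (nat \<Rightarrow> 'h::real_inner) \<Rightarrow> (nat \<Rightarrow> real) \<Rightarrow> nat \<Rightarrow> 'h" where
  "var_iter \<gamma> x \<epsilon> 0 = 0"
| "var_iter \<gamma> x \<epsilon> (Suc t) =
     (if t = 0 then 0
      else var_iter \<gamma> x \<epsilon> t - (\<gamma> * inner (var_iter \<gamma> x \<epsilon> t) (x t)) *\<^sub>R x t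
             + (\<gamma> * \<epsilon> t) *\<^sub>R x t)"

definition dist_avg :: "nat \<Rightarrow> nat \<Rightarrow> (nat \<Rightarrow> nat \<Rightarrow> 'h::real_vector) \<Rightarrow> 'h" where
  "dist_avg n M u =
     (1 / real M) *\<^sub>R (\<Sum>m=1..M. (real M / real n) *\<^sub>R (\<Sum>t=1..n div M. u m t))"

definition half_energy :: "'b measure \<Rightarrow> ('h::real_inner \<Rightarrow> 'h) \<Rightarrow> ('b \<Rightarrow> 'h) \<Rightarrow> real" where
  "half_energy Q H u = 1/2 * (\<integral>\<omega>. inner (u \<omega>) (H (u \<omega>)) \<partial>Q)"

definition cutoff_index :: "(nat \<Rightarrow> real) \<Rightarrow> real \<Rightarrow> nat" where
  "cutoff_index lam \<theta> =
     (if \<exists>k\<ge>1. lam k \<ge> \<theta> then Max {k. k \<ge> 1 \<and> lam k \<ge> \<theta>} else 0)"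

definition V_term :: "(nat \<Rightarrow> real) \<Rightarrow> real \<Rightarrow> nat \<Rightarrow> nat \<Rightarrow> nat \<Rightarrow> real" where
  "V_term lam \<gamma> n M k =
     real k / real n + \<gamma>\<^sup>2 * (real n / (real M)\<^sup>2) * (\<Sum>\<^sub>\<infinity>j\<in>{k<..}. (lam j)\<^sup>2)"

end

(* Everything is done on scalar moments E <z,u>^2 of the iterates, without operator-valued
   covariances. The fourth-moment assumption is only needed for A = I and for rank-one A, where it
   says E |x|^2 <u,x>^2 <= tau tr(H) <u,Hu> and E <b,x>^2 <u,x>^2 <= tau <b,Hb> <u,Hu>; the second
   form can be averaged over an independent random b.

   Along an eigenvector v with eigenvalue l, the correlations of the iterates decay by the factor
   r = 1 - gamma l per time step, so the second moment of the time average is at most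
   2 (1 - r^N) / (gamma l N^2) times the sum of the second moments q_t. These satisfy
   q_{t+1} <= r^2 q_t + (forcing). For the variance, E <z,u>^2 <= K |u|^2 bounds the forcing by
   gamma l K, whence q_t <= K (1 - r^(t-1)), and different machines are uncorrelated. For the bias,
   the forcing is gamma^2 tau l E <z_t, H z_t>, and the sum of E <z_t, H z_t> over t is bounded by
   telescoping E |z_t|^2 and comparing its last value with the norm of the mean; the machines are
   averaged by convexity. Finally 1 - r^N is at most 1 and at most N gamma l, which gives the head
   and the tail for any splitting index k. *)

theory Submission
  imports Defs
begin

section \<open>Orthonormal bases and traces\<close>

text \<open>Minimality of \<open>wstar\<close> gives only E[e x] = 0; the noise may depend on x and
  need not be centred given x. In one step the cross term of contracted iterate and noise contains
  the same sample twice, so conditioning on the past does not remove it. Conditioning on the sample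
  does, if the iterate has mean zero, which holds for the start 0. Hence bias and variance iterates
  are kept apart, and |b + v|^2 \<le> 2 |b|^2 + 2 |v|^2 in the seminorm of H joins them at the end.

  Iterate and current sample are independent, so E <z,x>^2 <u,x>^2 can be integrated in either
  order. Given the past, the rank-one case yields \<tau> <u,Hu> E <z,Hz>, used for the bias. Given
  the sample, <z,x>^2 averages to at most K |x|^2 and the case A = I yields K \<tau> tr(H) <u,Hu>,
  used for the variance. There K solves K = \<gamma> \<sigma>^2 + \<gamma> \<tau> tr(H) K, the
  origin of the denominator 1 - \<gamma> \<tau> tr(H).

  The decay estimates need 0 \<le> r \<le> 1, while the stepsize condition concerns \<tau> tr(H).
  The bridge is \<tau> \<ge> 1 as soon as some eigenvalue is nonzero, by Jensen for <v,x>^2.\<close>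

definition orthonormal :: "'h::real_inner set \<Rightarrow> bool" where
  "orthonormal F \<longleftrightarrow> (\<forall>e\<in>F. \<forall>f\<in>F. inner e f = (if e = f then 1 else 0))"

lemma orthonormal_basis_iff:
  "orthonormal_basis B \<longleftrightarrow> orthonormal B \<and> closure (span B) = UNIV"
  unfolding orthonormal_basis_def orthonormal_def pairwise_def orthogonal_def norm_eq_1
  by metis

lemma orthonormal_subset: "orthonormal B \<Longrightarrow> F \<subseteq> B \<Longrightarrow> orthonormal F"
  unfolding orthonormal_def by blast

lemma inner_sum_orthonormal:
  assumes "orthonormal F" "finite F" "f \<in> F"
  shows "inner (\<Sum>e\<in>F. c e *\<^sub>R e) f = c f"
proof -
  have "inner (\<Sum>e\<in>F. c e *\<^sub>R e) f = (\<Sum>e\<in>F. if e = f then c e else 0)"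
    using assms unfolding inner_sum_left orthonormal_def
    by (intro sum.cong) auto
  then show ?thesis using assms by simp
qed

text \<open>Completing the square in the coefficients isolates the cost of a wrong choice
  \<open>c\<close>. With \<open>c e = inner a e\<close> it gives Bessel's inequality; for arbitrary
  \<open>c\<close> it shows that no combination over \<open>F\<close> comes closer to
  \<open>a\<close> than the projection.\<close>

lemma norm_sq_diff_orthonormal:
  assumes "orthonormal F" "finite F"
  shows "(norm (a - (\<Sum>e\<in>F. c e *\<^sub>R e)))\<^sup>2
    = (norm a)\<^sup>2 - (\<Sum>e\<in>F. (inner a e)\<^sup>2) + (\<Sum>e\<in>F. (c e - inner a e)\<^sup>2)"
proof -
  let ?s = "\<Sum>e\<in>F. c e *\<^sub>R e"
  have "inner ?s ?s = (\<Sum>e\<in>F. c e * inner ?s e)"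
    by (subst inner_sum_right) simp
  also have "\<dots> = (\<Sum>e\<in>F. (c e)\<^sup>2)"
    using assms by (simp add: inner_sum_orthonormal power2_eq_square)
  finally have ss: "inner ?s ?s = (\<Sum>e\<in>F. (c e)\<^sup>2)" .
  have as: "inner a ?s = (\<Sum>e\<in>F. c e * inner a e)"
    by (simp add: inner_sum_right)
  have "(norm (a - ?s))\<^sup>2 = inner a a - 2 * inner a ?s + inner ?s ?s"
    unfolding power2_norm_eq_inner by (simp add: inner_diff_left inner_diff_right inner_commute)
  also have "\<dots> = (norm a)\<^sup>2 + (\<Sum>e\<in>F. (c e)\<^sup>2 - 2 * (c e * inner a e))"
    by (simp add: ss as sum_subtractf sum_distrib_left power2_norm_eq_inner)
  also have "(\<Sum>e\<in>F. (c e)\<^sup>2 - 2 * (c e * inner a e))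
      = (\<Sum>e\<in>F. (c e - inner a e)\<^sup>2 - (inner a e)\<^sup>2)"
    by (intro sum.cong) (auto simp: power2_eq_square algebra_simps)
  finally show ?thesis by (simp add: sum_subtractf)
qed

lemma bessel:
  assumes "orthonormal F" "finite F"
  shows "(\<Sum>e\<in>F. (inner a e)\<^sup>2) \<le> (norm a)\<^sup>2"
proof -
  have "0 \<le> (norm (a - (\<Sum>e\<in>F. inner a e *\<^sub>R e)))\<^sup>2" by simp
  also have "\<dots> = (norm a)\<^sup>2 - (\<Sum>e\<in>F. (inner a e)\<^sup>2)"
    using norm_sq_diff_orthonormal[OF assms, of a "inner a"] by simp
  finally show ?thesis by simp
qed

text \<open>Density of the span suffices: a finite combination within \<open>sqrt r\<close> of
  \<open>a\<close> has a support \<open>t\<close>, the optimal coefficients on \<open>t\<close> do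
  at least as well, and enlarging \<open>t\<close> only shrinks the defect, which Bessel keeps
  nonnegative.\<close>

lemma parseval_norm:
  assumes B: "orthonormal_basis B"
  shows "((\<lambda>e. (inner a e)\<^sup>2) has_sum (norm a)\<^sup>2) B"
  unfolding has_sum_def
proof (rule tendstoI)
  fix r :: real assume r: "r > 0"
  have oB: "orthonormal B" and cl: "closure (span B) = UNIV"
    using B unfolding orthonormal_basis_iff by auto
  have "a \<in> closure (span B)" using cl by simp
  then obtain s where s: "s \<in> span B" "dist s a < sqrt r"
    using r unfolding closure_approachable by (meson real_sqrt_gt_0_iff)
  obtain t c where t: "finite t" "t \<subseteq> B" "s = (\<Sum>e\<in>t. c e *\<^sub>R e)"
    using s(1) unfolding span_explicit by auto
  have "\<exists>X. finite X \<and> X \<subseteq> B \<and> (\<forall>Y. finite Y \<and> X \<subseteq> Y \<and> Y \<subseteq> B \<longrightarrow>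
      dist (\<Sum>e\<in>Y. (inner a e)\<^sup>2) ((norm a)\<^sup>2) < r)"
  proof (intro exI[of _ t] conjI allI impI t)
    fix Y assume Y: "finite Y \<and> t \<subseteq> Y \<and> Y \<subseteq> B"
    have oY: "orthonormal Y" using oB Y orthonormal_subset by blast
    have "(norm a)\<^sup>2 - (\<Sum>e\<in>Y. (inner a e)\<^sup>2) \<le> (norm a)\<^sup>2 - (\<Sum>e\<in>t. (inner a e)\<^sup>2)"
      using Y by (auto intro!: sum_mono2)
    also have "\<dots> \<le> (norm (a - s))\<^sup>2"
      using norm_sq_diff_orthonormal[OF orthonormal_subset[OF oB t(2)] t(1), of a c] t(3)
      by (simp add: sum_nonneg)
    also have "\<dots> < r"
      using s(2) r by (metis dist_commute dist_norm norm_ge_zero real_less_rsqrt real_sqrt_less_iff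
          real_sqrt_abs abs_norm_cancel)
    finally have "(norm a)\<^sup>2 - (\<Sum>e\<in>Y. (inner a e)\<^sup>2) < r" .
    moreover have "(\<Sum>e\<in>Y. (inner a e)\<^sup>2) \<le> (norm a)\<^sup>2" using bessel oY Y by blast
    ultimately show "dist (\<Sum>e\<in>Y. (inner a e)\<^sup>2) ((norm a)\<^sup>2) < r"
      by (simp add: dist_real_def)
  qed
  then show "\<forall>\<^sub>F Y in finite_subsets_at_top B. dist (\<Sum>e\<in>Y. (inner a e)\<^sup>2) ((norm a)\<^sup>2) < r"
    unfolding eventually_finite_subsets_at_top .
qed

text \<open>Polarisation of \<open>parseval_norm\<close>, which settles the summability of the
  products as well.\<close>

lemma parseval:
  assumes B: "orthonormal_basis B"
  shows "((\<lambda>e. inner a e * inner b e) has_sum inner a b) B"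
proof -
  have "((\<lambda>e. ((inner (a + b) e)\<^sup>2 - (inner (a - b) e)\<^sup>2) / 4)
      has_sum (((norm (a + b))\<^sup>2 - (norm (a - b))\<^sup>2) / 4)) B"
    unfolding divide_inverse diff_conv_add_uminus[of "_\<^sup>2"]
    by (intro has_sum_cmult_left has_sum_add has_sum_uminusI parseval_norm B)
  moreover have "((norm (a + b))\<^sup>2 - (norm (a - b))\<^sup>2) / 4 = inner a b"
    by (simp add: power2_norm_eq_inner inner_add_left inner_add_right
        inner_diff_left inner_diff_right inner_commute)
  moreover have "((inner (a + b) e)\<^sup>2 - (inner (a - b) e)\<^sup>2) / 4 = inner a e * inner b e" for e
    by (simp add: inner_add_left inner_diff_left power2_eq_square algebra_simps)
  ultimately show ?thesis by simp
qed

text \<open>A zero residual leaves the set unchanged, so the enumerated vectors may repeat or be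
  linearly dependent, as happens in a dense sequence.\<close>

primrec gram_schmidt :: "(nat \<Rightarrow> 'h::real_inner) \<Rightarrow> nat \<Rightarrow> 'h set" where
  "gram_schmidt d 0 = {}"
| "gram_schmidt d (Suc n) =
     (let r = d n - (\<Sum>e\<in>gram_schmidt d n. inner (d n) e *\<^sub>R e)
      in if r = 0 then gram_schmidt d n else insert (r /\<^sub>R norm r) (gram_schmidt d n))"

lemma gram_schmidt_orthonormal:
  "finite (gram_schmidt d n) \<and> orthonormal (gram_schmidt d n)"
proof (induction n)
  case (Suc n)
  let ?B = "gram_schmidt d n"
  define r where "r = d n - (\<Sum>e\<in>?B. inner (d n) e *\<^sub>R e)"
  have r: "inner r f = 0" if "f \<in> ?B" for f
    unfolding r_def inner_diff_left
    using inner_sum_orthonormal[of ?B f "inner (d n)"] that Suc by simp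
  have "orthonormal (insert (r /\<^sub>R norm r) ?B)" if "r \<noteq> 0"
  proof -
    have rr: "inner (r /\<^sub>R norm r) (r /\<^sub>R norm r) = 1"
      unfolding norm_eq_1[symmetric] using that by simp
    have rf: "inner (r /\<^sub>R norm r) f = 0" "inner f (r /\<^sub>R norm r) = 0" if "f \<in> ?B" for f
      using r[OF that] by (simp_all add: inner_commute)
    have nB: "r /\<^sub>R norm r \<notin> ?B" using rf rr by force
    have oB: "\<And>e f. e \<in> ?B \<Longrightarrow> f \<in> ?B \<Longrightarrow> inner e f = (if e = f then 1 else 0)"
      using Suc unfolding orthonormal_def by blast
    show ?thesis
      unfolding orthonormal_def using rr rf nB oB by auto
  qed
  then show ?case using Suc by (simp add: Let_def flip: r_def)
qed (simp add: orthonormal_def)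

lemma gram_schmidt_span: "d n \<in> span (gram_schmidt d (Suc n))"
proof -
  let ?B = "gram_schmidt d n"
  define r where "r = d n - (\<Sum>e\<in>?B. inner (d n) e *\<^sub>R e)"
  have B': "gram_schmidt d (Suc n) = (if r = 0 then ?B else insert (r /\<^sub>R norm r) ?B)"
    by (simp add: Let_def r_def)
  have "(\<Sum>e\<in>?B. inner (d n) e *\<^sub>R e) \<in> span (gram_schmidt d (Suc n))"
    unfolding B' by (intro span_sum span_scale span_base) auto
  moreover have "r \<in> span (gram_schmidt d (Suc n))"
  proof (cases "r = 0")
    case False
    then have "r = norm r *\<^sub>R (r /\<^sub>R norm r)" by simp
    then show ?thesis using False unfolding B'
      by (metis insertI1 span_base span_scale)
  qed (simp add: span_zero)
  ultimately have "r + (\<Sum>e\<in>?B. inner (d n) e *\<^sub>R e) \<in> span (gram_schmidt d (Suc n))"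
    by (rule span_add[rotated])
  then show ?thesis by (simp add: r_def)
qed

text \<open>\<open>has_trace\<close> quantifies over all orthonormal bases and would hold for every
  number if there were none; existence is what makes the trace unique. Gram-Schmidt runs on a
  countable dense set, each member of which ends up in the span.\<close>

lemma orthonormal_basis_exists:
  "\<exists>B :: 'h::{real_inner,second_countable_topology} set. orthonormal_basis B"
proof -
  obtain D :: "'h set" where D: "countable D" "\<And>X. open X \<Longrightarrow> X \<noteq> {} \<Longrightarrow> \<exists>d\<in>D. d \<in> X"
    using countable_dense_exists by blast
  have "D \<noteq> {}" using D(2)[OF open_UNIV UNIV_not_empty] by blast
  then have d: "range (from_nat_into D) = D" using D(1) by (rule range_from_nat_into)
  define d where "d = from_nat_into D"
  define B where "B = (\<Union>n. gram_schmidt d n)"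
  have mono: "gram_schmidt d m \<subseteq> gram_schmidt d n" if "m \<le> n" for m n
    by (rule lift_Suc_mono_le[OF _ that]) (auto simp: Let_def)
  have "orthonormal B"
    unfolding orthonormal_def
  proof (intro ballI)
    fix e f assume "e \<in> B" "f \<in> B"
    then obtain m n where "e \<in> gram_schmidt d m" "f \<in> gram_schmidt d n"
      by (auto simp: B_def)
    then have "e \<in> gram_schmidt d (max m n)" "f \<in> gram_schmidt d (max m n)"
      using mono[of m "max m n"] mono[of n "max m n"] by auto
    then show "inner e f = (if e = f then 1 else 0)"
      using gram_schmidt_orthonormal unfolding orthonormal_def by blast
  qed
  moreover have "closure (span B) = UNIV"
  proof (rule ccontr)
    assume "closure (span B) \<noteq> UNIV"
    then obtain i where "d i \<in> - closure (span B)"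
      using D(2)[of "- closure (span B)"] d unfolding d_def by (metis Compl_UNIV_eq
          boolean_algebra.de_Morgan_conj closed_closure double_complement imageE open_Compl)
    moreover have "gram_schmidt d (Suc i) \<subseteq> B" unfolding B_def by blast
    then have "d i \<in> span B" using gram_schmidt_span[of d i] span_mono by blast
    ultimately show False using closure_subset by blast
  qed
  ultimately show ?thesis unfolding orthonormal_basis_iff by auto
qed

lemma has_trace_op_trace:
  fixes T :: "'h::{real_inner,second_countable_topology} \<Rightarrow> 'h"
  assumes "has_trace T t"
  shows "op_trace T = t"
  unfolding op_trace_def
proof (rule the_equality)
  show "has_trace T t" by (rule assms)
  fix s assume "has_trace T s"
  then show "s = t"
    using assms orthonormal_basis_exists[where 'h = 'h] has_sum_unique unfolding has_trace_def by metis
qed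

text \<open>Along a basis the terms are <b,e> <T b,e>, which Parseval sums. With
  \<open>T = H\<close> this evaluates the trace in the fourth-moment hypothesis for A = b \<otimes>
  b.\<close>

lemma op_trace_rank_one:
  fixes T :: "'h::{real_inner,second_countable_topology} \<Rightarrow> 'h"
  assumes "linear T"
  shows "op_trace (\<lambda>u. T (inner b u *\<^sub>R b)) = inner b (T b)"
proof (rule has_trace_op_trace)
  show "has_trace (\<lambda>u. T (inner b u *\<^sub>R b)) (inner b (T b))"
    unfolding has_trace_def using parseval[of _ b "T b"] assms
    by (simp add: linear_scale inner_commute)
qed

lemma psd_rank_one: "psd (\<lambda>u. inner b u *\<^sub>R b)"
  unfolding psd_def
  by (auto simp: inner_commute power2_eq_square
      intro!: bounded_linear_scaleR_left[THEN bounded_linear_compose] bounded_linear_inner_right)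

lemma psd_id: "psd (\<lambda>u. u)"
  by (simp add: psd_def bounded_linear_ident)

section \<open>Spectral decomposition of a trace-class operator\<close>

lemma has_sum_sum_finite:
  fixes f :: "'i \<Rightarrow> 'a \<Rightarrow> real"
  assumes "finite F" "\<And>i. i \<in> F \<Longrightarrow> (f i has_sum s i) A"
  shows "((\<lambda>x. \<Sum>i\<in>F. f i x) has_sum (\<Sum>i\<in>F. s i)) A"
  using assms by (induction F rule: finite_induct) (auto intro!: has_sum_add has_sum_0)

locale spectral =
  fixes H :: "'h::{real_inner,second_countable_topology} \<Rightarrow> 'h" and lam v T
  assumes eig: "eigendecomposition H lam v"
    and H_nonneg: "\<And>w. 0 \<le> inner w (H w)"
    and H_trace: "has_trace H T"
begin

lemma v_unit: "j \<ge> 1 \<Longrightarrow> norm (v j) = 1 \<or> lam j = 0 \<and> v j = 0"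
  and v_orthogonal: "i \<ge> 1 \<Longrightarrow> j \<ge> 1 \<Longrightarrow> i \<noteq> j \<Longrightarrow> inner (v i) (v j) = 0"
  and H_has_sum: "((\<lambda>j. (lam j * inner w (v j)) *\<^sub>R v j) has_sum H w) {1..}"
  using eig unfolding eigendecomposition_def orthogonal_def by blast+

lemma norm_v_le: "j \<ge> 1 \<Longrightarrow> norm (v j) \<le> 1"
  using v_unit[of j] by auto

lemma H_v:
  assumes "j \<ge> 1"
  shows "H (v j) = lam j *\<^sub>R v j"
proof -
  have "((\<lambda>i. (lam i * inner (v j) (v i)) *\<^sub>R v i) has_sum (lam j * inner (v j) (v j)) *\<^sub>R v j) {1..}"
    using assms v_orthogonal by (intro has_sum_finite_neutralI[of "{j}"]) auto
  moreover have "(lam j * inner (v j) (v j)) *\<^sub>R v j = lam j *\<^sub>R v j"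
    using v_unit[OF assms] by (auto simp: norm_eq_1)
  ultimately show ?thesis using has_sum_unique[OF H_has_sum[of "v j"]] by simp
qed

lemma lam_nonneg: "j \<ge> 1 \<Longrightarrow> 0 \<le> lam j"
  using v_unit[of j] H_v[of j] H_nonneg[of "v j"] by (auto simp: norm_eq_1)

lemma quad_has_sum: "((\<lambda>j. lam j * (inner w (v j))\<^sup>2) has_sum inner w (H w)) {1..}"
  using has_sum_bounded_linear[OF bounded_linear_inner_right[of w] H_has_sum[of w]]
  by (simp add: o_def power2_eq_square mult.assoc)

text \<open>The \<open>v j\<close> need not form a basis, since kernel directions of
  \<open>H\<close> may be missing, so the trace cannot simply be read off along them. Over any
  basis, Parseval spreads each \<open>lam j\<close> into terms lam j <v j,e>^2, and for fixed e
  their finite sums stay below <e,He>.\<close>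

lemma sum_lam_le:
  assumes F: "finite F" "F \<subseteq> {1..}"
  shows "(\<Sum>j\<in>F. lam j) \<le> T"
proof -
  obtain B :: "'h set" where B: "orthonormal_basis B" using orthonormal_basis_exists by blast
  have "((\<lambda>e. \<Sum>j\<in>F. lam j * (inner (v j) e)\<^sup>2) has_sum (\<Sum>j\<in>F. lam j * (norm (v j))\<^sup>2)) B"
    by (intro has_sum_sum_finite F has_sum_cmult_right parseval_norm B)
  moreover have "((\<lambda>e. inner e (H e)) has_sum T) B"
    using H_trace B unfolding has_trace_def by blast
  moreover have "(\<Sum>j\<in>F. lam j * (inner (v j) e)\<^sup>2) \<le> inner e (H e)" for e
    using lam_nonneg unfolding inner_commute[of "v _"]
    by (intro finite_sum_le_has_sum[OF quad_has_sum F]) auto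
  ultimately have "(\<Sum>j\<in>F. lam j * (norm (v j))\<^sup>2) \<le> T"
    using has_sum_mono by blast
  moreover have "lam j * (norm (v j))\<^sup>2 = lam j" if "j \<in> F" for j
    using v_unit[of j] subsetD[OF F(2) that] by auto
  ultimately show ?thesis by simp
qed

lemma lam_le: "j \<ge> 1 \<Longrightarrow> lam j \<le> T"
  using sum_lam_le[of "{j}"] by simp

lemma T_nonneg: "0 \<le> T"
  using sum_lam_le[of "{}"] by simp

lemma lam_summable: "lam summable_on {1..}"
  using sum_lam_le lam_nonneg
  by (intro nonneg_bdd_above_summable_on bdd_aboveI2[where M = T]) auto

lemma lam_sq_summable: "(\<lambda>j. (lam j)\<^sup>2) summable_on {1..}"
proof (rule summable_on_comparison_test)
  show "(\<lambda>j. T * lam j) summable_on {1..}" by (intro summable_on_cmult_right lam_summable)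
qed (use lam_le lam_nonneg in \<open>auto simp: power2_eq_square intro: mult_right_mono\<close>)

text \<open>Each squared coordinate is at most |w|^2 and the eigenvalues sum to at most
  \<open>T\<close>. This later makes \<open>H\<close> a bounded operator.\<close>

lemma quad_le: "inner w (H w) \<le> T * (norm w)\<^sup>2"
proof (rule has_sum_le_finite_sums[OF quad_has_sum])
  fix F :: "nat set" assume F: "finite F" "F \<subseteq> {1..}"
  have "(\<Sum>j\<in>F. lam j * (inner w (v j))\<^sup>2) \<le> (\<Sum>j\<in>F. lam j * (norm w)\<^sup>2)"
  proof (intro sum_mono mult_left_mono)
    fix j assume "j \<in> F"
    then have j: "j \<ge> 1" using F by auto
    show "0 \<le> lam j" by (rule lam_nonneg[OF j])
    have "\<bar>inner w (v j)\<bar> \<le> norm w"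
      using Cauchy_Schwarz_ineq2[of w "v j"] mult_left_le[OF norm_v_le[OF j], of "norm w"] by simp
    then show "(inner w (v j))\<^sup>2 \<le> (norm w)\<^sup>2" by (simp add: abs_le_square_iff[symmetric])
  qed
  also have "\<dots> \<le> T * (norm w)\<^sup>2"
    using sum_lam_le[OF F] by (simp add: sum_distrib_right[symmetric] mult_right_mono)
  finally show "(\<Sum>j\<in>F. lam j * (inner w (v j))\<^sup>2) \<le> T * (norm w)\<^sup>2" .
qed

lemma quad_summable: "(\<lambda>j. lam j * (inner w (v j))\<^sup>2) summable_on {1..}"
  using quad_has_sum has_sum_imp_summable by blast

end

section \<open>Independent pairs of random variables\<close>

text \<open>The library's \<open>indep_var\<close> needs both variables to have the same codomain type.\<close>

definition (in prob_space) independent ::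
    "('a \<Rightarrow> 'b::second_countable_topology) \<Rightarrow> ('a \<Rightarrow> 'c::second_countable_topology) \<Rightarrow> bool" where
  "independent U Z \<longleftrightarrow> random_variable borel U \<and> random_variable borel Z \<and>
     distr M (borel \<Otimes>\<^sub>M borel) (\<lambda>\<omega>. (U \<omega>, Z \<omega>)) = distr M borel U \<Otimes>\<^sub>M distr M borel Z"

text \<open>Passes from independent blocks of samples, which live in different product spaces, to
  the product law of functions of them, the form that Fubini arguments consume.\<close>

lemma (in prob_space) independent_compose:
  assumes ind: "indep_var S X T Y"
    and f[measurable]: "f \<in> borel_measurable S" and g[measurable]: "g \<in> borel_measurable T"
  shows "independent (\<lambda>\<omega>. f (X \<omega>)) (\<lambda>\<omega>. g (Y \<omega>))"
proof -
  have rv[measurable]: "random_variable S X" "random_variable T Y"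
    and eq: "distr M S X \<Otimes>\<^sub>M distr M T Y = distr M (S \<Otimes>\<^sub>M T) (\<lambda>\<omega>. (X \<omega>, Y \<omega>))"
    using ind unfolding indep_var_distribution_eq by auto
  interpret Y: prob_space "distr (distr M T Y) borel g"
    by (intro prob_space.prob_space_distr prob_space_distr) simp_all
  have "distr M borel (\<lambda>\<omega>. f (X \<omega>)) \<Otimes>\<^sub>M distr M borel (\<lambda>\<omega>. g (Y \<omega>))
      = distr (distr M S X) borel f \<Otimes>\<^sub>M distr (distr M T Y) borel g"
    by (simp add: distr_distr o_def)
  also have "\<dots> = distr (distr M S X \<Otimes>\<^sub>M distr M T Y) (borel \<Otimes>\<^sub>M borel) (\<lambda>(x, y). (f x, g y))"
    by (intro pair_measure_distr) (auto intro: Y.sigma_finite_measure_axioms)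
  also have "\<dots> = distr M (borel \<Otimes>\<^sub>M borel) (\<lambda>\<omega>. (f (X \<omega>), g (Y \<omega>)))"
    unfolding eq by (subst distr_distr) (auto simp: o_def)
  finally show ?thesis unfolding independent_def by simp
qed

lemma (in prob_space) independent_sym:
  assumes "independent U Z"
  shows "independent Z U"
proof -
  have rv[measurable]: "random_variable borel U" "random_variable borel Z"
    and eq: "distr M (borel \<Otimes>\<^sub>M borel) (\<lambda>\<omega>. (U \<omega>, Z \<omega>)) = distr M borel U \<Otimes>\<^sub>M distr M borel Z"
    using assms unfolding independent_def by auto
  interpret U: prob_space "distr M borel U" by (rule prob_space_distr) simp
  interpret Z: prob_space "distr M borel Z" by (rule prob_space_distr) simp
  interpret ZU: pair_prob_space "distr M borel Z" "distr M borel U" ..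
  have "distr M borel Z \<Otimes>\<^sub>M distr M borel U
      = distr (distr M borel U \<Otimes>\<^sub>M distr M borel Z) (distr M borel Z \<Otimes>\<^sub>M distr M borel U) (\<lambda>(x, y). (y, x))"
    by (rule ZU.distr_pair_swap)
  also have "\<dots> = distr (distr M borel U \<Otimes>\<^sub>M distr M borel Z) (borel \<Otimes>\<^sub>M borel) (\<lambda>(x, y). (y, x))"
    by (intro distr_cong) (auto intro: sets_pair_measure_cong)
  also have "\<dots> = distr M (borel \<Otimes>\<^sub>M borel) (\<lambda>\<omega>. (Z \<omega>, U \<omega>))"
    unfolding eq[symmetric] by (subst distr_distr) (auto simp: o_def)
  finally show ?thesis unfolding independent_def by simp
qed

text \<open>Joint integrability is produced from sections: each \<open>f u\<close> is integrable,
  and its absolute integral is at most \<open>g u\<close>, where \<open>g\<close> composed with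
  \<open>U\<close> is integrable. Applying the lemma amounts to finding such a
  \<open>g\<close>.\<close>

lemma (in prob_space) indep_Fubini:
  fixes U :: "'a \<Rightarrow> 'b::second_countable_topology" and Z :: "'a \<Rightarrow> 'c::second_countable_topology"
    and f :: "'b \<Rightarrow> 'c \<Rightarrow> real"
  assumes ind: "independent U Z"
    and f: "(\<lambda>(u, z). f u z) \<in> borel_measurable borel"
    and int: "\<And>u. integrable (distr M borel Z) (f u)"
    and g: "integrable M (\<lambda>\<omega>. g (U \<omega>))"
    and le: "\<And>u. (\<integral>z. \<bar>f u z\<bar> \<partial>distr M borel Z) \<le> g u"
  shows "integrable M (\<lambda>\<omega>. f (U \<omega>) (Z \<omega>))"
    and "(\<integral>\<omega>. f (U \<omega>) (Z \<omega>) \<partial>M) = (\<integral>\<omega>. (\<integral>z. f (U \<omega>) z \<partial>distr M borel Z) \<partial>M)"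
proof -
  have rv[measurable]: "random_variable borel U" "random_variable borel Z"
    and eq: "distr M borel U \<Otimes>\<^sub>M distr M borel Z = distr M (borel \<Otimes>\<^sub>M borel) (\<lambda>\<omega>. (U \<omega>, Z \<omega>))"
    using ind unfolding independent_def by simp_all
  interpret U: prob_space "distr M borel U" by (rule prob_space_distr) simp
  interpret Z: prob_space "distr M borel Z" by (rule prob_space_distr) simp
  interpret UZ: pair_prob_space "distr M borel U" "distr M borel Z" ..
  have fm[measurable]: "(\<lambda>(u, z). f u z) \<in> borel_measurable (borel \<Otimes>\<^sub>M borel)"
    using f by (simp add: borel_prod)
  have m[measurable]: "(\<lambda>u. \<integral>z. \<bar>f u z\<bar> \<partial>distr M borel Z) \<in> borel_measurable borel"
  proof -
    have "(\<lambda>u. \<integral>z. \<bar>f u z\<bar> \<partial>distr M borel Z) \<in> borel_measurable (distr M borel U)"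
      by measurable
    then show ?thesis by simp
  qed
  have m'[measurable]: "(\<lambda>u. \<integral>z. f u z \<partial>distr M borel Z) \<in> borel_measurable borel"
  proof -
    have "(\<lambda>u. \<integral>z. f u z \<partial>distr M borel Z) \<in> borel_measurable (distr M borel U)"
      by measurable
    then show ?thesis by simp
  qed
  have "integrable M (\<lambda>\<omega>. \<integral>z. \<bar>f (U \<omega>) z\<bar> \<partial>distr M borel Z)"
  proof (rule Bochner_Integration.integrable_bound[OF g])
    have "0 \<le> (\<integral>z. \<bar>f u z\<bar> \<partial>distr M borel Z)" for u by simp
    then show "AE \<omega> in M. norm (\<integral>z. \<bar>f (U \<omega>) z\<bar> \<partial>distr M borel Z) \<le> norm (g (U \<omega>))"
      using le by (intro AE_I2) (simp add: abs_of_nonneg order_trans[OF _ abs_ge_self])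
  qed measurable
  then have "integrable (distr M borel U) (\<lambda>u. \<integral>z. \<bar>f u z\<bar> \<partial>distr M borel Z)"
    by (subst integrable_distr_eq) auto
  then have *: "integrable (distr M borel U \<Otimes>\<^sub>M distr M borel Z) (\<lambda>(u, z). f u z)"
    using int by (intro UZ.Fubini_integrable) auto
  then have **: "integrable (distr M (borel \<Otimes>\<^sub>M borel) (\<lambda>\<omega>. (U \<omega>, Z \<omega>))) (\<lambda>(u, z). f u z)"
    unfolding eq .
  then show "integrable M (\<lambda>\<omega>. f (U \<omega>) (Z \<omega>))"
    by (subst (asm) integrable_distr_eq) auto
  have "(\<integral>\<omega>. f (U \<omega>) (Z \<omega>) \<partial>M) = integral\<^sup>L (distr M (borel \<Otimes>\<^sub>M borel) (\<lambda>\<omega>. (U \<omega>, Z \<omega>))) (\<lambda>(u, z). f u z)"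
    by (subst integral_distr) auto
  also have "\<dots> = (\<integral>u. (\<integral>z. f u z \<partial>distr M borel Z) \<partial>distr M borel U)"
    unfolding eq[symmetric] using UZ.integral_fst[OF *] by simp
  also have "\<dots> = (\<integral>\<omega>. (\<integral>z. f (U \<omega>) z \<partial>distr M borel Z) \<partial>M)"
    by (subst integral_distr) auto
  finally show "(\<integral>\<omega>. f (U \<omega>) (Z \<omega>) \<partial>M) = (\<integral>\<omega>. (\<integral>z. f (U \<omega>) z \<partial>distr M borel Z) \<partial>M)" .
qed

text \<open>The order is exchanged: \<open>Z\<close> is frozen and \<open>U\<close> is averaged
  first. A moment bound on \<open>U\<close> in fixed directions can thus be applied in a direction
  that depends on \<open>Z\<close>.\<close>

lemma (in prob_space) indep_Fubini':
  fixes U :: "'a \<Rightarrow> 'b::second_countable_topology" and Z :: "'a \<Rightarrow> 'c::second_countable_topology"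
    and f :: "'b \<Rightarrow> 'c \<Rightarrow> real"
  assumes ind: "independent U Z"
    and f[measurable]: "(\<lambda>(u, z). f u z) \<in> borel_measurable borel"
    and int: "\<And>z. integrable M (\<lambda>\<omega>. f (U \<omega>) z)"
    and g[measurable]: "integrable (distr M borel Z) g"
    and le: "\<And>z. (\<integral>\<omega>. \<bar>f (U \<omega>) z\<bar> \<partial>M) \<le> g z"
  shows "integrable M (\<lambda>\<omega>. f (U \<omega>) (Z \<omega>))"
    and "(\<integral>\<omega>. f (U \<omega>) (Z \<omega>) \<partial>M) = (\<integral>z. (\<integral>\<omega>. f (U \<omega>) z \<partial>M) \<partial>distr M borel Z)"
proof -
  have rv[measurable]: "random_variable borel U" "random_variable borel Z"
    using ind unfolding independent_def by auto
  have fm[measurable]: "(\<lambda>(u, z). f u z) \<in> borel_measurable (borel \<Otimes>\<^sub>M borel)"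
    using f by (simp add: borel_prod)
  have fz[measurable]: "(\<lambda>u. f u z) \<in> borel_measurable borel" for z
  proof -
    have "(\<lambda>u. (case (u, z) of (u, z) \<Rightarrow> f u z)) \<in> borel_measurable borel" by measurable
    then show ?thesis by simp
  qed
  have sw: "(\<lambda>(z, u). f u z) \<in> borel_measurable borel"
  proof -
    have "(\<lambda>(z, u). f u z) \<in> borel_measurable (borel \<Otimes>\<^sub>M borel)" by measurable
    then show ?thesis by (simp add: borel_prod)
  qed
  have int': "integrable (distr M borel U) (\<lambda>u. f u z)" for z
    using int by (subst integrable_distr_eq) auto
  have eq: "(\<integral>u. f u z \<partial>distr M borel U) = (\<integral>\<omega>. f (U \<omega>) z \<partial>M)"
     "(\<integral>u. \<bar>f u z\<bar> \<partial>distr M borel U) = (\<integral>\<omega>. \<bar>f (U \<omega>) z\<bar> \<partial>M)" for z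
    by (subst integral_distr; simp)+
  have gm[measurable]: "g \<in> borel_measurable borel"
    using borel_measurable_integrable[OF g] by simp
  have gZ: "integrable M (\<lambda>\<omega>. g (Z \<omega>))"
    using g by (subst (asm) integrable_distr_eq) auto
  note F = indep_Fubini[OF independent_sym[OF ind] sw int' gZ, unfolded eq, OF le]
  show "integrable M (\<lambda>\<omega>. f (U \<omega>) (Z \<omega>))" by (rule F(1))
  have "(\<lambda>z. \<integral>\<omega>. f (U \<omega>) z \<partial>M) \<in> borel_measurable borel"
  proof -
    have "(\<lambda>z. \<integral>\<omega>. f (U \<omega>) z \<partial>M) \<in> borel_measurable (distr M borel Z)" by measurable
    then show ?thesis by simp
  qed
  then show "(\<integral>\<omega>. f (U \<omega>) (Z \<omega>) \<partial>M) = (\<integral>z. (\<integral>\<omega>. f (U \<omega>) z \<partial>M) \<partial>distr M borel Z)"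
    unfolding F(2) by (subst integral_distr) auto
qed

section \<open>Measurability, integrability from squares, and head-tail sums\<close>

lemma borel_measurable_fst_snd [measurable]:
  "fst \<in> borel_measurable (borel :: ('a::second_countable_topology \<times> 'b::second_countable_topology) measure)"
  "snd \<in> borel_measurable (borel :: ('a::second_countable_topology \<times> 'b::second_countable_topology) measure)"
  by (intro borel_measurable_continuous_onI continuous_intros)+

lemma abs_mult_le_squares: "\<bar>a * b\<bar> \<le> a\<^sup>2 + b\<^sup>2" for a b :: real
proof -
  have "0 \<le> (\<bar>a\<bar> - \<bar>b\<bar>)\<^sup>2" by simp
  then have "2 * \<bar>a * b\<bar> \<le> a\<^sup>2 + b\<^sup>2" by (simp add: power2_diff abs_mult)
  then show ?thesis using abs_ge_zero[of "a * b"] by linarith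
qed

lemma integrable_mult_of_squares:
  fixes f g :: "'a \<Rightarrow> real"
  assumes [measurable]: "f \<in> borel_measurable M" "g \<in> borel_measurable M"
    and "integrable M (\<lambda>x. (f x)\<^sup>2)" "integrable M (\<lambda>x. (g x)\<^sup>2)"
  shows "integrable M (\<lambda>x. f x * g x)"
  by (rule Bochner_Integration.integrable_bound[OF Bochner_Integration.integrable_add[OF assms(3,4)]])
    (auto simp: abs_mult_le_squares)

lemma (in prob_space) integrable_of_square:
  fixes f :: "'a \<Rightarrow> real"
  assumes "f \<in> borel_measurable M" "integrable M (\<lambda>x. (f x)\<^sup>2)"
  shows "integrable M f"
  using integrable_mult_of_squares[of f M "\<lambda>_. 1"] assms by simp

lemma has_sum_head_tail:
  fixes f g :: "nat \<Rightarrow> real"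
  assumes "g summable_on {k<..}"
  shows "((\<lambda>j. if j \<le> k then f j else g j) has_sum (\<Sum>j=1..k. f j) + (\<Sum>\<^sub>\<infinity>j\<in>{k<..}. g j)) {1..}"
proof -
  have "((\<lambda>j. if j \<le> k then f j else g j) has_sum (\<Sum>j=1..k. f j)) {1..k}"
    by (subst has_sum_finite_iff) auto
  moreover have "((\<lambda>j. if j \<le> k then f j else g j) has_sum (\<Sum>\<^sub>\<infinity>j\<in>{k<..}. g j)) {k<..}"
    using has_sum_infsum[OF assms] by (subst has_sum_cong[where g = g]) auto
  moreover have "{1..k} \<union> {k<..} = {1..}" "{1..k} \<inter> {k<..} = {}" by auto
  ultimately show ?thesis using has_sum_Un_disjoint by metis
qed

section \<open>The data distribution and the mean iterate\<close>

text \<open>The three recursions of the model differ only in the noise \<open>e\<close> and the starting point.\<close>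

primrec proc :: "real \<Rightarrow> 'h::real_inner \<Rightarrow> ('h \<times> real \<Rightarrow> real) \<Rightarrow> (nat \<Rightarrow> 'h \<times> real) \<Rightarrow> nat \<Rightarrow> 'h" where
  "proc \<gamma> z1 e d 0 = z1"
| "proc \<gamma> z1 e d (Suc t) = (if t = 0 then z1 else
     proc \<gamma> z1 e d t - (\<gamma> * (inner (proc \<gamma> z1 e d t) (fst (d t)) - e (d t))) *\<^sub>R fst (d t))"

lemma proc_cong: "(\<And>i. i \<in> {1..<t} \<Longrightarrow> d i = d' i) \<Longrightarrow> proc \<gamma> z1 e d t = proc \<gamma> z1 e d' t"
  by (induction t) auto

text \<open>The iterate at time \<open>t\<close> reads only the samples at times 1 to t - 1. The
  hypothesis on \<open>A\<close> is exactly this, and the independence of the iterate from sample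
  \<open>t\<close> rests on it.\<close>

lemma proc_measurable_PiM:
  fixes z1 :: "'h::{real_inner,second_countable_topology}"
  assumes [measurable]: "e \<in> borel_measurable borel"
    and "\<And>i. i \<in> {1..<t} \<Longrightarrow> (m, i) \<in> A"
  shows "(\<lambda>d. proc \<gamma> z1 e (\<lambda>i. d (m, i)) t) \<in> borel_measurable (PiM A (\<lambda>_. borel))"
  using assms(2)
proof (induction t)
  case (Suc t)
  show ?case
  proof (cases "t = 0")
    case False
    then have [measurable]: "(\<lambda>d. d (m, t)) \<in> measurable (PiM A (\<lambda>_. borel)) borel"
      using Suc.prems by (intro measurable_component_singleton) auto
    have [measurable]: "(\<lambda>d. proc \<gamma> z1 e (\<lambda>i. d (m, i)) t) \<in> borel_measurable (PiM A (\<lambda>_. borel))"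
      using Suc by auto
    show ?thesis using False by simp
  qed simp
qed simp

text \<open>The operator hypotheses appear here through their scalar consequences, stated for the
  law \<open>D\<close> of one sample, so that all machines and times share them.\<close>

locale data_model = spectral H lam v T + D: prob_space D
  for H :: "'h::{real_inner,second_countable_topology} \<Rightarrow> 'h" and lam v T
    and D :: "('h \<times> real) measure" +
  fixes \<tau> \<gamma> :: real
  assumes sets_D [measurable_cong]: "sets D = sets borel"
    and H_bounded_linear: "bounded_linear H"
    and second_integrable: "\<And>u. integrable D (\<lambda>p. (inner u (fst p))\<^sup>2)"
    and second_eq: "\<And>u w. (\<integral>p. inner u (fst p) * inner w (fst p) \<partial>D) = inner u (H w)"
    and fourth_integrable: "\<And>u. integrable D (\<lambda>p. (norm (fst p))\<^sup>2 * (inner u (fst p))\<^sup>2)"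
    and fourth_le: "\<And>u. (\<integral>p. (norm (fst p))\<^sup>2 * (inner u (fst p))\<^sup>2 \<partial>D) \<le> \<tau> * T * inner u (H u)"
    and fourth_rank_one_integrable:
      "\<And>b u. integrable D (\<lambda>p. (inner b (fst p))\<^sup>2 * (inner u (fst p))\<^sup>2)"
    and fourth_rank_one_le: "\<And>b u. (\<integral>p. (inner b (fst p))\<^sup>2 * (inner u (fst p))\<^sup>2 \<partial>D)
      \<le> \<tau> * inner b (H b) * inner u (H u)"
    and gamma_pos: "0 < \<gamma>" and tau_pos: "0 < \<tau>" and gamma_less: "\<gamma> * (\<tau> * T) < 1"
begin

abbreviation quad :: "'h \<Rightarrow> real" where "quad u \<equiv> inner u (H u)"

lemma H_measurable [measurable]: "H \<in> borel_measurable borel"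
  using H_bounded_linear
  by (intro borel_measurable_continuous_onI linear_continuous_on)

lemma quad_eq: "(\<integral>p. (inner u (fst p))\<^sup>2 \<partial>D) = quad u"
  using second_eq[of u u] by (simp add: power2_eq_square)

lemma quad_v: "j \<ge> 1 \<Longrightarrow> quad (v j) = lam j"
  using v_unit[of j] by (auto simp: H_v norm_eq_1)

text \<open>The variance of <v j,x>^2 is nonnegative, so the rank-one case gives lam j^2 \<le>
  \<tau> lam j^2 and hence \<tau> \<ge> 1 if \<open>lam j\<close> is nonzero. The stepsize condition
  on \<tau> T therefore controls \<gamma> lam j and keeps 1 - \<gamma> lam j in [0,1].\<close>

lemma lam_le_tau:
  assumes "j \<ge> 1"
  shows "lam j \<le> \<tau> * T"
proof (cases "lam j = 0")
  case False
  define f where "f p = (inner (v j) (fst p))\<^sup>2" for p :: "'h \<times> real"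
  have f: "integrable D f" "integrable D (\<lambda>p. f p * f p)"
    unfolding f_def by (rule second_integrable fourth_rank_one_integrable)+
  have Ef: "(\<integral>p. f p \<partial>D) = lam j" "(\<integral>p. f p * f p \<partial>D) \<le> \<tau> * lam j * lam j"
    unfolding f_def using quad_eq[of "v j"] fourth_rank_one_le[of "v j" "v j"] assms
    by (simp_all add: quad_v)
  have "0 \<le> (\<integral>p. (f p - lam j)\<^sup>2 \<partial>D)" by simp
  also have "\<dots> = (\<integral>p. f p * f p - 2 * lam j * f p + lam j * lam j \<partial>D)"
    by (intro Bochner_Integration.integral_cong) (auto simp: power2_eq_square algebra_simps)
  also have "\<dots> = (\<integral>p. f p * f p \<partial>D) - 2 * lam j * lam j + lam j * lam j"
    using f by (simp add: Ef D.prob_space)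
  also have "\<dots> \<le> \<tau> * lam j * lam j - 2 * lam j * lam j + lam j * lam j"
    using Ef(2) by simp
  finally have "0 \<le> (\<tau> - 1) * (lam j * lam j)" by (simp add: algebra_simps)
  moreover have "0 < lam j * lam j" using False by (auto simp: zero_less_mult_iff)
  ultimately have "1 \<le> \<tau>" by (simp add: zero_le_mult_iff)
  then have "1 * T \<le> \<tau> * T" using T_nonneg by (intro mult_right_mono) auto
  then show ?thesis using lam_le[OF assms] by simp
qed (use tau_pos T_nonneg in simp)

lemma gamma_lam_le: "j \<ge> 1 \<Longrightarrow> \<gamma> * lam j \<le> 1"
  using mult_left_mono[OF lam_le_tau, of j \<gamma>] gamma_pos gamma_less by linarith

section \<open>The mean iterate: gradient descent on the quadratic form of \<open>H\<close>\<close>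

primrec mean :: "'h \<Rightarrow> nat \<Rightarrow> 'h" where
  "mean z1 0 = z1"
| "mean z1 (Suc t) = (if t = 0 then z1 else mean z1 t - \<gamma> *\<^sub>R H (mean z1 t))"

lemma H_symmetric: "inner u (H w) = inner (H u) w"
  using second_eq[of u w] second_eq[of w u] by (simp add: inner_commute mult.commute)

lemma mean_zero: "mean 0 t = 0"
  using linear_0[OF bounded_linear.linear[OF H_bounded_linear]] by (induction t) auto

lemma mean_inner_v:
  assumes "j \<ge> 1"
  shows "inner (mean z1 (Suc t)) (v j) = (1 - \<gamma> * lam j) ^ t * inner z1 (v j)"
proof (induction t)
  case (Suc t)
  have "inner (mean z1 (Suc (Suc t))) (v j)
      = inner (mean z1 (Suc t)) (v j) - \<gamma> * inner (mean z1 (Suc t)) (H (v j))"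
    by (simp add: inner_diff_left H_symmetric del: mean.simps(2)) (simp add: inner_diff_left H_symmetric)
  then show ?case unfolding Suc H_v[OF assms] inner_scaleR_right by (simp add: Suc algebra_simps)
qed simp

lemma power_sum_bounds:
  assumes "j \<ge> 1"
  defines "r \<equiv> 1 - \<gamma> * lam j"
  shows "0 \<le> r" "r \<le> 1" "\<gamma> * lam j * (\<Sum>i<n. r ^ i) = 1 - r ^ n"
    "(\<Sum>i<n. r ^ i) \<le> real n" "0 \<le> (\<Sum>i<n. r ^ i)"
proof -
  show r: "0 \<le> r" "r \<le> 1"
    using gamma_lam_le[OF assms(1)] lam_nonneg[OF assms(1)] gamma_pos by (simp_all add: r_def)
  show "\<gamma> * lam j * (\<Sum>i<n. r ^ i) = 1 - r ^ n"
    using one_diff_power_eq[of r n] by (simp add: r_def)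
  show "(\<Sum>i<n. r ^ i) \<le> real n"
    using sum_bounded_above[of "{..<n}" "\<lambda>i. r ^ i" 1] r by (simp add: power_le_one)
  show "0 \<le> (\<Sum>i<n. r ^ i)" using r by (simp add: sum_nonneg)
qed

text \<open>Expanding |m - \<gamma> H m|^2 and dropping its square term, a step loses at most 2
  \<gamma> <m,Hm>. In coordinate j these forms sum to at most (1 - r^n) <z1,v j>^2, estimated
  through 1 in the head and n \<gamma> lam j in the tail. Only the loss of norm is bounded, so
  |z1|^2 itself does not enter.\<close>

lemma mean_norm_decrease:
  "(norm z1)\<^sup>2 - (norm (mean z1 (Suc n)))\<^sup>2
    \<le> 2 * (normsq_id_head v k z1 + \<gamma> * n * normsq_tail lam v k z1)"
proof -
  have step: "(norm (mean z1 t))\<^sup>2 - (norm (mean z1 (Suc t)))\<^sup>2 \<le> 2 * (\<gamma> * quad (mean z1 t))"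
    if "t \<ge> 1" for t
  proof -
    let ?m = "mean z1 t"
    have "(norm (?m - \<gamma> *\<^sub>R H ?m))\<^sup>2 = (norm ?m)\<^sup>2 - 2 * (\<gamma> * quad ?m) + (norm (\<gamma> *\<^sub>R H ?m))\<^sup>2"
      unfolding power2_norm_eq_inner
      by (simp add: inner_diff_left inner_diff_right) (simp add: inner_commute algebra_simps)
    then show ?thesis using that by simp
  qed
  have "(norm z1)\<^sup>2 - (norm (mean z1 (Suc n)))\<^sup>2 \<le> 2 * (\<Sum>t=1..n. \<gamma> * quad (mean z1 t))"
  proof (induction n)
    case (Suc n)
    then show ?case using step[of "Suc n"] by (simp del: mean.simps)
  qed simp
  moreover have "(\<Sum>t=1..n. \<gamma> * quad (mean z1 t)) \<le> normsq_id_head v k z1 + \<gamma> * n * normsq_tail lam v k z1"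
  proof (rule has_sum_mono)
    let ?r = "\<lambda>j. 1 - \<gamma> * lam j"
    show "((\<lambda>j. \<Sum>t=1..n. \<gamma> * (lam j * (inner (mean z1 t) (v j))\<^sup>2))
        has_sum (\<Sum>t=1..n. \<gamma> * quad (mean z1 t))) {1..}"
      by (intro has_sum_sum_finite has_sum_cmult_right quad_has_sum) simp
    show "((\<lambda>j. if j \<le> k then (inner z1 (v j))\<^sup>2 else \<gamma> * n * (lam j * (inner z1 (v j))\<^sup>2))
        has_sum normsq_id_head v k z1 + \<gamma> * n * normsq_tail lam v k z1) {1..}"
      unfolding normsq_id_head_def normsq_tail_def infsum_cmult_right'[symmetric]
      by (intro has_sum_head_tail summable_on_cmult_right summable_on_subset[OF quad_summable]) auto
    fix j :: nat assume "j \<in> {1..}"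
    then have j: "j \<ge> 1" by simp
    note r = power_sum_bounds[OF j]
    let ?S = "\<Sum>i<n. ?r j ^ i" and ?b = "(inner z1 (v j))\<^sup>2"
    have "(\<Sum>t=1..n. \<gamma> * (lam j * (inner (mean z1 t) (v j))\<^sup>2))
        = (\<Sum>i<n. \<gamma> * (lam j * (inner (mean z1 (Suc i)) (v j))\<^sup>2))"
      by (rule sum.reindex_bij_witness[of _ Suc "\<lambda>t. t - 1"]) (auto simp del: mean.simps)
    also have "\<dots> = (\<Sum>i<n. \<gamma> * lam j * ?b * (?r j ^ i)\<^sup>2)"
      unfolding mean_inner_v[OF j] by (simp add: power_mult_distrib mult_ac)
    \<comment> \<open>One of the two factors r^i is given up, which leaves a geometric sum of ratio
      r; multiplied by \<gamma> lam j it is exactly 1 - r^n.\<close>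
    also have "\<dots> \<le> (\<Sum>i<n. \<gamma> * lam j * ?b * ?r j ^ i)"
      using r(1,2) lam_nonneg[OF j] gamma_pos
      by (intro sum_mono mult_left_mono) (auto simp: power2_eq_square mult_left_le_one_le power_le_one)
    also have "\<dots> = \<gamma> * lam j * ?S * ?b"
      by (simp add: sum_distrib_left sum_distrib_right mult_ac)
    finally have *: "(\<Sum>t=1..n. \<gamma> * (lam j * (inner (mean z1 t) (v j))\<^sup>2)) \<le> \<gamma> * lam j * ?S * ?b" .
    have "\<gamma> * lam j * ?S \<le> 1" unfolding r(3) using r(1) by simp
    then have **: "\<gamma> * lam j * ?S * ?b \<le> ?b" using mult_right_mono[of _ 1 ?b] by simp
    have "\<gamma> * lam j * ?S * ?b \<le> \<gamma> * lam j * real n * ?b"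
      using r(4) lam_nonneg[OF j] gamma_pos by (intro mult_right_mono mult_left_mono) auto
    then show "(\<Sum>t=1..n. \<gamma> * (lam j * (inner (mean z1 t) (v j))\<^sup>2))
        \<le> (if j \<le> k then ?b else \<gamma> * n * (lam j * ?b))"
      using * ** by (simp add: mult_ac)
  qed
  ultimately show ?thesis by simp
qed

text \<open>Passes from bounds in the single eigendirections to E <W,HW> by integrating a series of
  nonnegative terms. \<open>R\<close> is a summable majorant, and integrability is part of the
  conclusion.\<close>

lemma quad_expectation:
  assumes Q: "prob_space Q" and W[measurable]: "W \<in> borel_measurable Q"
    and int: "\<And>j. j \<ge> 1 \<Longrightarrow> integrable Q (\<lambda>\<omega>. (inner (W \<omega>) (v j))\<^sup>2)"
    and le: "\<And>j. j \<ge> 1 \<Longrightarrow> lam j * (\<integral>\<omega>. (inner (W \<omega>) (v j))\<^sup>2 \<partial>Q) \<le> R j"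
    and R: "(R has_sum S) {1..}"
  shows "integrable Q (\<lambda>\<omega>. quad (W \<omega>))" "(\<integral>\<omega>. quad (W \<omega>) \<partial>Q) \<le> S"
proof -
  have range_Suc: "range Suc = {1..}"
    by (auto simp: image_iff) (metis Suc_le_D One_nat_def)
  have sums: "(\<lambda>i. f (Suc i)) sums s" if "(f has_sum s) {1..}" for f :: "nat \<Rightarrow> real" and s
  proof -
    have "((\<lambda>i. f (Suc i)) has_sum s) UNIV"
      using that has_sum_reindex[of Suc UNIV f s] range_Suc by (simp add: o_def)
    then show ?thesis by (rule has_sum_imp_sums)
  qed
  let ?f = "\<lambda>i \<omega>. lam (Suc i) * (inner (W \<omega>) (v (Suc i)))\<^sup>2"
  have f: "integrable Q (?f i)" "norm (?f i \<omega>) = ?f i \<omega>" for i \<omega>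
    using int lam_nonneg by (auto simp: abs_mult)
  have pw: "(\<lambda>i. ?f i \<omega>) sums quad (W \<omega>)" for \<omega>
    by (rule sums[OF quad_has_sum])
  have Ef: "(\<integral>\<omega>. ?f i \<omega> \<partial>Q) \<le> R (Suc i)" "0 \<le> (\<integral>\<omega>. ?f i \<omega> \<partial>Q)" for i
    using le[of "Suc i"] lam_nonneg by simp_all
  have sumE: "summable (\<lambda>i. \<integral>\<omega>. ?f i \<omega> \<partial>Q)"
    using Ef by (intro summable_comparison_test_ev[OF _ sums_summable[OF sums[OF R]]]) auto
  have "integrable Q (\<lambda>\<omega>. \<Sum>i. ?f i \<omega>)"
    using f pw sumE by (intro integrable_suminf) (auto simp: sums_iff simp del: norm_mult)
  then show "integrable Q (\<lambda>\<omega>. quad (W \<omega>))" using pw by (simp add: sums_iff)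
  have "(\<integral>\<omega>. quad (W \<omega>) \<partial>Q) = (\<integral>\<omega>. (\<Sum>i. ?f i \<omega>) \<partial>Q)" using pw by (simp add: sums_iff)
  also have "\<dots> = (\<Sum>i. \<integral>\<omega>. ?f i \<omega> \<partial>Q)"
    using f pw sumE by (intro integral_suminf) (auto simp: sums_iff simp del: norm_mult)
  also have "\<dots> \<le> S"
    by (rule sums_le[OF Ef(1) summable_sums[OF sumE] sums[OF R]])
  finally show "(\<integral>\<omega>. quad (W \<omega>) \<partial>Q) \<le> S" .
qed

end

section \<open>Moments of the iterates\<close>

text \<open>One process serves twice: zero noise with any start is the bias, start 0 with noise is
  the variance. \<open>noise_mean\<close> only makes noise and x uncorrelated;
  \<open>bias_or_variance\<close> records the two cases in which the cross term of noise and iterate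
  still vanishes.\<close>

locale sgd_process = data_model H lam v T D \<tau> \<gamma> + Q: prob_space Q
  for H :: "'h::{real_inner,second_countable_topology} \<Rightarrow> 'h" and lam v T D \<tau> \<gamma>
    and Q :: "'b measure" +
  fixes d :: "nat \<times> nat \<Rightarrow> 'b \<Rightarrow> 'h \<times> real" and M N :: nat
    and z1 :: 'h and e :: "'h \<times> real \<Rightarrow> real" and s :: real
  assumes d_indep: "Q.indep_vars (\<lambda>_. borel) d ({1..M} \<times> {1..N})"
    and d_distr: "\<And>m t. m \<in> {1..M} \<Longrightarrow> t \<in> {1..N} \<Longrightarrow> distr Q borel (d (m, t)) = D"
    and e_measurable [measurable]: "e \<in> borel_measurable borel"
    and noise_integrable: "\<And>u. integrable D (\<lambda>p. (e p * inner u (fst p))\<^sup>2)"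
    and noise_mean: "\<And>u. (\<integral>p. e p * inner u (fst p) \<partial>D) = 0"
    and noise_le: "\<And>u. (\<integral>p. (e p * inner u (fst p))\<^sup>2 \<partial>D) \<le> s * quad u"
    and s_nonneg: "0 \<le> s"
    and bias_or_variance: "e = (\<lambda>_. 0) \<or> z1 = 0"
begin

definition z :: "nat \<Rightarrow> nat \<Rightarrow> 'b \<Rightarrow> 'h" where
  "z m t \<omega> = proc \<gamma> z1 e (\<lambda>i. d (m, i) \<omega>) t"

abbreviation X :: "nat \<Rightarrow> nat \<Rightarrow> 'b \<Rightarrow> 'h" where "X m t \<omega> \<equiv> fst (d (m, t) \<omega>)"

abbreviation noise :: "nat \<Rightarrow> nat \<Rightarrow> 'b \<Rightarrow> real" where "noise m t \<omega> \<equiv> e (d (m, t) \<omega>)"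

lemma z_1 [simp]: "z m (Suc 0) \<omega> = z1"
  by (simp add: z_def)

lemma z_Suc: "t \<ge> 1 \<Longrightarrow> z m (Suc t) \<omega>
    = z m t \<omega> - (\<gamma> * (inner (z m t \<omega>) (X m t \<omega>) - noise m t \<omega>)) *\<^sub>R X m t \<omega>"
  by (simp add: z_def)

lemma z_Suc_inner: "t \<ge> 1 \<Longrightarrow> inner (z m (Suc t) \<omega>) u
    = inner (z m t \<omega>) (u - (\<gamma> * inner u (X m t \<omega>)) *\<^sub>R X m t \<omega>) + \<gamma> * (noise m t \<omega> * inner u (X m t \<omega>))"
  by (simp add: z_Suc inner_diff_left inner_diff_right inner_commute algebra_simps)

lemma d_measurable [measurable]: "m \<in> {1..M} \<Longrightarrow> t \<in> {1..N} \<Longrightarrow> d (m, t) \<in> borel_measurable Q"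
  using d_indep unfolding Q.indep_vars_def by blast

lemma z_restrict:
  assumes "{m} \<times> {1..<t} \<subseteq> A"
  shows "z m t \<omega> = proc \<gamma> z1 e (\<lambda>i. restrict (\<lambda>i. d i \<omega>) A (m, i)) t"
proof -
  have "(m, i) \<in> A" if "i \<in> {1..<t}" for i using assms that by auto
  then show ?thesis unfolding z_def by (intro proc_cong) simp
qed

lemma z_measurable [measurable]:
  assumes m: "m \<in> {1..M}" and t: "t \<le> Suc N"
  shows "z m t \<in> borel_measurable Q"
proof -
  let ?A = "{m} \<times> {1..<t}"
  have [measurable]: "(\<lambda>\<omega>. restrict (\<lambda>i. d i \<omega>) ?A) \<in> measurable Q (PiM ?A (\<lambda>_. borel))"
    using assms d_measurable by (intro measurable_restrict) auto
  have [measurable]: "(\<lambda>d. proc \<gamma> z1 e (\<lambda>i. d (m, i)) t) \<in> borel_measurable (PiM ?A (\<lambda>_. borel))"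
    by (intro proc_measurable_PiM) auto
  have "z m t = (\<lambda>\<omega>. proc \<gamma> z1 e (\<lambda>i. restrict (\<lambda>i. d i \<omega>) ?A (m, i)) t)"
    by (rule ext, rule z_restrict) simp
  also have "\<dots> \<in> borel_measurable Q" by measurable
  finally show ?thesis .
qed

text \<open>Both iterates read only samples of machine \<open>m\<close> before time
  \<open>t\<close>, an index set disjoint from the current sample.\<close>

lemma indep_step:
  assumes m: "m \<in> {1..M}" and t: "t \<in> {1..N}" and r: "r \<le> t"
  shows "Q.independent (\<lambda>\<omega>. (z m r \<omega>, z m t \<omega>)) (d (m, t))"
proof -
  let ?A = "{m} \<times> {1..<t}" and ?B = "{(m, t)}"
  let ?f = "\<lambda>d. (proc \<gamma> z1 e (\<lambda>i. d (m, i)) r, proc \<gamma> z1 e (\<lambda>i. d (m, i)) t)"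
  have ind: "Q.indep_var (PiM ?A (\<lambda>_. borel)) (\<lambda>\<omega>. restrict (\<lambda>i. d i \<omega>) ?A)
      (PiM ?B (\<lambda>_. borel)) (\<lambda>\<omega>. restrict (\<lambda>i. d i \<omega>) ?B)"
    using m t by (intro Q.indep_var_restrict[OF d_indep]) auto
  have f: "?f \<in> borel_measurable (PiM ?A (\<lambda>_. borel))"
    using r by (intro borel_measurable_Pair proc_measurable_PiM) auto
  have g: "(\<lambda>d. d (m, t)) \<in> borel_measurable (PiM ?B (\<lambda>_. borel))"
    by (intro measurable_component_singleton) simp
  have "z m r \<omega> = proc \<gamma> z1 e (\<lambda>i. restrict (\<lambda>i. d i \<omega>) ?A (m, i)) r"
     "z m t \<omega> = proc \<gamma> z1 e (\<lambda>i. restrict (\<lambda>i. d i \<omega>) ?A (m, i)) t" for \<omega>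
    using r by (intro z_restrict; auto)+
  then show ?thesis using Q.independent_compose[OF ind f g] by simp
qed

lemma indep_machines:
  assumes m: "m \<in> {1..M}" "m' \<in> {1..M}" "m \<noteq> m'" and t: "t \<in> {1..N}" "r \<in> {1..N}"
  shows "Q.independent (z m t) (z m' r)"
proof -
  let ?A = "{m} \<times> {1..<t}" and ?B = "{m'} \<times> {1..<r}"
  have ind: "Q.indep_var (PiM ?A (\<lambda>_. borel)) (\<lambda>\<omega>. restrict (\<lambda>i. d i \<omega>) ?A)
      (PiM ?B (\<lambda>_. borel)) (\<lambda>\<omega>. restrict (\<lambda>i. d i \<omega>) ?B)"
    using m t by (intro Q.indep_var_restrict[OF d_indep]) auto
  have z: "z m t = (\<lambda>\<omega>. proc \<gamma> z1 e (\<lambda>i. restrict (\<lambda>i. d i \<omega>) ?A (m, i)) t)"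
     "z m' r = (\<lambda>\<omega>. proc \<gamma> z1 e (\<lambda>i. restrict (\<lambda>i. d i \<omega>) ?B (m', i)) r)"
    by (rule ext, rule z_restrict, simp)+
  show ?thesis
    unfolding z by (rule Q.independent_compose[OF ind]) (auto intro!: proc_measurable_PiM)
qed

text \<open>Conditional expectations are taken either given the past or given the current sample;
  \<open>r\<close> is an earlier time that is carried along for the correlations across time.\<close>

lemma given_past:
  fixes f :: "'h \<times> 'h \<Rightarrow> 'h \<times> real \<Rightarrow> real"
  assumes m: "m \<in> {1..M}" and t: "t \<in> {1..N}" and r: "r \<le> t"
    and f: "(\<lambda>(u, p). f u p) \<in> borel_measurable borel"
    and int: "\<And>u. integrable D (f u)"
    and g: "integrable Q (\<lambda>\<omega>. g (z m r \<omega>, z m t \<omega>))"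
    and le: "\<And>u. (\<integral>p. \<bar>f u p\<bar> \<partial>D) \<le> g u"
  shows "integrable Q (\<lambda>\<omega>. f (z m r \<omega>, z m t \<omega>) (d (m, t) \<omega>))"
    and "(\<integral>\<omega>. f (z m r \<omega>, z m t \<omega>) (d (m, t) \<omega>) \<partial>Q) = (\<integral>\<omega>. (\<integral>p. f (z m r \<omega>, z m t \<omega>) p \<partial>D) \<partial>Q)"
  by (rule Q.indep_Fubini[OF indep_step[OF m t r] f, unfolded d_distr[OF m t], OF int g le])+

lemma given_sample:
  fixes f :: "'h \<Rightarrow> 'h \<times> real \<Rightarrow> real"
  assumes m: "m \<in> {1..M}" and t: "t \<in> {1..N}"
    and f[measurable]: "(\<lambda>(u, p). f u p) \<in> borel_measurable borel"
    and int: "\<And>p. integrable Q (\<lambda>\<omega>. f (z m t \<omega>) p)"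
    and g: "integrable D g"
    and le: "\<And>p. (\<integral>\<omega>. \<bar>f (z m t \<omega>) p\<bar> \<partial>Q) \<le> g p"
  shows "integrable Q (\<lambda>\<omega>. f (z m t \<omega>) (d (m, t) \<omega>))"
    and "(\<integral>\<omega>. f (z m t \<omega>) (d (m, t) \<omega>) \<partial>Q) = (\<integral>p. (\<integral>\<omega>. f (z m t \<omega>) p \<partial>Q) \<partial>D)"
proof -
  have fm: "(\<lambda>(u, p). f (snd u) p) \<in> borel_measurable (borel :: (('h \<times> 'h) \<times> 'h \<times> real) measure)"
  proof -
    have "(\<lambda>q. (\<lambda>(u, p). f u p) (snd (fst q), snd q))
        \<in> borel_measurable (borel :: (('h \<times> 'h) \<times> 'h \<times> real) measure)"
      by measurable
    then show ?thesis by (simp add: split_beta')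
  qed
  show "integrable Q (\<lambda>\<omega>. f (z m t \<omega>) (d (m, t) \<omega>))"
    and "(\<integral>\<omega>. f (z m t \<omega>) (d (m, t) \<omega>) \<partial>Q) = (\<integral>p. (\<integral>\<omega>. f (z m t \<omega>) p \<partial>Q) \<partial>D)"
    using Q.indep_Fubini'[OF indep_step[OF m t order_refl] fm, unfolded d_distr[OF m t], of g] int g le
    by auto
qed

lemma of_sample:
  assumes m: "m \<in> {1..M}" and t: "t \<in> {1..N}"
    and [measurable]: "f \<in> borel_measurable borel"
  shows "integrable Q (\<lambda>\<omega>. f (d (m, t) \<omega>) :: real) \<longleftrightarrow> integrable D f"
    and "(\<integral>\<omega>. f (d (m, t) \<omega>) \<partial>Q) = (\<integral>p. f p \<partial>D)"
proof -
  have [measurable]: "d (m, t) \<in> borel_measurable Q" using m t by (rule d_measurable)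
  show "integrable Q (\<lambda>\<omega>. f (d (m, t) \<omega>)) \<longleftrightarrow> integrable D f"
    unfolding d_distr[OF m t, symmetric] by (subst integrable_distr_eq) auto
  show "(\<integral>\<omega>. f (d (m, t) \<omega>) \<partial>Q) = (\<integral>p. f p \<partial>D)"
    unfolding d_distr[OF m t, symmetric] by (subst integral_distr) auto
qed

text \<open>A constant preserved by the recursion for the bound \<open>E \<langle>z, u\<rangle>\<^sup>2 \<le> K \<parallel>u\<parallel>\<^sup>2\<close>.\<close>

definition K :: real where "K = (norm z1)\<^sup>2 + \<gamma> * s / (1 - \<gamma> * \<tau> * T)"

lemma K_nonneg: "0 \<le> K"
  unfolding K_def using gamma_less gamma_pos s_nonneg by (auto simp: mult.assoc)

text \<open>The second summand of \<open>K\<close> is the fixed point of the map taking K to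
  \<gamma> s + \<gamma> \<tau> T K. The first one, which accounts for the start, adds the surplus (1
  - \<gamma> \<tau> T) |z1|^2 \<ge> 0.\<close>

lemma K_step: "\<gamma> * s + \<gamma> * \<tau> * T * K \<le> K"
proof -
  have a: "0 < 1 - \<gamma> * \<tau> * T" using gamma_less by (simp add: mult.assoc)
  have "(1 - \<gamma> * \<tau> * T) * K = (1 - \<gamma> * \<tau> * T) * (norm z1)\<^sup>2 + \<gamma> * s"
    using a unfolding K_def distrib_left by simp
  moreover have "0 \<le> (1 - \<gamma> * \<tau> * T) * (norm z1)\<^sup>2" using a by simp
  ultimately show ?thesis by (simp add: algebra_simps)
qed

section \<open>One step of the recursion\<close>

abbreviation contract :: "'h \<Rightarrow> 'h \<times> real \<Rightarrow> 'h" where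
  "contract u p \<equiv> u - (\<gamma> * inner u (fst p)) *\<^sub>R fst p"

lemma norm_contract: "(norm (contract u p))\<^sup>2
    = (norm u)\<^sup>2 - 2 * \<gamma> * (inner u (fst p))\<^sup>2 + \<gamma>\<^sup>2 * ((norm (fst p))\<^sup>2 * (inner u (fst p))\<^sup>2)"
proof -
  have "(norm (u - c *\<^sub>R a))\<^sup>2 = (norm u)\<^sup>2 - 2 * (c * inner u a) + c * c * (norm a)\<^sup>2" for c and a :: 'h
    unfolding power2_norm_eq_inner
    by (simp add: inner_diff_left inner_diff_right) (simp add: inner_commute algebra_simps)
  from this[of "\<gamma> * inner u (fst p)" "fst p"] show ?thesis
    by (simp only: power2_eq_square mult_ac)
qed

lemma contract_integrable: "integrable D (\<lambda>p. (norm (contract u p))\<^sup>2)"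
  unfolding norm_contract
  by (intro Bochner_Integration.integrable_add Bochner_Integration.integrable_diff
      integrable_mult_right second_integrable fourth_integrable) simp

text \<open>The case A = I bounds the square term by \<gamma>^2 \<tau> T <u,Hu>; against the linear
  term 2 \<gamma> <u,Hu> this leaves a decrease that the stepsize condition keeps
  nonnegative.\<close>

lemma contract_le: "(\<integral>p. (norm (contract u p))\<^sup>2 \<partial>D)
    \<le> (norm u)\<^sup>2 - \<gamma> * (2 - \<gamma> * \<tau> * T) * quad u"
proof -
  have "(\<integral>p. (norm (contract u p))\<^sup>2 \<partial>D) = (norm u)\<^sup>2 - 2 * \<gamma> * quad u
      + \<gamma>\<^sup>2 * (\<integral>p. (norm (fst p))\<^sup>2 * (inner u (fst p))\<^sup>2 \<partial>D)"
    unfolding norm_contract using second_integrable fourth_integrable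
    by (simp add: quad_eq D.prob_space)
  also have "\<dots> \<le> (norm u)\<^sup>2 - 2 * \<gamma> * quad u + \<gamma>\<^sup>2 * (\<tau> * T * quad u)"
    using fourth_le by (simp add: mult_left_mono)
  finally show ?thesis by (simp add: power2_eq_square[of \<gamma>] algebra_simps)
qed

text \<open>The three facts form one induction hypothesis: integrability and the bound by
  \<open>K\<close> provide the domination for Fubini, and the mean removes the cross term of the
  next step.\<close>

definition bounded_moments :: "nat \<Rightarrow> nat \<Rightarrow> bool" where
  "bounded_moments m t \<longleftrightarrow> (\<forall>u. integrable Q (\<lambda>\<omega>. (inner (z m t \<omega>) u)\<^sup>2) \<and>
     (\<integral>\<omega>. (inner (z m t \<omega>) u)\<^sup>2 \<partial>Q) \<le> K * (norm u)\<^sup>2 \<and>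
     (\<integral>\<omega>. inner (z m t \<omega>) u \<partial>Q) = inner (mean z1 t) u)"

lemma
  assumes "m \<in> {1..M}" "t \<le> Suc N" "bounded_moments m t"
  shows sq_integrable: "integrable Q (\<lambda>\<omega>. (inner (z m t \<omega>) u)\<^sup>2)"
    and sq_le: "(\<integral>\<omega>. (inner (z m t \<omega>) u)\<^sup>2 \<partial>Q) \<le> K * (norm u)\<^sup>2"
    and z_mean: "(\<integral>\<omega>. inner (z m t \<omega>) u \<partial>Q) = inner (mean z1 t) u"
    and z_integrable: "integrable Q (\<lambda>\<omega>. inner (z m t \<omega>) u)"
proof -
  have [measurable]: "z m t \<in> borel_measurable Q" using assms(1,2) by (rule z_measurable)
  show sq: "integrable Q (\<lambda>\<omega>. (inner (z m t \<omega>) u)\<^sup>2)"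
    and "(\<integral>\<omega>. (inner (z m t \<omega>) u)\<^sup>2 \<partial>Q) \<le> K * (norm u)\<^sup>2"
    and "(\<integral>\<omega>. inner (z m t \<omega>) u \<partial>Q) = inner (mean z1 t) u"
    using assms(3) unfolding bounded_moments_def by blast+
  show "integrable Q (\<lambda>\<omega>. inner (z m t \<omega>) u)"
    by (rule Q.integrable_of_square[OF _ sq]) measurable
qed

text \<open>By symmetry the random contraction acts on \<open>u\<close> instead of the iterate. With
  the sample frozen, the moment bound applies in the direction \<open>contract u p\<close>;
  averaging over the sample is then \<open>contract_le\<close>.\<close>

lemma step_contract:
  assumes m: "m \<in> {1..M}" and t: "t \<in> {1..N}" and bm: "bounded_moments m t"
  shows "integrable Q (\<lambda>\<omega>. (inner (z m t \<omega>) (contract u (d (m, t) \<omega>)))\<^sup>2)"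
    and "(\<integral>\<omega>. (inner (z m t \<omega>) (contract u (d (m, t) \<omega>)))\<^sup>2 \<partial>Q)
      \<le> K * ((norm u)\<^sup>2 - \<gamma> * (2 - \<gamma> * \<tau> * T) * quad u)"
proof -
  have t': "t \<le> Suc N" using t by simp
  note bm' = sq_integrable[OF m t' bm] sq_le[OF m t' bm]
  have f: "(\<lambda>(a, p). (inner a (contract u p))\<^sup>2) \<in> borel_measurable borel"
    unfolding split_beta' by measurable
  have g: "integrable D (\<lambda>p. K * (norm (contract u p))\<^sup>2)"
    by (intro integrable_mult_right contract_integrable)
  have le: "(\<integral>\<omega>. \<bar>(inner (z m t \<omega>) (contract u p))\<^sup>2\<bar> \<partial>Q) \<le> K * (norm (contract u p))\<^sup>2" for p
    using bm'(2) by simp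
  note F = given_sample[OF m t f bm'(1) g le]
  show "integrable Q (\<lambda>\<omega>. (inner (z m t \<omega>) (contract u (d (m, t) \<omega>)))\<^sup>2)" by (rule F(1))
  have "(\<integral>\<omega>. (inner (z m t \<omega>) (contract u (d (m, t) \<omega>)))\<^sup>2 \<partial>Q)
      \<le> (\<integral>p. K * (norm (contract u p))\<^sup>2 \<partial>D)"
    unfolding F(2) using bm'(2) K_nonneg g by (intro integral_mono') auto
  also have "\<dots> \<le> K * ((norm u)\<^sup>2 - \<gamma> * (2 - \<gamma> * \<tau> * T) * quad u)"
    using contract_le K_nonneg by (simp add: mult_left_mono)
  finally show "(\<integral>\<omega>. (inner (z m t \<omega>) (contract u (d (m, t) \<omega>)))\<^sup>2 \<partial>Q)
      \<le> K * ((norm u)\<^sup>2 - \<gamma> * (2 - \<gamma> * \<tau> * T) * quad u)" .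
qed

lemma noise_sample:
  assumes m: "m \<in> {1..M}" and t: "t \<in> {1..N}"
  shows "integrable Q (\<lambda>\<omega>. (noise m t \<omega> * inner u (X m t \<omega>))\<^sup>2)"
    and "(\<integral>\<omega>. (noise m t \<omega> * inner u (X m t \<omega>))\<^sup>2 \<partial>Q) \<le> s * quad u"
    and "integrable Q (\<lambda>\<omega>. noise m t \<omega> * inner u (X m t \<omega>))"
    and "(\<integral>\<omega>. noise m t \<omega> * inner u (X m t \<omega>) \<partial>Q) = 0"
proof -
  have "integrable D (\<lambda>p. e p * inner u (fst p))"
    by (rule D.integrable_of_square[OF _ noise_integrable]) measurable
  then show "integrable Q (\<lambda>\<omega>. (noise m t \<omega> * inner u (X m t \<omega>))\<^sup>2)"
    and "(\<integral>\<omega>. (noise m t \<omega> * inner u (X m t \<omega>))\<^sup>2 \<partial>Q) \<le> s * quad u"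
    and "integrable Q (\<lambda>\<omega>. noise m t \<omega> * inner u (X m t \<omega>))"
    and "(\<integral>\<omega>. noise m t \<omega> * inner u (X m t \<omega>) \<partial>Q) = 0"
    using noise_integrable noise_le noise_mean
    by (simp_all add: of_sample[OF m t, of "\<lambda>p. (e p * inner u (fst p))\<^sup>2"]
        of_sample[OF m t, of "\<lambda>p. e p * inner u (fst p)"])
qed

text \<open>The noise and \<open>contract u\<close> depend on the same x, so E[e x] = 0 does not
  help given the past. For start 0 the sample is frozen instead and the iterate averages to
  \<open>mean 0 t = 0\<close>; for zero noise there is nothing to show.\<close>

lemma step_cross:
  assumes m: "m \<in> {1..M}" and t: "t \<in> {1..N}" and bm: "bounded_moments m t"
  shows "integrable Q (\<lambda>\<omega>. inner (z m t \<omega>) (contract u (d (m, t) \<omega>)) * (noise m t \<omega> * inner u (X m t \<omega>)))"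
    and "(\<integral>\<omega>. inner (z m t \<omega>) (contract u (d (m, t) \<omega>)) * (noise m t \<omega> * inner u (X m t \<omega>)) \<partial>Q) = 0"
proof -
  have "integrable Q (\<lambda>\<omega>. inner (z m t \<omega>) (contract u (d (m, t) \<omega>)) * (noise m t \<omega> * inner u (X m t \<omega>)))
    \<and> (\<integral>\<omega>. inner (z m t \<omega>) (contract u (d (m, t) \<omega>)) * (noise m t \<omega> * inner u (X m t \<omega>)) \<partial>Q) = 0"
    using bias_or_variance
  proof
    assume z1: "z1 = 0"
    have t': "t \<le> Suc N" using t by simp
    note bm' = sq_integrable[OF m t' bm] sq_le[OF m t' bm] z_mean[OF m t' bm] z_integrable[OF m t' bm]
    let ?f = "\<lambda>a p. inner a (contract u p) * (e p * inner u (fst p))"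
    let ?g = "\<lambda>p. K * (norm (contract u p))\<^sup>2 + (e p * inner u (fst p))\<^sup>2"
    have f: "(\<lambda>(a, p). ?f a p) \<in> borel_measurable borel" unfolding split_beta' by measurable
    have int: "integrable Q (\<lambda>\<omega>. ?f (z m t \<omega>) p)" for p using bm'(4) by simp
    have g: "integrable D ?g"
      by (intro Bochner_Integration.integrable_add integrable_mult_right contract_integrable noise_integrable)
    have le: "(\<integral>\<omega>. \<bar>?f (z m t \<omega>) p\<bar> \<partial>Q) \<le> ?g p" for p
    proof -
      have "(\<integral>\<omega>. \<bar>?f (z m t \<omega>) p\<bar> \<partial>Q)
          \<le> (\<integral>\<omega>. (inner (z m t \<omega>) (contract u p))\<^sup>2 + (e p * inner u (fst p))\<^sup>2 \<partial>Q)"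
        using bm'(1) by (intro integral_mono') (auto intro: abs_mult_le_squares)
      also have "\<dots> = (\<integral>\<omega>. (inner (z m t \<omega>) (contract u p))\<^sup>2 \<partial>Q) + (e p * inner u (fst p))\<^sup>2"
        using bm'(1) by (subst Bochner_Integration.integral_add) (auto simp: Q.prob_space)
      finally show ?thesis using bm'(2)[of "contract u p"] by linarith
    qed
    have "(\<integral>\<omega>. ?f (z m t \<omega>) p \<partial>Q) = inner (mean z1 t) (contract u p) * (e p * inner u (fst p))" for p
      by (simp only: integral_mult_left_zero bm'(3))
    moreover have "inner (mean z1 t) w = 0" for w
      unfolding z1 mean_zero by simp
    ultimately have 0: "(\<integral>p. (\<integral>\<omega>. ?f (z m t \<omega>) p \<partial>Q) \<partial>D) = 0"
      by (simp only: mult_zero_left integral_zero)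
    show ?thesis
      using given_sample[OF m t f int g le] unfolding 0 by blast
  qed simp
  then show "integrable Q (\<lambda>\<omega>. inner (z m t \<omega>) (contract u (d (m, t) \<omega>)) * (noise m t \<omega> * inner u (X m t \<omega>)))"
    and "(\<integral>\<omega>. inner (z m t \<omega>) (contract u (d (m, t) \<omega>)) * (noise m t \<omega> * inner u (X m t \<omega>)) \<partial>Q) = 0"
    by auto
qed

lemma step_sq:
  assumes m: "m \<in> {1..M}" and t: "t \<in> {1..N}" and bm: "bounded_moments m t"
  shows "integrable Q (\<lambda>\<omega>. (inner (z m (Suc t) \<omega>) u)\<^sup>2)"
    and "(\<integral>\<omega>. (inner (z m (Suc t) \<omega>) u)\<^sup>2 \<partial>Q)
      \<le> (\<integral>\<omega>. (inner (z m t \<omega>) (contract u (d (m, t) \<omega>)))\<^sup>2 \<partial>Q) + \<gamma>\<^sup>2 * (s * quad u)"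
proof -
  let ?a = "\<lambda>\<omega>. inner (z m t \<omega>) (contract u (d (m, t) \<omega>))"
  let ?c = "\<lambda>\<omega>. noise m t \<omega> * inner u (X m t \<omega>)"
  have eq: "(inner (z m (Suc t) \<omega>) u)\<^sup>2 = (?a \<omega>)\<^sup>2 + 2 * \<gamma> * (?a \<omega> * ?c \<omega>) + \<gamma>\<^sup>2 * (?c \<omega>)\<^sup>2" for \<omega>
  proof -
    have "inner (z m (Suc t) \<omega>) u = ?a \<omega> + \<gamma> * ?c \<omega>" using z_Suc_inner t by simp
    then show ?thesis by (simp only: power2_eq_square) (simp add: algebra_simps)
  qed
  note int = step_contract(1)[OF m t bm, of u] step_cross[OF m t bm, of u] noise_sample[OF m t, of u]
  show "integrable Q (\<lambda>\<omega>. (inner (z m (Suc t) \<omega>) u)\<^sup>2)"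
    unfolding eq using int
    by (intro Bochner_Integration.integrable_add integrable_mult_right)
  have "(\<integral>\<omega>. (inner (z m (Suc t) \<omega>) u)\<^sup>2 \<partial>Q)
      = (\<integral>\<omega>. (?a \<omega>)\<^sup>2 \<partial>Q) + 2 * \<gamma> * (\<integral>\<omega>. ?a \<omega> * ?c \<omega> \<partial>Q) + \<gamma>\<^sup>2 * (\<integral>\<omega>. (?c \<omega>)\<^sup>2 \<partial>Q)"
    unfolding eq using int
    by (simp add: Bochner_Integration.integral_add Bochner_Integration.integrable_add integrable_mult_right
        del: integrable_mult_right_iff)
  also have "\<dots> \<le> (\<integral>\<omega>. (?a \<omega>)\<^sup>2 \<partial>Q) + \<gamma>\<^sup>2 * (s * quad u)"
    unfolding int(3) using int(5) by (simp add: mult_left_mono)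
  finally show "(\<integral>\<omega>. (inner (z m (Suc t) \<omega>) u)\<^sup>2 \<partial>Q)
      \<le> (\<integral>\<omega>. (?a \<omega>)\<^sup>2 \<partial>Q) + \<gamma>\<^sup>2 * (s * quad u)" .
qed

lemma second_product_integrable: "integrable D (\<lambda>p. inner a (fst p) * inner u (fst p))"
  by (rule integrable_mult_of_squares[OF _ _ second_integrable second_integrable]) measurable

lemma step_mean:
  assumes m: "m \<in> {1..M}" and t: "t \<in> {1..N}" and bm: "bounded_moments m t"
  shows "(\<integral>\<omega>. inner (z m (Suc t) \<omega>) u \<partial>Q) = inner (mean z1 (Suc t)) u"
proof -
  have t': "t \<le> Suc N" using t by simp
  note bm' = sq_integrable[OF m t' bm] sq_le[OF m t' bm] z_mean[OF m t' bm] z_integrable[OF m t' bm]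
  let ?f = "\<lambda>a p. inner a (contract u p)"
  let ?g = "\<lambda>p. 1 + K * (norm (contract u p))\<^sup>2"
  have f: "(\<lambda>(a, p). ?f a p) \<in> borel_measurable borel" unfolding split_beta' by measurable
  have g: "integrable D ?g"
    by (intro Bochner_Integration.integrable_add integrable_mult_right contract_integrable) simp
  have le: "(\<integral>\<omega>. \<bar>?f (z m t \<omega>) p\<bar> \<partial>Q) \<le> ?g p" for p
  proof -
    have "(\<integral>\<omega>. \<bar>?f (z m t \<omega>) p\<bar> \<partial>Q) \<le> (\<integral>\<omega>. 1 + (?f (z m t \<omega>) p)\<^sup>2 \<partial>Q)"
      using bm'(1) abs_mult_le_squares[of 1] by (intro integral_mono') auto
    also have "\<dots> = 1 + (\<integral>\<omega>. (?f (z m t \<omega>) p)\<^sup>2 \<partial>Q)"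
      using bm'(1) by (subst Bochner_Integration.integral_add) (auto simp: Q.prob_space)
    finally show ?thesis using bm'(2)[of "contract u p"] by linarith
  qed
  note F = given_sample[OF m t f bm'(4) g le]
  note c = noise_sample[OF m t, of u]
  have "(\<integral>\<omega>. inner (z m (Suc t) \<omega>) u \<partial>Q)
      = (\<integral>\<omega>. ?f (z m t \<omega>) (d (m, t) \<omega>) + \<gamma> * (noise m t \<omega> * inner u (X m t \<omega>)) \<partial>Q)"
    using t by (intro Bochner_Integration.integral_cong refl) (simp add: z_Suc_inner)
  also have "\<dots> = (\<integral>p. inner (mean z1 t) (contract u p) \<partial>D)"
    using F(1) c(3,4) unfolding bm'(3)[symmetric] F(2)[symmetric]
    by (subst Bochner_Integration.integral_add) auto
  also have "\<dots> = (\<integral>p. inner (mean z1 t) u - \<gamma> * (inner (mean z1 t) (fst p) * inner u (fst p)) \<partial>D)"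
    by (intro Bochner_Integration.integral_cong) (auto simp: inner_diff_right)
  also have "\<dots> = inner (mean z1 t) u - \<gamma> * inner (mean z1 t) (H u)"
    using second_product_integrable
    by (subst Bochner_Integration.integral_diff) (auto simp: second_eq D.prob_space)
  also have "\<dots> = inner (mean z1 (Suc t)) u"
    using t by (simp add: inner_diff_left H_symmetric)
  finally show ?thesis .
qed

lemma bounded_moments_all:
  assumes m: "m \<in> {1..M}"
  shows "t \<in> {1..Suc N} \<Longrightarrow> bounded_moments m t"
proof (induction t)
  case (Suc t)
  show ?case
  proof (cases "t = 0")
    case True
    have "(inner z1 u)\<^sup>2 \<le> K * (norm u)\<^sup>2" for u
    proof -
      have "(inner z1 u)\<^sup>2 \<le> (norm z1)\<^sup>2 * (norm u)\<^sup>2"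
        using Cauchy_Schwarz_ineq[of z1 u] by (simp add: power2_norm_eq_inner)
      also have "\<dots> \<le> K * (norm u)\<^sup>2"
        unfolding K_def using s_nonneg gamma_pos gamma_less
        by (intro mult_right_mono) (auto simp: mult.assoc)
      finally show ?thesis .
    qed
    then show ?thesis using True unfolding bounded_moments_def by (simp add: Q.prob_space)
  next
    case False
    then have t: "t \<in> {1..N}" and bm: "bounded_moments m t" using Suc by auto
    have "(\<integral>\<omega>. (inner (z m (Suc t) \<omega>) u)\<^sup>2 \<partial>Q) \<le> K * (norm u)\<^sup>2" for u
    proof -
      have "(\<integral>\<omega>. (inner (z m (Suc t) \<omega>) u)\<^sup>2 \<partial>Q)
          \<le> K * ((norm u)\<^sup>2 - \<gamma> * (2 - \<gamma> * \<tau> * T) * quad u) + \<gamma>\<^sup>2 * (s * quad u)"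
        using step_sq(2)[OF m t bm, of u] step_contract(2)[OF m t bm, of u] by linarith
      \<comment> \<open>\<open>K_step\<close> bounds the inner bracket by \<open>K\<close>, so the
        factor multiplying \<gamma> <u,Hu> is at least \<open>K\<close> and the subtracted term is
        nonnegative.\<close>
      also have "\<dots> = K * (norm u)\<^sup>2 - \<gamma> * quad u * (2 * K - (\<gamma> * s + \<gamma> * \<tau> * T * K))"
        by (simp add: power2_eq_square[of \<gamma>] algebra_simps)
      also have "\<dots> \<le> K * (norm u)\<^sup>2"
        using K_step K_nonneg gamma_pos H_nonneg[of u] by simp
      finally show ?thesis .
    qed
    then show ?thesis
      unfolding bounded_moments_def using step_sq(1)[OF m t bm] step_mean[OF m t bm] by blast
  qed
qed simp

end

section \<open>Correlations along eigenvectors\<close>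

text \<open>To the right of the diagonal, row i consists of \<open>g i i\<close> times powers of r,
  so it contributes at most a geometric sum; symmetry accounts for the factor 2.\<close>

lemma double_sum_le_diagonal:
  fixes g :: "nat \<Rightarrow> nat \<Rightarrow> real"
  assumes sym: "\<And>i j. g i j = g j i" and nn: "\<And>i. 0 \<le> g i i" and r: "0 \<le> r"
    and step: "\<And>i j. 1 \<le> i \<Longrightarrow> i \<le> j \<Longrightarrow> j < n \<Longrightarrow> g i (Suc j) = r * g i j"
  shows "(\<Sum>i=1..n. \<Sum>j=1..n. g i j) \<le> 2 * (\<Sum>i<n. r ^ i) * (\<Sum>i=1..n. g i i)"
proof -
  define G where "G k = (\<Sum>i<k. r ^ i)" for k
  have pow: "g i (i + k) = r ^ k * g i i" if "1 \<le> i" "i + k \<le> n" for i k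
    using that by (induction k) (auto simp: step)
  \<comment> \<open>\<open>G (Suc m - i)\<close> is the exact geometric sum of row i from column i
    to m; keeping it exact lets the induction close, and it is enlarged to \<open>G n\<close> only
    afterwards. Counting the diagonal twice gives the uniform factor 2.\<close>
  have "m \<le> n \<Longrightarrow> (\<Sum>i=1..m. \<Sum>j=1..m. g i j) \<le> 2 * (\<Sum>i=1..m. g i i * G (Suc m - i))" for m
  proof (induction m)
    case (Suc m)
    have "(\<Sum>j=1..m. g (Suc m) j) = (\<Sum>i=1..m. g i (Suc m))" by (intro sum.cong refl sym)
    then have "(\<Sum>i=1..Suc m. \<Sum>j=1..Suc m. g i j)
        = (\<Sum>i=1..m. \<Sum>j=1..m. g i j) + 2 * (\<Sum>i=1..m. g i (Suc m)) + g (Suc m) (Suc m)"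
      by (simp add: sum.distrib)
    also have "\<dots> \<le> 2 * (\<Sum>i=1..m. g i i * G (Suc m - i)) + 2 * (\<Sum>i=1..m. g i (Suc m)) + 2 * g (Suc m) (Suc m)"
      using Suc nn[of "Suc m"] by simp
    also have "(\<Sum>i=1..m. g i (Suc m)) = (\<Sum>i=1..m. g i i * r ^ (Suc m - i))"
      using Suc.prems pow[of _ "Suc m - _"]
      by (intro sum.cong refl) (metis (no_types, lifting) Suc_leI atLeastAtMost_iff
          le_SucI le_add_diff_inverse mult.commute)
    also have "2 * (\<Sum>i=1..m. g i i * G (Suc m - i)) + 2 * (\<Sum>i=1..m. g i i * r ^ (Suc m - i))
        = 2 * (\<Sum>i=1..m. g i i * G (Suc (Suc m) - i))"
      unfolding distrib_left[symmetric] sum.distrib[symmetric]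
      by (intro arg_cong[of _ _ "\<lambda>s. 2 * s"] sum.cong refl) (auto simp: G_def Suc_diff_le)
    finally show ?case by (simp add: G_def)
  qed simp
  from this[of n] have "(\<Sum>i=1..n. \<Sum>j=1..n. g i j) \<le> 2 * (\<Sum>i=1..n. g i i * G (Suc n - i))" by simp
  also have "\<dots> \<le> 2 * (\<Sum>i=1..n. g i i * G n)"
    unfolding G_def using nn r
    by (intro mult_left_mono sum_mono sum_mono2) auto
  finally show ?thesis unfolding sum_distrib_right[symmetric] G_def by (simp add: mult_ac)
qed

text \<open>With r^2 \<le> r the partial sums satisfy s_(m+1) \<le> C + r s_m, where C is the
  initial value plus the total forcing. Geometric sums multiplied by C satisfy the same recursion
  with equality.\<close>

lemma sum_of_contracting_le:
  fixes q c :: "nat \<Rightarrow> real"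
  assumes r: "0 \<le> r" "r \<le> 1" and q: "\<And>t. 0 \<le> q t" and c: "\<And>t. 0 \<le> c t"
    and step: "\<And>t. 1 \<le> t \<Longrightarrow> t < n \<Longrightarrow> q (Suc t) \<le> r\<^sup>2 * q t + c t"
  shows "(\<Sum>t=1..n. q t) \<le> (\<Sum>i<n. r ^ i) * (q 1 + (\<Sum>t=1..n. c t))"
proof -
  let ?C = "q 1 + (\<Sum>t=1..n. c t)"
  have "m \<le> n \<Longrightarrow> (\<Sum>t=1..m. q t) \<le> (\<Sum>i<m. r ^ i) * ?C" for m
  proof (induction m)
    case (Suc m)
    have "(\<Sum>t=1..Suc m. q t) = q 1 + (\<Sum>t=1..m. q (Suc t))"
      by (simp add: sum.atLeast1_atMost_eq sum.lessThan_Suc_shift del: sum.lessThan_Suc sum.cl_ivl_Suc)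
    also have "(\<Sum>t=1..m. q (Suc t)) \<le> (\<Sum>t=1..m. r\<^sup>2 * q t + c t)"
      using Suc.prems by (intro sum_mono step) auto
    also have "\<dots> = r\<^sup>2 * (\<Sum>t=1..m. q t) + (\<Sum>t=1..m. c t)"
      by (simp add: sum.distrib sum_distrib_left)
    also have "\<dots> \<le> r * (\<Sum>t=1..m. q t) + (\<Sum>t=1..n. c t)"
      using r q c Suc.prems
      by (intro add_mono mult_right_mono sum_mono2)
        (auto simp: power2_eq_square mult_left_le_one_le intro: sum_nonneg)
    also have "r * (\<Sum>t=1..m. q t) \<le> r * ((\<Sum>i<m. r ^ i) * ?C)"
      using Suc r by (intro mult_left_mono) auto
    finally have "(\<Sum>t=1..Suc m. q t) \<le> (1 + r * (\<Sum>i<m. r ^ i)) * ?C"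
      by (simp add: algebra_simps)
    also have "1 + r * (\<Sum>i<m. r ^ i) = (\<Sum>i<Suc m. r ^ i)"
      by (subst sum.lessThan_Suc_shift) (simp add: sum_distrib_left)
    finally show ?case .
  qed simp
  then show ?thesis by simp
qed

context sgd_process
begin

lemma moments:
  assumes "m \<in> {1..M}" "t \<in> {1..Suc N}"
  shows "integrable Q (\<lambda>\<omega>. (inner (z m t \<omega>) u)\<^sup>2)"
    and "(\<integral>\<omega>. (inner (z m t \<omega>) u)\<^sup>2 \<partial>Q) \<le> K * (norm u)\<^sup>2"
    and "(\<integral>\<omega>. inner (z m t \<omega>) u \<partial>Q) = inner (mean z1 t) u"
    and "integrable Q (\<lambda>\<omega>. inner (z m t \<omega>) u)"
  using sq_integrable sq_le z_mean z_integrable bounded_moments_all assms by auto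

lemma product_integrable:
  assumes m: "m \<in> {1..M}" "m' \<in> {1..M}" and t: "t \<in> {1..Suc N}" "r \<in> {1..Suc N}"
  shows "integrable Q (\<lambda>\<omega>. inner (z m r \<omega>) u * inner (z m' t \<omega>) w)"
proof -
  have [measurable]: "z m r \<in> borel_measurable Q" "z m' t \<in> borel_measurable Q"
    using m t by (auto intro: z_measurable)
  show ?thesis using m t by (intro integrable_mult_of_squares moments) auto
qed

text \<open>Coordinate j contributes at most K lam j, and the eigenvalues are summable; E <z,Hz> is
  thus finite without passing through E |z|^2.\<close>

lemma quad_z_integrable:
  assumes "m \<in> {1..M}" "t \<in> {1..Suc N}"
  shows "integrable Q (\<lambda>\<omega>. quad (z m t \<omega>))"
proof (rule quad_expectation(1)[where R = "\<lambda>j. K * lam j"])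
  show "((\<lambda>j. K * lam j) has_sum K * infsum lam {1..}) {1..}"
    by (intro has_sum_cmult_right has_sum_infsum lam_summable)
  fix j :: nat assume j: "j \<ge> 1"
  have "(\<integral>\<omega>. (inner (z m t \<omega>) (v j))\<^sup>2 \<partial>Q) \<le> K * (norm (v j))\<^sup>2"
    using moments assms by blast
  also have "\<dots> \<le> K * 1"
    using norm_v_le[OF j] K_nonneg by (intro mult_left_mono) (auto simp: power_le_one)
  finally show "lam j * (\<integral>\<omega>. (inner (z m t \<omega>) (v j))\<^sup>2 \<partial>Q) \<le> K * lam j"
    using lam_nonneg[OF j] by (subst mult.commute) (simp add: mult_right_mono)
qed (use assms in \<open>auto intro: moments z_measurable Q.prob_space_axioms\<close>)

text \<open>Given the past, x \<otimes> x averages to \<open>H\<close>. The domination uses the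
  rank-one fourth moment with the iterate in the role of b, and \<open>quad_z_integrable\<close>
  makes the resulting majorant integrable.\<close>

lemma sample_product:
  assumes m: "m \<in> {1..M}" and t: "t \<in> {1..N}" and r: "1 \<le> r" "r \<le> t"
  shows "integrable Q (\<lambda>\<omega>. inner (z m r \<omega>) u * (inner (z m t \<omega>) (X m t \<omega>) * inner u (X m t \<omega>)))"
    and "(\<integral>\<omega>. inner (z m r \<omega>) u * (inner (z m t \<omega>) (X m t \<omega>) * inner u (X m t \<omega>)) \<partial>Q)
      = (\<integral>\<omega>. inner (z m r \<omega>) u * inner (z m t \<omega>) (H u) \<partial>Q)"
proof -
  have t': "t \<in> {1..Suc N}" "r \<in> {1..Suc N}" using t r by auto
  let ?f = "\<lambda>a p. inner (fst a) u * (inner (snd a) (fst p) * inner u (fst p))"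
  let ?g = "\<lambda>a. (inner (fst a) u)\<^sup>2 + \<tau> * quad (snd a) * quad u"
  have f: "(\<lambda>(a, p). ?f a p) \<in> borel_measurable (borel :: (('h \<times> 'h) \<times> 'h \<times> real) measure)"
    unfolding split_beta' by measurable
  have int: "integrable D (?f a)" for a :: "'h \<times> 'h"
    by (intro integrable_mult_right second_product_integrable)
  have g: "integrable Q (\<lambda>\<omega>. ?g (z m r \<omega>, z m t \<omega>))"
    using moments(1)[OF m t'(2)] quad_z_integrable[OF m t'(1)] by simp
  have le: "(\<integral>p. \<bar>?f a p\<bar> \<partial>D) \<le> ?g a" for a :: "'h \<times> 'h"
  proof -
    have "(\<integral>p. \<bar>?f a p\<bar> \<partial>D)
        \<le> (\<integral>p. (inner (fst a) u)\<^sup>2 + (inner (snd a) (fst p))\<^sup>2 * (inner u (fst p))\<^sup>2 \<partial>D)"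
      using fourth_rank_one_integrable
      by (intro integral_mono') (auto intro: abs_mult_le_squares simp flip: power_mult_distrib)
    also have "\<dots> = (inner (fst a) u)\<^sup>2 + (\<integral>p. (inner (snd a) (fst p))\<^sup>2 * (inner u (fst p))\<^sup>2 \<partial>D)"
      using fourth_rank_one_integrable
      by (subst Bochner_Integration.integral_add) (auto simp: D.prob_space)
    finally show ?thesis using fourth_rank_one_le[of "snd a" u] by linarith
  qed
  note F = given_past[OF m t r(2) f int g le]
  show "integrable Q (\<lambda>\<omega>. inner (z m r \<omega>) u * (inner (z m t \<omega>) (X m t \<omega>) * inner u (X m t \<omega>)))"
    using F(1) by simp
  show "(\<integral>\<omega>. inner (z m r \<omega>) u * (inner (z m t \<omega>) (X m t \<omega>) * inner u (X m t \<omega>)) \<partial>Q)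
      = (\<integral>\<omega>. inner (z m r \<omega>) u * inner (z m t \<omega>) (H u) \<partial>Q)"
    using F(2) by (simp add: second_eq)
qed

text \<open>The second claim integrates over the sample first and serves the bias; the third
  integrates over the iterate first and serves the variance.\<close>

lemma sample_fourth:
  assumes m: "m \<in> {1..M}" and t: "t \<in> {1..N}"
  shows "integrable Q (\<lambda>\<omega>. (inner (z m t \<omega>) (X m t \<omega>))\<^sup>2 * (inner u (X m t \<omega>))\<^sup>2)"
    and "(\<integral>\<omega>. (inner (z m t \<omega>) (X m t \<omega>))\<^sup>2 * (inner u (X m t \<omega>))\<^sup>2 \<partial>Q)
      \<le> \<tau> * quad u * (\<integral>\<omega>. quad (z m t \<omega>) \<partial>Q)"
    and "(\<integral>\<omega>. (inner (z m t \<omega>) (X m t \<omega>))\<^sup>2 * (inner u (X m t \<omega>))\<^sup>2 \<partial>Q)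
      \<le> K * (\<tau> * T * quad u)"
proof -
  have t': "t \<in> {1..Suc N}" using t by auto
  let ?f = "\<lambda>a p. (inner (snd a) (fst p))\<^sup>2 * (inner u (fst p))\<^sup>2"
  let ?g = "\<lambda>a. \<tau> * quad (snd a) * quad u"
  have f: "(\<lambda>(a, p). ?f a p) \<in> borel_measurable (borel :: (('h \<times> 'h) \<times> 'h \<times> real) measure)"
    unfolding split_beta' by measurable
  have g: "integrable Q (\<lambda>\<omega>. ?g (z m t \<omega>, z m t \<omega>))"
    using quad_z_integrable[OF m t'] by simp
  have le: "(\<integral>p. \<bar>?f a p\<bar> \<partial>D) \<le> ?g a" for a :: "'h \<times> 'h"
    using fourth_rank_one_le[of "snd a" u] by simp
  note F = given_past[OF m t order_refl f fourth_rank_one_integrable g le]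
  show "integrable Q (\<lambda>\<omega>. (inner (z m t \<omega>) (X m t \<omega>))\<^sup>2 * (inner u (X m t \<omega>))\<^sup>2)"
    using F(1) by simp
  have "(\<integral>\<omega>. (\<integral>p. ?f (z m t \<omega>, z m t \<omega>) p \<partial>D) \<partial>Q) \<le> (\<integral>\<omega>. \<tau> * quad (z m t \<omega>) * quad u \<partial>Q)"
    using fourth_rank_one_le quad_z_integrable[OF m t'] tau_pos H_nonneg
    by (intro integral_mono') auto
  also have "\<dots> = \<tau> * quad u * (\<integral>\<omega>. quad (z m t \<omega>) \<partial>Q)"
    by (simp add: mult_ac)
  finally have "(\<integral>\<omega>. (\<integral>p. ?f (z m t \<omega>, z m t \<omega>) p \<partial>D) \<partial>Q) \<le> \<tau> * quad u * (\<integral>\<omega>. quad (z m t \<omega>) \<partial>Q)" .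
  then show "(\<integral>\<omega>. (inner (z m t \<omega>) (X m t \<omega>))\<^sup>2 * (inner u (X m t \<omega>))\<^sup>2 \<partial>Q)
      \<le> \<tau> * quad u * (\<integral>\<omega>. quad (z m t \<omega>) \<partial>Q)"
    using F(2) by simp
  let ?h = "\<lambda>a p. (inner a (fst p))\<^sup>2 * (inner u (fst p))\<^sup>2"
  have h: "(\<lambda>(a, p). ?h a p) \<in> borel_measurable (borel :: ('h \<times> 'h \<times> real) measure)"
    unfolding split_beta' by measurable
  have hint: "integrable Q (\<lambda>\<omega>. ?h (z m t \<omega>) p)" for p
    using moments(1)[OF m t'] by simp
  have k: "integrable D (\<lambda>p. K * ((norm (fst p))\<^sup>2 * (inner u (fst p))\<^sup>2))"
    by (intro integrable_mult_right fourth_integrable)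
  have kle: "(\<integral>\<omega>. \<bar>?h (z m t \<omega>) p\<bar> \<partial>Q) \<le> K * ((norm (fst p))\<^sup>2 * (inner u (fst p))\<^sup>2)" for p
    using mult_right_mono[OF moments(2)[OF m t', of "fst p"], of "(inner u (fst p))\<^sup>2"] by (simp add: mult.assoc)
  have "(\<integral>\<omega>. ?h (z m t \<omega>) (d (m, t) \<omega>) \<partial>Q) = (\<integral>p. (\<integral>\<omega>. ?h (z m t \<omega>) p \<partial>Q) \<partial>D)"
    by (rule given_sample(2)[OF m t h hint k kle])
  also have "\<dots> \<le> (\<integral>p. K * ((norm (fst p))\<^sup>2 * (inner u (fst p))\<^sup>2) \<partial>D)"
    using kle k K_nonneg by (intro integral_mono') auto
  also have "\<dots> \<le> K * (\<tau> * T * quad u)"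
    using fourth_le[of u] K_nonneg by (simp add: mult_left_mono)
  finally show "(\<integral>\<omega>. (inner (z m t \<omega>) (X m t \<omega>))\<^sup>2 * (inner u (X m t \<omega>))\<^sup>2 \<partial>Q) \<le> K * (\<tau> * T * quad u)" .
qed

section \<open>Second moments and time correlations in one eigendirection\<close>

definition q :: "nat \<Rightarrow> nat \<Rightarrow> nat \<Rightarrow> real" where
  "q m t j = (\<integral>\<omega>. (inner (z m t \<omega>) (v j))\<^sup>2 \<partial>Q)"

lemma q_nonneg: "0 \<le> q m t j"
  by (simp add: q_def)

lemma q_1: "q m (Suc 0) j = (inner z1 (v j))\<^sup>2"
  by (simp add: q_def Q.prob_space)

lemma q_Suc_le:
  assumes m: "m \<in> {1..M}" and t: "t \<in> {1..N}" and j: "j \<ge> 1"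
  shows "q m (Suc t) j \<le> (1 - \<gamma> * lam j)\<^sup>2 * q m t j
    + \<gamma>\<^sup>2 * (\<integral>\<omega>. (inner (z m t \<omega>) (X m t \<omega>))\<^sup>2 * (inner (v j) (X m t \<omega>))\<^sup>2 \<partial>Q) + \<gamma>\<^sup>2 * (s * lam j)"
proof -
  have t': "t \<in> {1..Suc N}" "1 \<le> t" using t by auto
  let ?F = "\<lambda>\<omega>. (inner (z m t \<omega>) (X m t \<omega>))\<^sup>2 * (inner (v j) (X m t \<omega>))\<^sup>2"
  let ?P = "\<lambda>\<omega>. inner (z m t \<omega>) (v j) * (inner (z m t \<omega>) (X m t \<omega>) * inner (v j) (X m t \<omega>))"
  have eq: "(inner (z m t \<omega>) (contract (v j) (d (m, t) \<omega>)))\<^sup>2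
      = (inner (z m t \<omega>) (v j))\<^sup>2 - 2 * \<gamma> * ?P \<omega> + \<gamma>\<^sup>2 * ?F \<omega>" for \<omega>
    by (simp add: inner_diff_right power2_eq_square algebra_simps)
  note int = moments(1)[OF m t'(1), of "v j"] sample_product[OF m t t'(2) order_refl, of "v j"]
    sample_fourth(1)[OF m t, of "v j"]
  have "(\<integral>\<omega>. (inner (z m t \<omega>) (contract (v j) (d (m, t) \<omega>)))\<^sup>2 \<partial>Q)
      = q m t j - 2 * \<gamma> * (\<integral>\<omega>. ?P \<omega> \<partial>Q) + \<gamma>\<^sup>2 * (\<integral>\<omega>. ?F \<omega> \<partial>Q)"
    unfolding eq q_def using int(1,2,4) by simp
  also have "(\<integral>\<omega>. ?P \<omega> \<partial>Q) = lam j * q m t j"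
    unfolding int(3) q_def H_v[OF j] by (simp add: power2_eq_square mult_ac)
  \<comment> \<open>1 - 2 \<gamma> lam j equals (1 - \<gamma> lam j)^2 - (\<gamma> lam j)^2; the
    last square is discarded, while the fourth-order term stays whole as forcing.\<close>
  finally have "(\<integral>\<omega>. (inner (z m t \<omega>) (contract (v j) (d (m, t) \<omega>)))\<^sup>2 \<partial>Q)
      = (1 - \<gamma> * lam j)\<^sup>2 * q m t j - (\<gamma> * lam j)\<^sup>2 * q m t j + \<gamma>\<^sup>2 * (\<integral>\<omega>. ?F \<omega> \<partial>Q)"
    by (simp add: power2_eq_square algebra_simps)
  moreover have "0 \<le> (\<gamma> * lam j)\<^sup>2 * q m t j" by (simp add: q_nonneg)
  ultimately show ?thesis
    using step_sq(2)[OF m t bounded_moments_all[OF m t'(1)], of "v j"]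
    unfolding q_def[symmetric] quad_v[OF j] by linarith
qed

text \<open>Only the later iterate involves sample \<open>t\<close>, so conditioning on the past
  suffices here: the noise averages to 0 against \<open>v j\<close>, and \<open>H (v j)\<close>
  being a multiple of \<open>v j\<close> closes the recursion exactly.\<close>

lemma correlation_Suc:
  assumes m: "m \<in> {1..M}" and t: "t \<in> {1..N}" and r: "1 \<le> r" "r \<le> t" and j: "j \<ge> 1"
  shows "(\<integral>\<omega>. inner (z m r \<omega>) (v j) * inner (z m (Suc t) \<omega>) (v j) \<partial>Q)
    = (1 - \<gamma> * lam j) * (\<integral>\<omega>. inner (z m r \<omega>) (v j) * inner (z m t \<omega>) (v j) \<partial>Q)"
proof -
  have t': "t \<in> {1..Suc N}" "r \<in> {1..Suc N}" using t r by auto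
  let ?A = "\<lambda>\<omega>. inner (z m r \<omega>) (v j) * inner (z m t \<omega>) (v j)"
  let ?P = "\<lambda>\<omega>. inner (z m r \<omega>) (v j) * (inner (z m t \<omega>) (X m t \<omega>) * inner (v j) (X m t \<omega>))"
  let ?E = "\<lambda>\<omega>. inner (z m r \<omega>) (v j) * (noise m t \<omega> * inner (v j) (X m t \<omega>))"
  have eq: "inner (z m r \<omega>) (v j) * inner (z m (Suc t) \<omega>) (v j) = ?A \<omega> - \<gamma> * ?P \<omega> + \<gamma> * ?E \<omega>" for \<omega>
    using t by (simp add: z_Suc_inner inner_diff_right algebra_simps)
  note int = product_integrable[OF m m t', of "v j" "v j"] sample_product[OF m t r, of "v j"]
  have E: "integrable Q ?E" "(\<integral>\<omega>. ?E \<omega> \<partial>Q) = 0"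
  proof -
    let ?f = "\<lambda>a p. inner (fst a) (v j) * (e p * inner (v j) (fst p))"
    let ?g = "\<lambda>a. (inner (fst a) (v j))\<^sup>2 + s * quad (v j)"
    have f: "(\<lambda>(a, p). ?f a p) \<in> borel_measurable (borel :: (('h \<times> 'h) \<times> 'h \<times> real) measure)"
      unfolding split_beta' by measurable
    have eint: "integrable D (\<lambda>p. e p * inner (v j) (fst p))"
      by (rule D.integrable_of_square[OF _ noise_integrable]) measurable
    have fint: "integrable D (?f a)" for a :: "'h \<times> 'h"
      using eint by simp
    have g: "integrable Q (\<lambda>\<omega>. ?g (z m r \<omega>, z m t \<omega>))"
      using moments(1)[OF m t'(2)] by simp
    have le: "(\<integral>p. \<bar>?f a p\<bar> \<partial>D) \<le> ?g a" for a :: "'h \<times> 'h"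
    proof -
      have "(\<integral>p. \<bar>?f a p\<bar> \<partial>D) \<le> (\<integral>p. (inner (fst a) (v j))\<^sup>2 + (e p * inner (v j) (fst p))\<^sup>2 \<partial>D)"
        using noise_integrable by (intro integral_mono') (auto intro: abs_mult_le_squares)
      also have "\<dots> = (inner (fst a) (v j))\<^sup>2 + (\<integral>p. (e p * inner (v j) (fst p))\<^sup>2 \<partial>D)"
        using noise_integrable by (subst Bochner_Integration.integral_add) (auto simp: D.prob_space)
      finally show ?thesis using noise_le[of "v j"] by linarith
    qed
    note F = given_past[OF m t r(2) f fint g le]
    show "integrable Q ?E" using F(1) by simp
    show "(\<integral>\<omega>. ?E \<omega> \<partial>Q) = 0" using F(2) by (simp add: noise_mean)
  qed
  have "(\<integral>\<omega>. inner (z m r \<omega>) (v j) * inner (z m (Suc t) \<omega>) (v j) \<partial>Q)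
      = (\<integral>\<omega>. ?A \<omega> \<partial>Q) - \<gamma> * (\<integral>\<omega>. ?P \<omega> \<partial>Q)"
    unfolding eq using int E by simp
  also have "(\<integral>\<omega>. ?P \<omega> \<partial>Q) = lam j * (\<integral>\<omega>. ?A \<omega> \<partial>Q)"
    unfolding int(3) H_v[OF j] by (simp add: mult_ac)
  finally show ?thesis by (simp add: algebra_simps)
qed

definition path_sum :: "nat \<Rightarrow> nat \<Rightarrow> 'b \<Rightarrow> real" where
  "path_sum m j \<omega> = (\<Sum>t=1..N. inner (z m t \<omega>) (v j))"

lemma path_sum_product:
  assumes m: "m \<in> {1..M}" "m' \<in> {1..M}"
  shows "integrable Q (\<lambda>\<omega>. path_sum m j \<omega> * path_sum m' j \<omega>)"
    and "(\<integral>\<omega>. path_sum m j \<omega> * path_sum m' j \<omega> \<partial>Q)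
      = (\<Sum>i=1..N. \<Sum>t=1..N. \<integral>\<omega>. inner (z m i \<omega>) (v j) * inner (z m' t \<omega>) (v j) \<partial>Q)"
proof -
  have int: "integrable Q (\<lambda>\<omega>. inner (z m i \<omega>) (v j) * inner (z m' t \<omega>) (v j))"
    if "i \<in> {1..N}" "t \<in> {1..N}" for i t
    using m that by (intro product_integrable) auto
  then have int': "integrable Q (\<lambda>\<omega>. \<Sum>t=1..N. inner (z m i \<omega>) (v j) * inner (z m' t \<omega>) (v j))"
    if "i \<in> {1..N}" for i
    using that by (intro Bochner_Integration.integrable_sum)
  show "integrable Q (\<lambda>\<omega>. path_sum m j \<omega> * path_sum m' j \<omega>)"
    unfolding path_sum_def sum_product using int by (intro Bochner_Integration.integrable_sum)
  have "(\<integral>\<omega>. path_sum m j \<omega> * path_sum m' j \<omega> \<partial>Q)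
      = (\<Sum>i=1..N. \<integral>\<omega>. (\<Sum>t=1..N. inner (z m i \<omega>) (v j) * inner (z m' t \<omega>) (v j)) \<partial>Q)"
    unfolding path_sum_def sum_product using int' by (intro Bochner_Integration.integral_sum)
  also have "\<dots> = (\<Sum>i=1..N. \<Sum>t=1..N. \<integral>\<omega>. inner (z m i \<omega>) (v j) * inner (z m' t \<omega>) (v j) \<partial>Q)"
    using int by (intro sum.cong refl Bochner_Integration.integral_sum)
  finally show "(\<integral>\<omega>. path_sum m j \<omega> * path_sum m' j \<omega> \<partial>Q)
      = (\<Sum>i=1..N. \<Sum>t=1..N. \<integral>\<omega>. inner (z m i \<omega>) (v j) * inner (z m' t \<omega>) (v j) \<partial>Q)" .
qed

text \<open>Keeping the factor \<gamma> lam j on the left turns the geometric sum into 1 - r^N and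
  covers zero eigenvalues without a division.\<close>

lemma path_sum_sq_le:
  assumes m: "m \<in> {1..M}" and j: "j \<ge> 1"
  shows "\<gamma> * lam j * (\<integral>\<omega>. (path_sum m j \<omega>)\<^sup>2 \<partial>Q)
    \<le> 2 * (1 - (1 - \<gamma> * lam j) ^ N) * (\<Sum>t=1..N. q m t j)"
proof -
  let ?r = "1 - \<gamma> * lam j"
  let ?g = "\<lambda>i t. \<integral>\<omega>. inner (z m i \<omega>) (v j) * inner (z m t \<omega>) (v j) \<partial>Q"
  have "(\<integral>\<omega>. (path_sum m j \<omega>)\<^sup>2 \<partial>Q) \<le> 2 * (\<Sum>i<N. ?r ^ i) * (\<Sum>i=1..N. ?g i i)"
    unfolding power2_eq_square path_sum_product(2)[OF m m]
    using correlation_Suc[OF m _ _ _ j] power_sum_bounds(1)[OF j]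
    by (intro double_sum_le_diagonal) (auto simp: mult.commute)
  then have "\<gamma> * lam j * (\<integral>\<omega>. (path_sum m j \<omega>)\<^sup>2 \<partial>Q)
      \<le> \<gamma> * lam j * (2 * (\<Sum>i<N. ?r ^ i) * (\<Sum>i=1..N. ?g i i))"
    using gamma_pos lam_nonneg[OF j] by (intro mult_left_mono) auto
  also have "\<dots> = 2 * (\<gamma> * lam j * (\<Sum>i<N. ?r ^ i)) * (\<Sum>t=1..N. q m t j)"
    by (simp add: q_def power2_eq_square mult_ac)
  finally show ?thesis unfolding power_sum_bounds(3)[OF j] .
qed

end

section \<open>Averages over time and machines\<close>

context sgd_process
begin

definition avg :: "'b \<Rightarrow> 'h" where
  "avg \<omega> = dist_avg (M * N) M (\<lambda>m t. z m t \<omega>)"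

context
  assumes M_pos: "M \<ge> 1" and N_pos: "N \<ge> 1"
begin

lemma avg_inner: "inner (avg \<omega>) (v j) = (\<Sum>m=1..M. path_sum m j \<omega>) / (M * N)"
  using M_pos unfolding avg_def dist_avg_def path_sum_def
  by (simp add: inner_sum_left inner_scaleR_left sum_distrib_left[symmetric] divide_inverse mult_ac
      flip: scaleR_sum_right)

lemma avg_measurable [measurable]: "avg \<in> borel_measurable Q"
proof -
  have "(\<lambda>\<omega>. (1 / M) *\<^sub>R (\<Sum>m=1..M. (real M / real (M * N)) *\<^sub>R (\<Sum>t=1..M * N div M. z m t \<omega>)))
      \<in> borel_measurable Q"
    using M_pos by (intro borel_measurable_scaleR borel_measurable_sum borel_measurable_const z_measurable) auto
  then show ?thesis unfolding avg_def dist_avg_def by simp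
qed

lemma avg_sq_integrable: "integrable Q (\<lambda>\<omega>. (inner (avg \<omega>) (v j))\<^sup>2)"
proof -
  have "integrable Q (\<lambda>\<omega>. \<Sum>m=1..M. \<Sum>m'=1..M. path_sum m j \<omega> * path_sum m' j \<omega>)"
    by (intro Bochner_Integration.integrable_sum path_sum_product)
  then show ?thesis
    unfolding avg_inner power_divide by (simp add: power2_eq_square sum_product)
qed

text \<open>Meant for the bias: its machines share a mean that is nonzero in general, so cross terms
  remain, and Cauchy-Schwarz over the machines takes the place of decorrelation.\<close>

lemma avg_sq_le:
  "(\<integral>\<omega>. (inner (avg \<omega>) (v j))\<^sup>2 \<partial>Q) \<le> (\<Sum>m=1..M. \<integral>\<omega>. (path_sum m j \<omega>)\<^sup>2 \<partial>Q) / (M * (real N)\<^sup>2)"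
proof -
  have int: "integrable Q (\<lambda>\<omega>. (path_sum m j \<omega>)\<^sup>2)" if "m \<in> {1..M}" for m
    unfolding power2_eq_square by (rule path_sum_product(1)[OF that that])
  have le: "(inner (avg \<omega>) (v j))\<^sup>2 \<le> (\<Sum>m=1..M. (path_sum m j \<omega>)\<^sup>2) / (M * (real N)\<^sup>2)" for \<omega>
  proof -
    have "(\<Sum>m=1..M. path_sum m j \<omega>)\<^sup>2 \<le> M * (\<Sum>m=1..M. (path_sum m j \<omega>)\<^sup>2)"
      using sum_squared_le_sum_of_squares[of "\<lambda>m. path_sum m j \<omega>" "{1..M}"] M_pos by (simp add: mult.commute)
    then have "(inner (avg \<omega>) (v j))\<^sup>2 \<le> M * (\<Sum>m=1..M. (path_sum m j \<omega>)\<^sup>2) / (real (M * N))\<^sup>2"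
      unfolding avg_inner power_divide by (intro divide_right_mono) auto
    also have "\<dots> = (\<Sum>m=1..M. (path_sum m j \<omega>)\<^sup>2) / (M * (real N)\<^sup>2)"
      using M_pos by (simp add: power2_eq_square)
    finally show ?thesis .
  qed
  have "(\<integral>\<omega>. (inner (avg \<omega>) (v j))\<^sup>2 \<partial>Q) \<le> (\<integral>\<omega>. (\<Sum>m=1..M. (path_sum m j \<omega>)\<^sup>2) / (M * (real N)\<^sup>2) \<partial>Q)"
    by (intro integral_mono le avg_sq_integrable integrable_divide Bochner_Integration.integrable_sum int)
  also have "\<dots> = (\<integral>\<omega>. (\<Sum>m=1..M. (path_sum m j \<omega>)\<^sup>2) \<partial>Q) / (M * (real N)\<^sup>2)"
    by simp
  also have "(\<integral>\<omega>. (\<Sum>m=1..M. (path_sum m j \<omega>)\<^sup>2) \<partial>Q) = (\<Sum>m=1..M. \<integral>\<omega>. (path_sum m j \<omega>)\<^sup>2 \<partial>Q)"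
    using int by (intro Bochner_Integration.integral_sum)
  finally show ?thesis .
qed

text \<open>Different machines use disjoint samples, and iterates started at 0 have mean 0, so the
  mixed products vanish. Compared with \<open>avg_sq_le\<close> this gains a factor
  \<open>M\<close>.\<close>

lemma avg_sq_eq_of_centred:
  assumes z1: "z1 = 0"
  shows "(\<integral>\<omega>. (inner (avg \<omega>) (v j))\<^sup>2 \<partial>Q) = (\<Sum>m=1..M. \<integral>\<omega>. (path_sum m j \<omega>)\<^sup>2 \<partial>Q) / (real (M * N))\<^sup>2"
proof -
  have cross: "(\<integral>\<omega>. path_sum m j \<omega> * path_sum m' j \<omega> \<partial>Q) = 0"
    if m: "m \<in> {1..M}" "m' \<in> {1..M}" "m \<noteq> m'" for m m'
    unfolding path_sum_product(2)[OF m(1,2)]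
  proof (intro sum.neutral ballI)
    fix i t assume it: "i \<in> {1..N}" "t \<in> {1..N}"
    then have it': "i \<in> {1..Suc N}" "t \<in> {1..Suc N}" by auto
    let ?f = "\<lambda>a b. inner a (v j) * inner b (v j)"
    have ind: "Q.independent (z m i) (z m' t)"
      using m it by (intro indep_machines) auto
    have f: "(\<lambda>(a, b). ?f a b) \<in> borel_measurable (borel :: ('h \<times> 'h) measure)"
      unfolding split_beta' by measurable
    have [measurable]: "z m' t \<in> borel_measurable Q" using m it' by (auto intro: z_measurable)
    have law: "integrable (distr Q borel (z m' t)) (\<lambda>b. inner b (v j))"
      "(\<integral>b. inner b (v j) \<partial>distr Q borel (z m' t)) = 0"
    proof -
      have "inner (mean z1 t) (v j) = 0" unfolding z1 mean_zero by simp
      then show "integrable (distr Q borel (z m' t)) (\<lambda>b. inner b (v j))"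
        "(\<integral>b. inner b (v j) \<partial>distr Q borel (z m' t)) = 0"
        using moments(3,4)[OF m(2) it'(2), of "v j"]
        by (simp_all add: integrable_distr_eq integral_distr)
    qed
    have fint: "integrable (distr Q borel (z m' t)) (?f a)" for a
      using law by simp
    let ?c = "\<integral>b. \<bar>inner b (v j)\<bar> \<partial>distr Q borel (z m' t)"
    have g: "integrable Q (\<lambda>\<omega>. \<bar>inner (z m i \<omega>) (v j)\<bar> * ?c)"
      using moments(4)[OF m(1) it'(1)] by simp
    have le: "(\<integral>b. \<bar>?f a b\<bar> \<partial>distr Q borel (z m' t)) \<le> \<bar>inner a (v j)\<bar> * ?c" for a
      by (simp add: abs_mult)
    show "(\<integral>\<omega>. inner (z m i \<omega>) (v j) * inner (z m' t \<omega>) (v j) \<partial>Q) = 0"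
      using Q.indep_Fubini(2)[OF ind f fint g le] by (simp add: law)
  qed
  have "(\<integral>\<omega>. (inner (avg \<omega>) (v j))\<^sup>2 \<partial>Q)
      = (\<integral>\<omega>. (\<Sum>m=1..M. \<Sum>m'=1..M. path_sum m j \<omega> * path_sum m' j \<omega>) \<partial>Q) / (real (M * N))\<^sup>2"
    unfolding avg_inner power_divide by (simp add: power2_eq_square sum_product)
  also have "(\<integral>\<omega>. (\<Sum>m=1..M. \<Sum>m'=1..M. path_sum m j \<omega> * path_sum m' j \<omega>) \<partial>Q)
      = (\<Sum>m=1..M. \<integral>\<omega>. (\<Sum>m'=1..M. path_sum m j \<omega> * path_sum m' j \<omega>) \<partial>Q)"
    by (intro Bochner_Integration.integral_sum Bochner_Integration.integrable_sum path_sum_product)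
  also have "\<dots> = (\<Sum>m=1..M. \<Sum>m'=1..M. \<integral>\<omega>. path_sum m j \<omega> * path_sum m' j \<omega> \<partial>Q)"
    by (intro sum.cong refl Bochner_Integration.integral_sum path_sum_product)
  also have "\<dots> = (\<Sum>m=1..M. \<Sum>m'=1..M. if m = m' then \<integral>\<omega>. (path_sum m j \<omega>)\<^sup>2 \<partial>Q else 0)"
    using cross by (intro sum.cong refl) (auto simp: power2_eq_square)
  also have "\<dots> = (\<Sum>m=1..M. \<integral>\<omega>. (path_sum m j \<omega>)\<^sup>2 \<partial>Q)"
    by (intro sum.cong refl) (simp add: sum.delta)
  finally show ?thesis .
qed

text \<open>The bound reproduces itself because r K (1 - r^t) + (1 - r) K = K (1 - r^(t+1)). It
  remains that r^2 \<le> r and, by \<open>K_step\<close>, that noise and fourth-order forcing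
  together are at most \<gamma> lam j K = (1 - r) K.\<close>

lemma q_le_of_centred:
  assumes z1: "z1 = 0" and m: "m \<in> {1..M}" and j: "j \<ge> 1"
  shows "t \<le> N \<Longrightarrow> q m (Suc t) j \<le> K * (1 - (1 - \<gamma> * lam j) ^ t)"
proof (induction t)
  case 0
  have "q m (Suc 0) j = 0" unfolding q_1 unfolding z1 by simp
  then show ?case by simp
next
  case (Suc t)
  let ?r = "1 - \<gamma> * lam j"
  let ?F = "\<integral>\<omega>. (inner (z m (Suc t) \<omega>) (X m (Suc t) \<omega>))\<^sup>2 * (inner (v j) (X m (Suc t) \<omega>))\<^sup>2 \<partial>Q"
  note r = power_sum_bounds(1,2)[OF j]
  have t: "Suc t \<in> {1..N}" using Suc by auto
  have "q m (Suc (Suc t)) j \<le> ?r\<^sup>2 * q m (Suc t) j + \<gamma>\<^sup>2 * ?F + \<gamma>\<^sup>2 * (s * lam j)"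
    by (rule q_Suc_le[OF m t j])
  also have "\<dots> \<le> ?r * (K * (1 - ?r ^ t)) + \<gamma>\<^sup>2 * (K * (\<tau> * T * lam j)) + \<gamma>\<^sup>2 * (s * lam j)"
  proof -
    have "?r\<^sup>2 * q m (Suc t) j \<le> ?r * q m (Suc t) j"
      using r q_nonneg by (intro mult_right_mono) (auto simp: power2_eq_square mult_left_le_one_le)
    also have "\<dots> \<le> ?r * (K * (1 - ?r ^ t))"
      using Suc r by (intro mult_left_mono) auto
    finally have "?r\<^sup>2 * q m (Suc t) j \<le> ?r * (K * (1 - ?r ^ t))" .
    moreover have "\<gamma>\<^sup>2 * ?F \<le> \<gamma>\<^sup>2 * (K * (\<tau> * T * lam j))"
      using sample_fourth(3)[OF m t, of "v j"] unfolding quad_v[OF j] by (rule mult_left_mono) simp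
    ultimately show ?thesis by linarith
  qed
  also have "\<dots> = ?r * (K * (1 - ?r ^ t)) + \<gamma> * lam j * (\<gamma> * s + \<gamma> * \<tau> * T * K)"
    by (simp add: power2_eq_square algebra_simps)
  also have "\<dots> \<le> ?r * (K * (1 - ?r ^ t)) + \<gamma> * lam j * K"
    using K_step gamma_pos lam_nonneg[OF j] by (intro add_left_mono mult_left_mono) auto
  also have "\<dots> = K * (1 - ?r ^ Suc t)"
    by (simp add: algebra_simps)
  finally show ?case .
qed

text \<open>Bounding every q_t by K (1 - r^N) yields a second factor 1 - r^N next to the one in
  \<open>path_sum_sq_le\<close>. This square is what makes the tail quadratic in
  \<open>lam j\<close>.\<close>

lemma variance_le:
  assumes z1: "z1 = 0"
  shows "integrable Q (\<lambda>\<omega>. quad (avg \<omega>))"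
    and "half_energy Q H avg \<le> s / (1 - \<gamma> * \<tau> * T) * V_term lam \<gamma> (M * N) M k"
proof -
  \<comment> \<open>The 2 comes from the double sum over times, K N from the N second moments, M /
    (M N)^2 from averaging uncorrelated machines, and 1 / \<gamma> from the factor on the left of
    \<open>path_sum_sq_le\<close>.\<close>
  let ?c = "2 * K / (\<gamma> * M * N)"
  let ?b = "\<lambda>j. (\<gamma> * lam j * N)\<^sup>2"
  let ?L = "\<Sum>\<^sub>\<infinity>j\<in>{k<..}. (lam j)\<^sup>2"
  have c: "0 \<le> ?c" using K_nonneg gamma_pos by simp
  have coord: "lam j * (\<integral>\<omega>. (inner (avg \<omega>) (v j))\<^sup>2 \<partial>Q) \<le> ?c * (if j \<le> k then 1 else ?b j)"
    if j: "j \<ge> 1" for j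
  proof -
    let ?r = "1 - \<gamma> * lam j"
    note r = power_sum_bounds[OF j]
    have rN: "0 \<le> 1 - ?r ^ N" "1 - ?r ^ N \<le> 1" using r(1,2) by (auto simp: power_le_one)
    have W: "\<gamma> * lam j * (\<integral>\<omega>. (path_sum m j \<omega>)\<^sup>2 \<partial>Q) \<le> 2 * K * N * (1 - ?r ^ N)\<^sup>2"
      if m: "m \<in> {1..M}" for m
    proof -
      have "(\<Sum>t=1..N. q m t j) \<le> (\<Sum>t=1..N. K * (1 - ?r ^ N))"
      proof (rule sum_mono)
        fix t assume t: "t \<in> {1..N}"
        have "q m t j \<le> K * (1 - ?r ^ (t - 1))"
          using q_le_of_centred[OF z1 m j, of "t - 1"] t by (cases t) auto
        also have "\<dots> \<le> K * (1 - ?r ^ N)"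
          using t r(1,2) K_nonneg by (intro mult_left_mono diff_left_mono power_decreasing) auto
        finally show "q m t j \<le> K * (1 - ?r ^ N)" .
      qed
      then have "2 * (1 - ?r ^ N) * (\<Sum>t=1..N. q m t j) \<le> 2 * (1 - ?r ^ N) * (N * (K * (1 - ?r ^ N)))"
        using rN by (intro mult_left_mono) auto
      with path_sum_sq_le[OF m j]
      have "\<gamma> * lam j * (\<integral>\<omega>. (path_sum m j \<omega>)\<^sup>2 \<partial>Q) \<le> 2 * (1 - ?r ^ N) * (N * (K * (1 - ?r ^ N)))"
        by (rule order_trans)
      then show ?thesis by (simp only: power2_eq_square mult_ac)
    qed
    have "lam j * (\<integral>\<omega>. (inner (avg \<omega>) (v j))\<^sup>2 \<partial>Q)
        = (\<Sum>m=1..M. \<gamma> * lam j * (\<integral>\<omega>. (path_sum m j \<omega>)\<^sup>2 \<partial>Q)) / (\<gamma> * (real (M * N))\<^sup>2)"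
      unfolding avg_sq_eq_of_centred[OF z1] using gamma_pos by (simp add: sum_distrib_left[symmetric])
    also have "\<dots> \<le> (\<Sum>m=1..M. 2 * K * N * (1 - ?r ^ N)\<^sup>2) / (\<gamma> * (real (M * N))\<^sup>2)"
      using W gamma_pos by (intro divide_right_mono sum_mono) auto
    also have "\<dots> = ?c * (1 - ?r ^ N)\<^sup>2"
      using gamma_pos M_pos N_pos by (simp add: power2_eq_square field_simps)
    also have "\<dots> \<le> ?c * (if j \<le> k then 1 else ?b j)"
    proof (intro mult_left_mono c)
      have "(1 - ?r ^ N)\<^sup>2 \<le> 1" using rN by (simp add: power_le_one)
      moreover have "(1 - ?r ^ N)\<^sup>2 \<le> ?b j"
      proof (rule power_mono[OF _ rN(1)])
        have "\<gamma> * lam j * (\<Sum>i<N. ?r ^ i) \<le> \<gamma> * lam j * N"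
          using r(4) gamma_pos lam_nonneg[OF j] by (intro mult_left_mono) auto
        then show "1 - ?r ^ N \<le> \<gamma> * lam j * N" unfolding r(3) .
      qed
      ultimately show "(1 - ?r ^ N)\<^sup>2 \<le> (if j \<le> k then 1 else ?b j)" by simp
    qed
    finally show ?thesis .
  qed
  have b: "?b = (\<lambda>j. (\<gamma> * N)\<^sup>2 * (lam j)\<^sup>2)" by (auto simp: power_mult_distrib mult_ac)
  have sm: "?b summable_on {k<..}"
    unfolding b by (intro summable_on_cmult_right summable_on_subset[OF lam_sq_summable]) auto
  have "(\<Sum>\<^sub>\<infinity>j\<in>{k<..}. ?b j) = (\<gamma> * N)\<^sup>2 * ?L"
    unfolding b by (rule infsum_cmult_right')
  then have R: "((\<lambda>j. ?c * (if j \<le> k then 1 else ?b j)) has_sum ?c * (k + (\<gamma> * N)\<^sup>2 * ?L)) {1..}"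
    using has_sum_cmult_right[OF has_sum_head_tail[OF sm, of "\<lambda>_. 1"], of ?c] by simp
  note E = quad_expectation[OF Q.prob_space_axioms avg_measurable avg_sq_integrable coord R]
  show "integrable Q (\<lambda>\<omega>. quad (avg \<omega>))" by (rule E(1))
  have "half_energy Q H avg \<le> K / (\<gamma> * M * N) * (k + (\<gamma> * N)\<^sup>2 * ?L)"
    unfolding half_energy_def using E(2) by (simp add: mult_ac)
  also have "\<dots> = K / \<gamma> * V_term lam \<gamma> (M * N) M k"
    unfolding V_term_def using M_pos N_pos gamma_pos by (simp add: field_simps power2_eq_square)
  \<comment> \<open>The 2 of \<open>?c\<close> has cancelled against the 1/2 in
    \<open>half_energy\<close>; for start 0 only the noise part of \<open>K\<close> remains.\<close>
  also have "K / \<gamma> = s / (1 - \<gamma> * \<tau> * T)"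
    unfolding K_def unfolding z1 using gamma_pos by simp
  finally show "half_energy Q H avg \<le> s / (1 - \<gamma> * \<tau> * T) * V_term lam \<gamma> (M * N) M k" .
qed

section \<open>The bias: telescoping norms and the total energy\<close>

lemma norm_sq_step:
  assumes e: "e = (\<lambda>_. 0)" and m: "m \<in> {1..M}" and t: "t \<in> {1..N}"
    and int: "integrable Q (\<lambda>\<omega>. (norm (z m t \<omega>))\<^sup>2)"
  shows "integrable Q (\<lambda>\<omega>. (norm (z m (Suc t) \<omega>))\<^sup>2)"
    and "(\<integral>\<omega>. (norm (z m (Suc t) \<omega>))\<^sup>2 \<partial>Q)
      \<le> (\<integral>\<omega>. (norm (z m t \<omega>))\<^sup>2 \<partial>Q) - \<gamma> * (2 - \<gamma> * \<tau> * T) * (\<integral>\<omega>. quad (z m t \<omega>) \<partial>Q)"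
proof -
  have t': "t \<in> {1..Suc N}" using t by auto
  let ?f = "\<lambda>a p. (norm (contract (snd a) p))\<^sup>2"
  let ?g = "\<lambda>a. (norm (snd a))\<^sup>2 - \<gamma> * (2 - \<gamma> * \<tau> * T) * quad (snd a)"
  have f: "(\<lambda>(a, p). ?f a p) \<in> borel_measurable (borel :: (('h \<times> 'h) \<times> 'h \<times> real) measure)"
    unfolding split_beta' by measurable
  have g: "integrable Q (\<lambda>\<omega>. ?g (z m t \<omega>, z m t \<omega>))"
    using int quad_z_integrable[OF m t'] by simp
  have le: "(\<integral>p. \<bar>?f a p\<bar> \<partial>D) \<le> ?g a" for a :: "'h \<times> 'h"
    using contract_le by simp
  note F = given_past[OF m t order_refl f contract_integrable g le]
  have eq: "z m (Suc t) \<omega> = contract (z m t \<omega>) (d (m, t) \<omega>)" for \<omega>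
    using t by (simp add: z_Suc) (simp add: e)
  show "integrable Q (\<lambda>\<omega>. (norm (z m (Suc t) \<omega>))\<^sup>2)"
    unfolding eq using F(1) by simp
  have "(\<integral>\<omega>. (norm (z m (Suc t) \<omega>))\<^sup>2 \<partial>Q) = (\<integral>\<omega>. (\<integral>p. ?f (z m t \<omega>, z m t \<omega>) p \<partial>D) \<partial>Q)"
    unfolding eq using F(2) by simp
  also have "\<dots> \<le> (\<integral>\<omega>. ?g (z m t \<omega>, z m t \<omega>) \<partial>Q)"
  proof (rule integral_mono'[OF g])
    show "(\<integral>p. ?f (z m t \<omega>, z m t \<omega>) p \<partial>D) \<le> ?g (z m t \<omega>, z m t \<omega>)" for \<omega>
      using contract_le by simp
    show "0 \<le> ?g (z m t \<omega>, z m t \<omega>)" for \<omega>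
    proof -
      have "0 \<le> (\<integral>p. (norm (contract (z m t \<omega>) p))\<^sup>2 \<partial>D)" by simp
      then show ?thesis using contract_le[of "z m t \<omega>"] unfolding snd_conv by linarith
    qed
  qed
  also have "\<dots> = (\<integral>\<omega>. (norm (z m t \<omega>))\<^sup>2 \<partial>Q) - \<gamma> * (2 - \<gamma> * \<tau> * T) * (\<integral>\<omega>. quad (z m t \<omega>) \<partial>Q)"
    using int quad_z_integrable[OF m t'] by simp
  finally show "(\<integral>\<omega>. (norm (z m (Suc t) \<omega>))\<^sup>2 \<partial>Q)
      \<le> (\<integral>\<omega>. (norm (z m t \<omega>))\<^sup>2 \<partial>Q) - \<gamma> * (2 - \<gamma> * \<tau> * T) * (\<integral>\<omega>. quad (z m t \<omega>) \<partial>Q)" .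
qed

text \<open>Jensen's inequality \<open>\<parallel>E z\<parallel>\<^sup>2 \<le> E \<parallel>z\<parallel>\<^sup>2\<close> at the final time turns the
  telescoping sum into the head-tail bound for the noiseless iteration.\<close>

lemma total_quad_le:
  assumes e: "e = (\<lambda>_. 0)" and m: "m \<in> {1..M}"
  shows "\<gamma> * (2 - \<gamma> * \<tau> * T) * (\<Sum>t=1..N. \<integral>\<omega>. quad (z m t \<omega>) \<partial>Q)
    \<le> 2 * (normsq_id_head v k z1 + \<gamma> * N * normsq_tail lam v k z1)"
proof -
  let ?a = "\<gamma> * (2 - \<gamma> * \<tau> * T)"
  have "t \<le> N \<Longrightarrow> integrable Q (\<lambda>\<omega>. (norm (z m (Suc t) \<omega>))\<^sup>2) \<and>
      ?a * (\<Sum>t=1..t. \<integral>\<omega>. quad (z m t \<omega>) \<partial>Q) \<le> (norm z1)\<^sup>2 - (\<integral>\<omega>. (norm (z m (Suc t) \<omega>))\<^sup>2 \<partial>Q)" for t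
  proof (induction t)
    case 0
    then show ?case by (simp add: Q.prob_space)
  next
    case (Suc t)
    then have t: "Suc t \<in> {1..N}" and int: "integrable Q (\<lambda>\<omega>. (norm (z m (Suc t) \<omega>))\<^sup>2)" by auto
    show ?case
      using norm_sq_step[OF e m t int] Suc by (simp add: distrib_left)
  qed
  from this[of N] have int: "integrable Q (\<lambda>\<omega>. (norm (z m (Suc N) \<omega>))\<^sup>2)"
    and le: "?a * (\<Sum>t=1..N. \<integral>\<omega>. quad (z m t \<omega>) \<partial>Q) \<le> (norm z1)\<^sup>2 - (\<integral>\<omega>. (norm (z m (Suc N) \<omega>))\<^sup>2 \<partial>Q)"
    by auto
  have N': "Suc N \<in> {1..Suc N}" by simp
  let ?\<mu> = "mean z1 (Suc N)"
  \<comment> \<open>Jensen by scalar means only: 2 <z,\<mu>> \<le> |z|^2 + |\<mu>|^2 is integrated,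
    and the mean formula in the direction \<open>?\<mu>\<close> itself evaluates the left
    side.\<close>
  have "2 * (norm ?\<mu>)\<^sup>2 = (\<integral>\<omega>. 2 * inner (z m (Suc N) \<omega>) ?\<mu> \<partial>Q)"
    using moments(3)[OF m N', of ?\<mu>] by (simp add: power2_norm_eq_inner)
  also have "\<dots> \<le> (\<integral>\<omega>. (norm (z m (Suc N) \<omega>))\<^sup>2 + (norm ?\<mu>)\<^sup>2 \<partial>Q)"
  proof (intro integral_mono)
    fix \<omega>
    have "0 \<le> (norm (z m (Suc N) \<omega> - ?\<mu>))\<^sup>2" by simp
    then show "2 * inner (z m (Suc N) \<omega>) ?\<mu> \<le> (norm (z m (Suc N) \<omega>))\<^sup>2 + (norm ?\<mu>)\<^sup>2"
      unfolding power2_norm_eq_inner inner_diff_left inner_diff_right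
      using inner_commute[of ?\<mu> "z m (Suc N) \<omega>"] by linarith
  qed (use int moments(4)[OF m N'] in auto)
  also have "\<dots> = (\<integral>\<omega>. (norm (z m (Suc N) \<omega>))\<^sup>2 \<partial>Q) + (norm ?\<mu>)\<^sup>2"
    using int by (simp add: Q.prob_space)
  finally show ?thesis using le mean_norm_decrease[of z1 N k] by linarith
qed

text \<open>Each coordinate carries its initial error plus the total forcing, multiplied by (1 -
  r^N) G with G the geometric sum. This product is at most 1 / (\<gamma> lam j), which gives the
  inverse weights of the head, and at most \<gamma> lam j N^2, which gives the tail.\<close>

lemma bias_le:
  assumes e: "e = (\<lambda>_. 0)" and s: "s = 0"
  shows "integrable Q (\<lambda>\<omega>. quad (avg \<omega>))"
    and "half_energy Q H avg \<le> 1 / (\<gamma> * N)\<^sup>2 * normsq_pinv_head lam v k z1 + normsq_tail lam v k z1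
      + 2 * \<tau> * (normsq_id_head v k z1 + \<gamma> * N * normsq_tail lam v k z1)
          / (\<gamma> * N * (1 - \<gamma> * \<tau> * T)) * (M * V_term lam \<gamma> (M * N) M k)"
proof -
  define B where "B = normsq_id_head v k z1 + \<gamma> * N * normsq_tail lam v k z1"
  \<comment> \<open>A bound for the energies summed over time. \<open>total_quad_le\<close> supplies
    the factor 2 - \<gamma> \<tau> T, which is weakened to the 1 - \<gamma> \<tau> T of the
    claim.\<close>
  define h where "h = 2 * B / (\<gamma> * (1 - \<gamma> * \<tau> * T))"
  let ?b = "\<lambda>j. (inner z1 (v j))\<^sup>2"
  let ?L = "\<Sum>\<^sub>\<infinity>j\<in>{k<..}. (lam j)\<^sup>2"
  have a: "0 < 1 - \<gamma> * \<tau> * T" using gamma_less by (simp add: mult.assoc)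
  have h: "(\<Sum>t=1..N. \<integral>\<omega>. quad (z m t \<omega>) \<partial>Q) \<le> h" if m: "m \<in> {1..M}" for m
  proof -
    have 0: "0 \<le> (\<Sum>t=1..N. \<integral>\<omega>. quad (z m t \<omega>) \<partial>Q)"
      using H_nonneg by (intro sum_nonneg) simp
    have "\<gamma> * (1 - \<gamma> * \<tau> * T) * (\<Sum>t=1..N. \<integral>\<omega>. quad (z m t \<omega>) \<partial>Q)
        \<le> \<gamma> * (2 - \<gamma> * \<tau> * T) * (\<Sum>t=1..N. \<integral>\<omega>. quad (z m t \<omega>) \<partial>Q)"
      using 0 gamma_pos by (intro mult_right_mono mult_left_mono) auto
    also have "\<dots> \<le> 2 * B" unfolding B_def by (rule total_quad_le[OF e m])
    finally show ?thesis
      unfolding h_def using gamma_pos a by (simp add: pos_le_divide_eq mult_ac)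
  qed
  have h0: "0 \<le> h"
    using h[of 1] M_pos H_nonneg by (intro order_trans[OF _ h[of 1]] sum_nonneg) auto
  define R where "R j = 2 * (if j \<le> k then 1 / (\<gamma> * N)\<^sup>2 * (?b j / lam j) + \<tau> * h / (real N)\<^sup>2
      else lam j * ?b j + \<tau> * \<gamma>\<^sup>2 * h * (lam j)\<^sup>2)" for j
  have coord: "lam j * (\<integral>\<omega>. (inner (avg \<omega>) (v j))\<^sup>2 \<partial>Q) \<le> R j" if j: "j \<ge> 1" for j
  \<comment> \<open>The head divides by \<open>lam j\<close>. For a zero eigenvalue that quotient is
    0 by convention, so \<open>R j\<close> is nonnegative while the left side is 0.\<close>
  proof (cases "lam j = 0")
    case True
    then show ?thesis using tau_pos h0 by (simp add: R_def)
  next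
    case False
    then have lam: "0 < lam j" using lam_nonneg[OF j] by simp
    let ?r = "1 - \<gamma> * lam j"
    let ?G = "\<Sum>i<N. ?r ^ i"
    note r = power_sum_bounds[OF j]
    have rN: "0 \<le> 1 - ?r ^ N" "1 - ?r ^ N \<le> 1" using r(1,2) by (auto simp: power_le_one)
    \<comment> \<open>Initial value plus total forcing: the rank-one case bounds the forcing at time
      t by \<gamma>^2 \<tau> lam j times the energy, and \<open>h\<close> bounds the energies summed
      over time.\<close>
    let ?y = "?b j + \<gamma>\<^sup>2 * (\<tau> * lam j * h)"
    have y: "0 \<le> ?y" using lam tau_pos h0 by simp
    have W: "\<gamma> * lam j * (\<integral>\<omega>. (path_sum m j \<omega>)\<^sup>2 \<partial>Q) \<le> 2 * (1 - ?r ^ N) * (?G * ?y)"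
      if m: "m \<in> {1..M}" for m
    proof -
      let ?c = "\<lambda>t. \<gamma>\<^sup>2 * (\<tau> * lam j * (\<integral>\<omega>. quad (z m t \<omega>) \<partial>Q))"
      have "(\<Sum>t=1..N. q m t j) \<le> ?G * (q m 1 j + (\<Sum>t=1..N. ?c t))"
      proof (rule sum_of_contracting_le[OF r(1,2)])
        show "0 \<le> q m t j" for t by (rule q_nonneg)
        show "0 \<le> ?c t" for t using tau_pos lam H_nonneg by simp
        fix t assume "1 \<le> t" "t < N"
        then have t: "t \<in> {1..N}" by simp
        have "\<gamma>\<^sup>2 * (\<integral>\<omega>. (inner (z m t \<omega>) (X m t \<omega>))\<^sup>2 * (inner (v j) (X m t \<omega>))\<^sup>2 \<partial>Q) \<le> ?c t"
          using sample_fourth(2)[OF m t, of "v j"] unfolding quad_v[OF j] by (rule mult_left_mono) simp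
        then show "q m (Suc t) j \<le> ?r\<^sup>2 * q m t j + ?c t"
          using q_Suc_le[OF m t j] by (simp add: s)
      qed
      also have "\<dots> \<le> ?G * ?y"
        unfolding sum_distrib_left[symmetric] using h[OF m] r(5) lam tau_pos
        by (intro mult_left_mono add_mono) (auto simp: q_1)
      finally show ?thesis
        using path_sum_sq_le[OF m j] rN(1) mult_left_mono[of _ _ "2 * (1 - ?r ^ N)"]
        by (meson order_trans mult_nonneg_nonneg zero_le_numeral)
    qed
    have "lam j * (\<integral>\<omega>. (inner (avg \<omega>) (v j))\<^sup>2 \<partial>Q)
        \<le> lam j * ((\<Sum>m=1..M. \<integral>\<omega>. (path_sum m j \<omega>)\<^sup>2 \<partial>Q) / (M * (real N)\<^sup>2))"
      using lam by (intro mult_left_mono avg_sq_le) auto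
    also have "\<dots> = (\<Sum>m=1..M. \<gamma> * lam j * (\<integral>\<omega>. (path_sum m j \<omega>)\<^sup>2 \<partial>Q)) / (\<gamma> * M * (real N)\<^sup>2)"
      using gamma_pos by (simp add: sum_distrib_left[symmetric])
    also have "\<dots> \<le> (\<Sum>m=1..M. 2 * (1 - ?r ^ N) * (?G * ?y)) / (\<gamma> * M * (real N)\<^sup>2)"
      using W gamma_pos by (intro divide_right_mono sum_mono) auto
    also have "\<dots> = 2 * ((1 - ?r ^ N) * ?G * ?y / (\<gamma> * (real N)\<^sup>2))"
      using M_pos by simp
    also have "\<dots> \<le> R j"
    proof (cases "j \<le> k")
      case True
      have "(1 - ?r ^ N) * ?G \<le> 1 * (1 / (\<gamma> * lam j))"
        using r(3,5) rN gamma_pos lam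
        by (intro mult_mono) (auto simp: pos_le_divide_eq mult_ac)
      then have "(1 - ?r ^ N) * ?G * ?y / (\<gamma> * (real N)\<^sup>2) \<le> 1 / (\<gamma> * lam j) * ?y / (\<gamma> * (real N)\<^sup>2)"
        using y gamma_pos by (intro divide_right_mono mult_right_mono) auto
      also have "\<dots> = 1 / (\<gamma> * N)\<^sup>2 * (?b j / lam j) + \<tau> * h / (real N)\<^sup>2"
        using gamma_pos lam N_pos by (simp add: field_simps power2_eq_square)
      finally show ?thesis using True by (simp add: R_def)
    next
      case False
      have "(1 - ?r ^ N) * ?G \<le> \<gamma> * lam j * N * N"
        unfolding r(3)[symmetric] using r(4,5) gamma_pos lam
        by (intro mult_mono mult_left_mono) auto
      then have "(1 - ?r ^ N) * ?G * ?y / (\<gamma> * (real N)\<^sup>2) \<le> \<gamma> * lam j * N * N * ?y / (\<gamma> * (real N)\<^sup>2)"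
        using y gamma_pos by (intro divide_right_mono mult_right_mono) auto
      also have "\<dots> = lam j * ?b j + \<tau> * \<gamma>\<^sup>2 * h * (lam j)\<^sup>2"
        using gamma_pos N_pos by (simp add: field_simps power2_eq_square)
      finally show ?thesis using False by (simp add: R_def)
    qed
    finally show ?thesis .
  qed
  have sum1: "(\<lambda>j. lam j * ?b j) summable_on {k<..}"
    by (intro summable_on_subset[OF quad_summable]) auto
  have sum2: "(\<lambda>j. \<tau> * \<gamma>\<^sup>2 * h * (lam j)\<^sup>2) summable_on {k<..}"
    by (intro summable_on_cmult_right summable_on_subset[OF lam_sq_summable]) auto
  have head: "(\<Sum>j=1..k. 1 / (\<gamma> * N)\<^sup>2 * (?b j / lam j) + \<tau> * h / (real N)\<^sup>2)
      = 1 / (\<gamma> * N)\<^sup>2 * normsq_pinv_head lam v k z1 + k * (\<tau> * h / (real N)\<^sup>2)"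
    unfolding normsq_pinv_head_def sum.distrib sum_distrib_left by simp
  have tail: "(\<Sum>\<^sub>\<infinity>j\<in>{k<..}. lam j * ?b j + \<tau> * \<gamma>\<^sup>2 * h * (lam j)\<^sup>2)
      = normsq_tail lam v k z1 + \<tau> * \<gamma>\<^sup>2 * h * ?L"
    unfolding infsum_add[OF sum1 sum2] normsq_tail_def infsum_cmult_right' ..
  define S where "S = 1 / (\<gamma> * N)\<^sup>2 * normsq_pinv_head lam v k z1 + k * (\<tau> * h / (real N)\<^sup>2)
    + (normsq_tail lam v k z1 + \<tau> * \<gamma>\<^sup>2 * h * ?L)"
  have R: "(R has_sum 2 * S) {1..}"
    unfolding R_def S_def head[symmetric] tail[symmetric]
    by (intro has_sum_cmult_right has_sum_head_tail summable_on_add sum1 sum2)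
  note E = quad_expectation[OF Q.prob_space_axioms avg_measurable avg_sq_integrable coord R]
  show "integrable Q (\<lambda>\<omega>. quad (avg \<omega>))" by (rule E(1))
  have "half_energy Q H avg \<le> 1 / (\<gamma> * N)\<^sup>2 * normsq_pinv_head lam v k z1 + normsq_tail lam v k z1
      + (k * (\<tau> * h / (real N)\<^sup>2) + \<tau> * \<gamma>\<^sup>2 * h * ?L)"
  proof -
    have "half_energy Q H avg \<le> S" unfolding half_energy_def using E(2) by simp
    then show ?thesis unfolding S_def by linarith
  qed
  \<comment> \<open>With n = M N, \<open>M\<close> times \<open>V_term\<close> is k / N plus
    \<gamma>^2 N times the tail sum. The extra \<open>M\<close> is the price of convexity in place
    of decorrelation.\<close>
  also have "k * (\<tau> * h / (real N)\<^sup>2) + \<tau> * \<gamma>\<^sup>2 * h * ?L = \<tau> * h / N * (M * V_term lam \<gamma> (M * N) M k)"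
    unfolding V_term_def using M_pos N_pos by (simp add: field_simps power2_eq_square)
  also have "\<tau> * h / N = 2 * \<tau> * B / (\<gamma> * N * (1 - \<gamma> * \<tau> * T))"
    by (simp add: h_def mult_ac)
  finally show "half_energy Q H avg \<le> 1 / (\<gamma> * N)\<^sup>2 * normsq_pinv_head lam v k z1 + normsq_tail lam v k z1
      + 2 * \<tau> * (normsq_id_head v k z1 + \<gamma> * N * normsq_tail lam v k z1)
          / (\<gamma> * N * (1 - \<gamma> * \<tau> * T)) * (M * V_term lam \<gamma> (M * N) M k)"
    unfolding B_def .
qed

end

end

section \<open>The regression model\<close>

lemma moment_quad:
  fixes x :: "'a \<Rightarrow> 'h::{real_inner,banach,second_countable_topology}"
  assumes "moment_op_exists P x g"
  shows "integrable P (\<lambda>\<omega>. g \<omega> * inner w (x \<omega>) * inner u (x \<omega>))"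
    and "(\<integral>\<omega>. g \<omega> * inner w (x \<omega>) * inner u (x \<omega>) \<partial>P) = inner u (moment_op P x g w)"
proof -
  have int: "integrable P (\<lambda>\<omega>. (g \<omega> * inner w (x \<omega>)) *\<^sub>R x \<omega>)"
    using assms unfolding moment_op_exists_def by blast
  have eq: "inner u ((g \<omega> * inner w (x \<omega>)) *\<^sub>R x \<omega>) = g \<omega> * inner w (x \<omega>) * inner u (x \<omega>)" for \<omega>
    by simp
  show "integrable P (\<lambda>\<omega>. g \<omega> * inner w (x \<omega>) * inner u (x \<omega>))"
    using integrable_inner_right[of u, OF int] unfolding eq .
  show "(\<integral>\<omega>. g \<omega> * inner w (x \<omega>) * inner u (x \<omega>) \<partial>P) = inner u (moment_op P x g w)"
    unfolding moment_op_def using integral_inner_right[of u, OF int] unfolding eq by simp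
qed

text \<open>Boundedness comes from the quadratic form: positivity at u - w gives 2 <u,Hw> \<le>
  <u,Hu> + <w,Hw>, and testing along H w turns this into a norm bound.\<close>

lemma moment_op_bounded_linear:
  fixes x :: "'a \<Rightarrow> 'h::{real_inner,banach,second_countable_topology}"
  assumes ex: "moment_op_exists P x (\<lambda>_. 1)"
    and le: "\<And>u. inner u (moment_op P x (\<lambda>_. 1) u) \<le> C * (norm u)\<^sup>2"
  shows "bounded_linear (moment_op P x (\<lambda>_. 1))"
proof -
  let ?H = "moment_op P x (\<lambda>_. 1)"
  note q = moment_quad[OF ex]
  have int: "integrable P (\<lambda>\<omega>. (1 * inner w (x \<omega>)) *\<^sub>R x \<omega>)" for w
    using ex unfolding moment_op_exists_def by blast
  have add: "?H (a + b) = ?H a + ?H b" for a b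
    unfolding moment_op_def using int by (simp add: inner_add_left scaleR_add_left)
  have scale: "?H (c *\<^sub>R a) = c *\<^sub>R ?H a" for c a
    unfolding moment_op_def by (simp flip: scaleR_scaleR)
  have sq: "inner u (?H u) = (\<integral>\<omega>. (inner u (x \<omega>))\<^sup>2 \<partial>P)" for u
    using q(2)[of u u] by (simp add: power2_eq_square)
  have cs: "2 * inner u (?H w) \<le> C * (norm u)\<^sup>2 + C * (norm w)\<^sup>2" for u w
  proof -
    have "0 \<le> inner (u - w) (?H (u - w))" unfolding sq by simp
    moreover have "?H (u - w) = ?H u - ?H w"
      using add[of u "(-1) *\<^sub>R w"] scale[of "-1" w] by simp
    moreover have "inner w (?H u) = inner u (?H w)"
      using q(2)[of u w] q(2)[of w u] by (simp add: mult.commute)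
    ultimately have "2 * inner u (?H w) \<le> inner u (?H u) + inner w (?H w)"
      by (simp add: inner_diff_left inner_diff_right)
    then show ?thesis using le[of u] le[of w] by linarith
  qed
  have "norm (?H w) \<le> norm w * C" for w
  proof (cases "?H w = 0 \<or> w = 0")
    case True
    have "?H 0 = 0" using scale[of 0 0] by simp
    moreover have "0 \<le> C * (norm w)\<^sup>2" using order_trans[OF _ le[of w]] unfolding sq by simp
    then have "0 \<le> norm w * C" by (cases "w = 0") (auto simp: zero_le_mult_iff)
    ultimately show ?thesis using True by auto
  next
    case False
    let ?n = "norm (?H w)"
    have n: "0 < ?n" "0 < norm w" using False by auto
    \<comment> \<open>The direction of \<open>?H w\<close> with the length of \<open>w\<close>,
      which balances the two terms on the right of \<open>cs\<close>.\<close>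
    define u where "u = (norm w / ?n) *\<^sub>R ?H w"
    have nu: "norm u = norm w" using n by (simp add: u_def)
    have "inner u (?H w) = norm w * ?n"
      using n by (simp add: u_def power2_norm_eq_inner[symmetric] power2_eq_square)
    then have "norm w * ?n \<le> C * (norm w)\<^sup>2" using cs[of u w] unfolding nu by linarith
    then show ?thesis using n by (simp add: power2_eq_square mult_ac)
  qed
  then show ?thesis by (rule bounded_linear_intro[OF add scale])
qed

lemma loewner_le_quad: "loewner_le A B \<Longrightarrow> inner u (A u) \<le> inner u (B u)"
  unfolding loewner_le_def psd_def by (simp add: inner_diff_right)

text \<open>For fixed \<open>u\<close> with <u,Hu> > 0, the quotient <u,Su> / <u,Hu> is a lower
  bound of all admissible constants, hence of their infimum. If <u,Hu> = 0, any admissible constant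
  already gives <u,Su> \<le> 0.\<close>

lemma whitened_norm_le:
  assumes "whitened_bounded H S" "0 \<le> inner u (H u)"
  shows "0 \<le> whitened_norm H S" "inner u (S u) \<le> whitened_norm H S * inner u (H u)"
proof -
  let ?A = "{s. 0 \<le> s \<and> loewner_le S (\<lambda>w. s *\<^sub>R H w)}"
  have ne: "?A \<noteq> {}" using assms(1) unfolding whitened_bounded_def by blast
  have le: "inner u (S u) \<le> s * inner u (H u)" if "s \<in> ?A" for s
    using loewner_le_quad[of S "\<lambda>w. s *\<^sub>R H w" u] that by simp
  show "0 \<le> whitened_norm H S"
    unfolding whitened_norm_def using ne by (intro cInf_greatest) auto
  show "inner u (S u) \<le> whitened_norm H S * inner u (H u)"
  proof (cases "inner u (H u) = 0")
    case True
    then show ?thesis using ne le by fastforce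
  next
    case False
    then have pos: "0 < inner u (H u)" using assms(2) by simp
    then have "inner u (S u) / inner u (H u) \<le> whitened_norm H S"
      unfolding whitened_norm_def using ne le
      by (intro cInf_greatest) (auto simp: pos_divide_le_eq)
    then show ?thesis using pos by (simp add: pos_divide_le_eq)
  qed
qed

text \<open>The first-order condition at a minimum: up to sign and scale, \<open>a\<close> is the
  slope and \<open>b\<close> the curvature of the risk on a line through the minimiser.\<close>

lemma zero_of_quadratic_nonneg:
  fixes a b :: real
  assumes "\<And>s. 0 \<le> s\<^sup>2 * b - 2 * s * a"
  shows "a = 0"
proof (rule ccontr)
  assume "a \<noteq> 0"
  have "b \<ge> 0" using assms[of 1] assms[of "-1"] by simp
  \<comment> \<open>The minimising parameter would be a / b; adding 1 keeps the denominator positive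
    when b = 0.\<close>
  define s where "s = a / (b + 1)"
  have a: "a = s * (b + 1)" using \<open>b \<ge> 0\<close> by (simp add: s_def)
  have "0 \<le> s\<^sup>2 * b - 2 * s * a" by (rule assms)
  also have "\<dots> = - (s\<^sup>2 * (b + 2))" by (simp add: a power2_eq_square algebra_simps)
  also have "\<dots> < 0" using \<open>a \<noteq> 0\<close> \<open>b \<ge> 0\<close> a by simp
  finally show False by simp
qed

lemma bias_iter_eq_proc:
  "bias_iter \<gamma> z1 (\<lambda>t. fst (d t)) = proc \<gamma> z1 (\<lambda>_. 0) d"
proof
  show "bias_iter \<gamma> z1 (\<lambda>t. fst (d t)) t = proc \<gamma> z1 (\<lambda>_. 0) d t" for t
    by (induction t) auto
qed

lemma var_iter_eq_proc:
  "var_iter \<gamma> (\<lambda>t. fst (d t)) (\<lambda>t. e (d t)) = proc \<gamma> 0 e d"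
proof
  show "var_iter \<gamma> (\<lambda>t. fst (d t)) (\<lambda>t. e (d t)) t = proc \<gamma> 0 e d t" for t
    by (induction t) (auto simp: algebra_simps)
qed

text \<open>The recursion is affine, so the error relative to a reference point splits into a part
  carrying the initial error and a part driven by the residuals at that point.\<close>

lemma sgd_iter_eq:
  "sgd_iter \<gamma> w1 x y t
    = w + bias_iter \<gamma> (w1 - w) x t + var_iter \<gamma> x (\<lambda>t. y t - inner (x t) w) t"
proof (induction t)
  case (Suc t)
  then show ?case
    by (simp add: inner_add_left inner_commute[of "x t" w] algebra_simps)
qed simp

lemma dist_avg_add: "dist_avg n M (\<lambda>m t. u m t + w m t) = dist_avg n M u + dist_avg n M w"
  by (simp add: dist_avg_def sum.distrib scaleR_add_right)

lemma dist_avg_const: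
  assumes "M \<ge> 1" "n \<ge> 1" "M dvd n"
  shows "dist_avg n M (\<lambda>_ _. w) = w"
proof -
  obtain N where "n = M * N" using assms by blast
  then show ?thesis
    using assms by (simp add: dist_avg_def sum_constant_scaleR del: sum_constant)
qed

theorem theorem3p5:
  fixes P :: "'a measure" and Q :: "'b measure"
    and x :: "'a \<Rightarrow> 'h::{real_inner,banach,second_countable_topology}" and y :: "'a \<Rightarrow> real"
    and X :: "nat \<Rightarrow> nat \<Rightarrow> 'b \<Rightarrow> 'h" and Y :: "nat \<Rightarrow> nat \<Rightarrow> 'b \<Rightarrow> real"
    and n M :: nat and \<gamma> \<tau> \<sigma>2 :: real
    and wstar w1 :: 'h and H \<Sigma> :: "'h \<Rightarrow> 'h" and fourth :: "('h \<Rightarrow> 'h) \<Rightarrow> 'h \<Rightarrow> 'h"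
    and lam :: "nat \<Rightarrow> real" and v :: "nat \<Rightarrow> 'h"
  assumes P: "prob_space P" and Q: "prob_space Q"
    and x_meas: "x \<in> borel_measurable P" and y_meas: "y \<in> borel_measurable P"
    and risk_finite: "\<forall>w. integrable P (\<lambda>\<omega>. (y \<omega> - inner w (x \<omega>))\<^sup>2)"
    and wstar: "min_norm_minimizer (risk P x y) wstar"
    and H_exists: "moment_op_exists P x (\<lambda>_. 1)"
    and H_def: "H = moment_op P x (\<lambda>_. 1)"
    and fourth_exists:
      "\<forall>A. bounded_linear A \<longrightarrow> moment_op_exists P x (\<lambda>\<omega>. inner (x \<omega>) (A (x \<omega>)))"
    and fourth_def: "fourth = (\<lambda>A. moment_op P x (\<lambda>\<omega>. inner (x \<omega>) (A (x \<omega>))))"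
    and Sigma_exists: "moment_op_exists P x (\<lambda>\<omega>. (inner wstar (x \<omega>) - y \<omega>)\<^sup>2)"
    and Sigma_def: "\<Sigma> = moment_op P x (\<lambda>\<omega>. (inner wstar (x \<omega>) - y \<omega>)\<^sup>2)"
    and eig: "eigendecomposition H lam v"
    and M_pos: "M \<ge> 1" and n_pos: "n \<ge> 1" and M_dvd: "M dvd n"
    and data_indep: "prob_space.indep_vars Q (\<lambda>_. borel)
      (\<lambda>(m, t) \<omega>. (X m t \<omega>, Y m t \<omega>)) ({1..M} \<times> {1..n div M})"
    and data_distr: "\<forall>m\<in>{1..M}. \<forall>t\<in>{1..n div M}.
      distr Q borel (\<lambda>\<omega>. (X m t \<omega>, Y m t \<omega>)) = distr P borel (\<lambda>\<omega>. (x \<omega>, y \<omega>))"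
    and cond_y: "AE \<omega> in P. nn_cond_exp P (vimage_algebra (space P) x borel)
      (\<lambda>\<omega>. ennreal ((y \<omega>)\<^sup>2)) \<omega> < \<infinity>"
    and trace_H: "\<exists>t. has_trace H t"
    and tau_pos: "\<tau> > 0"
    and fourth_le: "\<forall>A. psd A \<longrightarrow>
      loewner_le (fourth A) (\<lambda>w. (\<tau> * op_trace (\<lambda>u. H (A u))) *\<^sub>R H w)"
    and sigma_finite: "whitened_bounded H \<Sigma>"
    and sigma2_def: "\<sigma>2 = whitened_norm H \<Sigma>"
    and gamma_pos: "0 < \<gamma>" and gamma_less: "\<gamma> * (\<tau> * op_trace H) < 1"
    and w1: "w1 = 0"
  shows
    "let
       wbar = (\<lambda>\<omega>. dist_avg n M (\<lambda>m. sgd_iter \<gamma> w1 (\<lambda>t. X m t \<omega>) (\<lambda>t. Y m t \<omega>)));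
       bbar = (\<lambda>\<omega>. dist_avg n M (\<lambda>m. bias_iter \<gamma> (w1 - wstar) (\<lambda>t. X m t \<omega>)));
       vbar = (\<lambda>\<omega>. dist_avg n M (\<lambda>m. var_iter \<gamma> (\<lambda>t. X m t \<omega>)
                 (\<lambda>t. Y m t \<omega> - inner (X m t \<omega>) wstar)));
       Bias = half_energy Q H bbar;
       Var = half_energy Q H vbar;
       k = cutoff_index lam (real M / (\<gamma> * real n))
     in
       integrable Q (\<lambda>\<omega>. risk P x y (wbar \<omega>)) \<and>
       integrable Q (\<lambda>\<omega>. inner (bbar \<omega>) (H (bbar \<omega>))) \<and>
       integrable Q (\<lambda>\<omega>. inner (vbar \<omega>) (H (vbar \<omega>))) \<and>
       (\<integral>\<omega>. risk P x y (wbar \<omega>) \<partial>Q) - risk P x y wstar \<le> 2 * Bias + 2 * Var \<and>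
       Bias \<le> (real M)\<^sup>2 / (\<gamma>\<^sup>2 * (real n)\<^sup>2) * normsq_pinv_head lam v k wstar
               + normsq_tail lam v k wstar
               + 2 * \<tau> * (real M)\<^sup>2
                   * (normsq_id_head v k wstar
                        + \<gamma> * (real n / real M) * normsq_tail lam v k wstar)
                   / (\<gamma> * real n * (1 - \<gamma> * \<tau> * op_trace H))
                 * V_term lam \<gamma> n M k \<and>
       Var \<le> \<sigma>2 / (1 - \<gamma> * \<tau> * op_trace H) * V_term lam \<gamma> n M k"
proof -
  interpret P: prob_space P by (rule P)
  interpret Q: prob_space Q by (rule Q)
  obtain T where T: "has_trace H T" using trace_H by blast
  have op_T: "op_trace H = T" by (rule has_trace_op_trace[OF T])
  note xm[measurable] = x_meas and ym[measurable] = y_meas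
  note H_quad = moment_quad[OF H_exists, folded H_def, simplified]
  have sq_int: "integrable P (\<lambda>\<omega>. (inner u (x \<omega>))\<^sup>2)" for u
    using H_quad(1)[of u u] by (simp add: power2_eq_square)
  have sq_eq: "(\<integral>\<omega>. (inner u (x \<omega>))\<^sup>2 \<partial>P) = inner u (H u)" for u
    using H_quad(2)[of u u] by (simp add: power2_eq_square)
  have H_nonneg: "0 \<le> inner u (H u)" for u unfolding sq_eq[symmetric] by simp
  \<comment> \<open>\<open>spectral\<close> works from a nonnegative form with a trace, so
    \<open>quad_le\<close> is at hand before \<open>H\<close> is known to be bounded, and then
    proves it.\<close>
  interpret S: spectral H lam v T
    by unfold_locales (rule eig H_nonneg T)+
  have H_bl: "bounded_linear H"
    unfolding H_def using S.quad_le unfolding H_def by (rule moment_op_bounded_linear[OF H_exists])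

  \<comment> \<open>The law of one sample and the fourth-moment hypothesis\<close>
  define D where "D = distr P borel (\<lambda>\<omega>. (x \<omega>, y \<omega>))"
  have D_int: "integrable D f \<longleftrightarrow> integrable P (\<lambda>\<omega>. f (x \<omega>, y \<omega>))"
    and D_eq: "(\<integral>p. f p \<partial>D) = (\<integral>\<omega>. f (x \<omega>, y \<omega>) \<partial>P)"
    if "f \<in> borel_measurable borel" for f :: "'h \<times> real \<Rightarrow> real"
    unfolding D_def using that by (simp_all add: integrable_distr_eq integral_distr)
  have Dm [measurable_cong]: "sets D = sets borel" by (simp add: D_def)

  have fourth_quad: "integrable P (\<lambda>\<omega>. inner (x \<omega>) (A (x \<omega>)) * (inner u (x \<omega>))\<^sup>2)"
    "(\<integral>\<omega>. inner (x \<omega>) (A (x \<omega>)) * (inner u (x \<omega>))\<^sup>2 \<partial>P)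
      \<le> \<tau> * op_trace (\<lambda>u. H (A u)) * inner u (H u)" if A: "psd A" for A u
  proof -
    have "bounded_linear A" using A unfolding psd_def by blast
    then have ex: "moment_op_exists P x (\<lambda>\<omega>. inner (x \<omega>) (A (x \<omega>)))" using fourth_exists by blast
    show "integrable P (\<lambda>\<omega>. inner (x \<omega>) (A (x \<omega>)) * (inner u (x \<omega>))\<^sup>2)"
      using moment_quad(1)[OF ex, of u u] by (simp add: power2_eq_square mult.assoc)
    have "inner u (fourth A u) \<le> inner u ((\<tau> * op_trace (\<lambda>u. H (A u))) *\<^sub>R H u)"
      using fourth_le A loewner_le_quad by blast
    then show "(\<integral>\<omega>. inner (x \<omega>) (A (x \<omega>)) * (inner u (x \<omega>))\<^sup>2 \<partial>P)
        \<le> \<tau> * op_trace (\<lambda>u. H (A u)) * inner u (H u)"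
      unfolding fourth_def using moment_quad(2)[OF ex, of u u]
      by (simp add: power2_eq_square mult.assoc)
  qed
  note fourth_id = fourth_quad[OF psd_id, folded power2_norm_eq_inner]
  have rank_one: "inner a (inner b a *\<^sub>R b) = (inner b a)\<^sup>2" for a b :: 'h
    by (simp add: power2_eq_square inner_commute)
  \<comment> \<open>For A = b \<otimes> b the weight <x,Ax> is <b,x>^2 and the trace of HA is
    <b,Hb>.\<close>
  note fourth_rank_one = fourth_quad[OF psd_rank_one, unfolded rank_one
      op_trace_rank_one[OF bounded_linear.linear[OF H_bl]]]

  interpret D: prob_space D
    unfolding D_def by (rule P.prob_space_distr) measurable
  interpret data_model H lam v T D \<tau> \<gamma>
  proof (intro data_model.intro data_model_axioms.intro S.spectral_axioms D.prob_space_axioms)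
    show "sets D = sets borel" by (rule Dm)
    show "bounded_linear H" by (rule H_bl)
    show "integrable D (\<lambda>p. (inner u (fst p))\<^sup>2)" for u
      by (subst D_int) (auto simp: sq_int)
    show "(\<integral>p. inner u (fst p) * inner w (fst p) \<partial>D) = inner u (H w)" for u w
      using H_quad(2)[of w u] by (subst D_eq) (auto simp: mult.commute)
    show "integrable D (\<lambda>p. (norm (fst p))\<^sup>2 * (inner u (fst p))\<^sup>2)" for u
      using fourth_id(1)[of u] by (subst D_int) auto
    show "(\<integral>p. (norm (fst p))\<^sup>2 * (inner u (fst p))\<^sup>2 \<partial>D) \<le> \<tau> * T * inner u (H u)" for u
      using fourth_id(2)[of u] by (subst D_eq) (auto simp: op_T)
    show "integrable D (\<lambda>p. (inner b (fst p))\<^sup>2 * (inner u (fst p))\<^sup>2)" for b u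
      using fourth_rank_one(1)[of b u] by (subst D_int) auto
    show "(\<integral>p. (inner b (fst p))\<^sup>2 * (inner u (fst p))\<^sup>2 \<partial>D)
        \<le> \<tau> * inner b (H b) * inner u (H u)" for b u
      using fourth_rank_one(2)[of b u] by (subst D_eq) auto
    show "0 < \<gamma>" "0 < \<tau>" "\<gamma> * (\<tau> * T) < 1"
      using gamma_pos tau_pos gamma_less by (auto simp: op_T)
  qed

  \<comment> \<open>The risk around its minimiser\<close>
  define \<epsilon> where "\<epsilon> p = snd p - inner (fst p) wstar" for p :: "'h \<times> real"
  have \<epsilon>m[measurable]: "\<epsilon> \<in> borel_measurable borel" unfolding \<epsilon>_def by measurable
  have \<epsilon>_sq: "integrable P (\<lambda>\<omega>. (\<epsilon> (x \<omega>, y \<omega>))\<^sup>2)"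
    using risk_finite by (simp add: \<epsilon>_def inner_commute)
  have \<epsilon>_x: "integrable P (\<lambda>\<omega>. \<epsilon> (x \<omega>, y \<omega>) * inner u (x \<omega>))" for u
    by (rule integrable_mult_of_squares[OF _ _ \<epsilon>_sq sq_int]) measurable
  have risk_expand: "risk P x y (wstar + u)
      = risk P x y wstar - (\<integral>\<omega>. \<epsilon> (x \<omega>, y \<omega>) * inner u (x \<omega>) \<partial>P) + 1/2 * quad u" for u
  proof -
    have "(y \<omega> - inner (wstar + u) (x \<omega>))\<^sup>2
        = (\<epsilon> (x \<omega>, y \<omega>))\<^sup>2 - 2 * (\<epsilon> (x \<omega>, y \<omega>) * inner u (x \<omega>)) + (inner u (x \<omega>))\<^sup>2" for \<omega>
      by (simp add: \<epsilon>_def inner_add_left inner_commute[of "x \<omega>" wstar] power2_eq_square algebra_simps)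
    then have "(\<integral>\<omega>. (y \<omega> - inner (wstar + u) (x \<omega>))\<^sup>2 \<partial>P)
        = (\<integral>\<omega>. (\<epsilon> (x \<omega>, y \<omega>))\<^sup>2 \<partial>P) - 2 * (\<integral>\<omega>. \<epsilon> (x \<omega>, y \<omega>) * inner u (x \<omega>) \<partial>P) + quad u"
      using \<epsilon>_sq \<epsilon>_x sq_int by (simp add: sq_eq)
    moreover have "(\<integral>\<omega>. (y \<omega> - inner wstar (x \<omega>))\<^sup>2 \<partial>P) = (\<integral>\<omega>. (\<epsilon> (x \<omega>, y \<omega>))\<^sup>2 \<partial>P)"
      by (simp add: \<epsilon>_def inner_commute)
    ultimately show ?thesis unfolding risk_def by (simp add: algebra_simps)
  qed
  \<comment> \<open>Minimality on each line through \<open>wstar\<close> forces the normal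
    equations. They are the only centring of the noise, and they reduce the excess risk to half the
    quadratic form.\<close>
  have \<epsilon>_mean: "(\<integral>\<omega>. \<epsilon> (x \<omega>, y \<omega>) * inner u (x \<omega>) \<partial>P) = 0" for u
  proof (rule zero_of_quadratic_nonneg)
    fix s :: real
    have "\<not> risk P x y (wstar + s *\<^sub>R u) < risk P x y wstar"
      using wstar unfolding min_norm_minimizer_def is_arg_min_def by blast
    moreover have "quad (s *\<^sub>R u) = s\<^sup>2 * quad u"
      using bounded_linear.linear[OF H_bl] by (simp add: linear_scale power2_eq_square)
    moreover have "(\<integral>\<omega>. \<epsilon> (x \<omega>, y \<omega>) * inner (s *\<^sub>R u) (x \<omega>) \<partial>P)
        = s * (\<integral>\<omega>. \<epsilon> (x \<omega>, y \<omega>) * inner u (x \<omega>) \<partial>P)"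
      by (subst integral_mult_right_zero[symmetric]) (simp add: mult_ac)
    ultimately show "0 \<le> s\<^sup>2 * quad u - 2 * s * (\<integral>\<omega>. \<epsilon> (x \<omega>, y \<omega>) * inner u (x \<omega>) \<partial>P)"
      unfolding risk_expand by simp
  qed
  have risk_eq: "risk P x y (wstar + u) = risk P x y wstar + 1/2 * quad u" for u
    unfolding risk_expand \<epsilon>_mean by simp
  have Sig_eq: "((inner wstar (x \<omega>) - y \<omega>)\<^sup>2 * inner u (x \<omega>)) * inner u (x \<omega>)
      = (\<epsilon> (x \<omega>, y \<omega>) * inner u (x \<omega>))\<^sup>2" for u \<omega>
    by (simp add: \<epsilon>_def inner_commute[of "x \<omega>" wstar] power2_eq_square algebra_simps)
  note Sig = moment_quad[OF Sigma_exists, of u u for u, unfolded Sig_eq, folded Sigma_def]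
  note whitened = whitened_norm_le[OF sigma_finite H_nonneg, folded sigma2_def]

  \<comment> \<open>Bias and variance as two instances of one process\<close>
  obtain N where n: "n = M * N" using M_dvd by blast
  have N: "n div M = N" "N \<ge> 1" using n M_pos n_pos by auto
  define d where "d = (\<lambda>(m, t) \<omega>. (X m t \<omega>, Y m t \<omega>))"
  have d_indep: "Q.indep_vars (\<lambda>_. borel) d ({1..M} \<times> {1..N})"
    using data_indep unfolding d_def N .
  have d_distr: "distr Q borel (d (m, t)) = D" if "m \<in> {1..M}" "t \<in> {1..N}" for m t
    using data_distr that unfolding d_def D_def N by simp

  interpret B: sgd_process H lam v T D \<tau> \<gamma> Q d M N "w1 - wstar" "\<lambda>_. 0" 0
    by unfold_locales (use d_indep d_distr in auto)
  interpret V: sgd_process H lam v T D \<tau> \<gamma> Q d M N 0 \<epsilon> \<sigma>2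
  proof unfold_locales
    show "integrable D (\<lambda>p. (\<epsilon> p * inner u (fst p))\<^sup>2)" for u
      using Sig(1)[of u] by (subst D_int) auto
    show "(\<integral>p. \<epsilon> p * inner u (fst p) \<partial>D) = 0" for u
      using \<epsilon>_mean[of u] by (subst D_eq) auto
    show "(\<integral>p. (\<epsilon> p * inner u (fst p))\<^sup>2 \<partial>D) \<le> \<sigma>2 * quad u" for u
      using Sig(2)[of u] whitened(2)[of u] by (subst D_eq) auto
    show "0 \<le> \<sigma>2" by (rule whitened(1))
  qed (use d_indep d_distr in auto)

  \<comment> \<open>Excess risk and the final constants\<close>
  define bbar where "bbar = (\<lambda>\<omega>. dist_avg n M (\<lambda>m. bias_iter \<gamma> (w1 - wstar) (\<lambda>t. X m t \<omega>)))"
  define vbar where "vbar = (\<lambda>\<omega>. dist_avg n M (\<lambda>m. var_iter \<gamma> (\<lambda>t. X m t \<omega>)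
      (\<lambda>t. Y m t \<omega> - inner (X m t \<omega>) wstar)))"
  define wbar where "wbar = (\<lambda>\<omega>. dist_avg n M (\<lambda>m. sgd_iter \<gamma> w1 (\<lambda>t. X m t \<omega>) (\<lambda>t. Y m t \<omega>)))"
  define k where "k = cutoff_index lam (real M / (\<gamma> * real n))"
  have bbar: "bbar = B.avg"
    unfolding bbar_def B.avg_def B.z_def n
    by (simp add: d_def flip: bias_iter_eq_proc)
  have vbar: "vbar = V.avg"
    unfolding vbar_def V.avg_def V.z_def n
    by (simp add: d_def \<epsilon>_def flip: var_iter_eq_proc)
  have wbar: "wbar \<omega> = wstar + (bbar \<omega> + vbar \<omega>)" for \<omega>
  proof -
    have "wbar \<omega> = dist_avg n M (\<lambda>m t. (wstar + bias_iter \<gamma> (w1 - wstar) (\<lambda>t. X m t \<omega>) t)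
        + var_iter \<gamma> (\<lambda>t. X m t \<omega>) (\<lambda>t. Y m t \<omega> - inner (X m t \<omega>) wstar) t)"
      unfolding wbar_def by (simp add: sgd_iter_eq[where w = wstar, abs_def])
    also have "\<dots> = (wstar + bbar \<omega>) + vbar \<omega>"
      unfolding dist_avg_add dist_avg_const[OF M_pos n_pos M_dvd] bbar_def vbar_def ..
    finally show ?thesis by (simp add: add.assoc)
  qed
  note bias = B.bias_le[OF M_pos N(2) refl refl, folded bbar]
  note variance = V.variance_le[OF M_pos N(2) refl, folded vbar]
  have [measurable]: "bbar \<in> borel_measurable Q" "vbar \<in> borel_measurable Q"
    unfolding bbar vbar by (rule B.avg_measurable[OF M_pos N(2)] V.avg_measurable[OF M_pos N(2)])+
  \<comment> \<open>Half of the parallelogram inequality, from nonnegativity of the form at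
    \<open>bbar \<omega> - vbar \<omega>\<close>. Since \<open>half_energy\<close> carries 1/2, the
    right side integrates to twice the bias plus twice the variance.\<close>
  have excess_le: "1/2 * quad (bbar \<omega> + vbar \<omega>) \<le> quad (bbar \<omega>) + quad (vbar \<omega>)" for \<omega>
  proof -
    have "0 \<le> quad (bbar \<omega> - vbar \<omega>)" by (rule H_nonneg)
    moreover note lin = linear_add[OF bounded_linear.linear[OF H_bl]] linear_diff[OF bounded_linear.linear[OF H_bl]]
    ultimately show ?thesis
      by (simp add: lin inner_add_left inner_add_right inner_diff_left inner_diff_right)
  qed
  have excess_int: "integrable Q (\<lambda>\<omega>. 1/2 * quad (bbar \<omega> + vbar \<omega>))"
  proof (rule Bochner_Integration.integrable_bound)
    show "integrable Q (\<lambda>\<omega>. quad (bbar \<omega>) + quad (vbar \<omega>))"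
      by (intro Bochner_Integration.integrable_add bias(1) variance(1))
    show "(\<lambda>\<omega>. 1/2 * quad (bbar \<omega> + vbar \<omega>)) \<in> borel_measurable Q" by measurable
    have "norm (1/2 * quad (bbar \<omega> + vbar \<omega>)) \<le> norm (quad (bbar \<omega>) + quad (vbar \<omega>))" for \<omega>
      unfolding real_norm_def
      using excess_le[of \<omega>] H_nonneg[of "bbar \<omega> + vbar \<omega>"] by linarith
    then show "AE \<omega> in Q. norm (1/2 * quad (bbar \<omega> + vbar \<omega>)) \<le> norm (quad (bbar \<omega>) + quad (vbar \<omega>))"
      by (rule AE_I2)
  qed
  have risk_int: "integrable Q (\<lambda>\<omega>. risk P x y (wbar \<omega>))"
    unfolding wbar risk_eq using excess_int by simp
  have "(\<integral>\<omega>. risk P x y (wbar \<omega>) \<partial>Q) - risk P x y wstar = (\<integral>\<omega>. 1/2 * quad (bbar \<omega> + vbar \<omega>) \<partial>Q)"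
    unfolding wbar risk_eq using excess_int by (simp add: Q.prob_space)
  also have "\<dots> \<le> (\<integral>\<omega>. quad (bbar \<omega>) + quad (vbar \<omega>) \<partial>Q)"
    using excess_le excess_int bias(1) variance(1) by (intro integral_mono) auto
  also have "\<dots> = 2 * half_energy Q H bbar + 2 * half_energy Q H vbar"
    unfolding half_energy_def using bias(1) variance(1) by simp
  finally have excess: "(\<integral>\<omega>. risk P x y (wbar \<omega>) \<partial>Q) - risk P x y wstar
      \<le> 2 * half_energy Q H bbar + 2 * half_energy Q H vbar" .
  \<comment> \<open>The bias process starts at -wstar because \<open>w1\<close> is 0, and all three
    weighted norms are even.\<close>
  have neg: "normsq_pinv_head lam v k (w1 - wstar) = normsq_pinv_head lam v k wstar"
    "normsq_id_head v k (w1 - wstar) = normsq_id_head v k wstar"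
    "normsq_tail lam v k (w1 - wstar) = normsq_tail lam v k wstar"
    unfolding w1 by (simp_all add: normsq_pinv_head_def normsq_id_head_def normsq_tail_def)
  have const: "(real M)\<^sup>2 / (\<gamma>\<^sup>2 * (real n)\<^sup>2) = 1 / (\<gamma> * N)\<^sup>2"
      "real n / real M = N"
      "2 * \<tau> * (real M)\<^sup>2 * b / (\<gamma> * real n * c) * V = 2 * \<tau> * b / (\<gamma> * N * c) * (M * V)" for b c V :: real
    using M_pos N(2) gamma_pos by (simp_all add: n power2_eq_square field_simps)
  have "half_energy Q H bbar \<le> (real M)\<^sup>2 / (\<gamma>\<^sup>2 * (real n)\<^sup>2) * normsq_pinv_head lam v k wstar
               + normsq_tail lam v k wstar
               + 2 * \<tau> * (real M)\<^sup>2
                   * (normsq_id_head v k wstar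
                        + \<gamma> * (real n / real M) * normsq_tail lam v k wstar)
                   / (\<gamma> * real n * (1 - \<gamma> * \<tau> * op_trace H))
                 * V_term lam \<gamma> n M k"
    using bias(2)[of k] unfolding const neg op_T n[symmetric] .
  moreover have "half_energy Q H vbar \<le> \<sigma>2 / (1 - \<gamma> * \<tau> * op_trace H) * V_term lam \<gamma> n M k"
    using variance(2)[of k] unfolding op_T n[symmetric] .
  ultimately show ?thesis
    unfolding Let_def bbar_def[symmetric] vbar_def[symmetric] wbar_def[symmetric] k_def[symmetric]
    using risk_int bias(1) variance(1) excess by blast
qed

end
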